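(* Let $\varphi(x,y)=f(\langle x,y\rangle)$ be a Markov kernel on $\mathbb{S}^{d-1}$ such that $f$ is monotone, $f$ is continuous, $\lambda(\varphi)>0$, and $|\lambda_i|\le\lambda(\varphi)$ for every $i\ge1$. Let $q>1$ and let $T$ be a tree of growth at most $q$. There exists a universal constant $c>0$ such that if $$q\le\left(1-c\,\frac{\ln(\lambda(\varphi))\,(1-\lambda(\varphi))^2}{\ln\left(\frac{\lambda(\varphi)(1-\lambda(\varphi))}{f(1)}\right)}\right)^{-1},$$ then the model has zero percolation of information, i.e. $\lim_{k\to\infty}\mathbb E[\mathrm{TV}(\mu_k,\sigma)]=0$.
   Context: $\sigma$ is the uniform probability measure on $\mathbb{S}^{d-1}$. A Markov kernel here means $f:[-1,1]\to[0,\infty)$ with $\int\varphi(x,y)\,d\sigma(y)=1$ for all $x$. $A_\varphi g(x)=\int\varphi(x,y)g(y)\,d\sigma(y)$ has the spherical harmonics $\{\psi_i\}_{i\ge0}$ as eigenfunctions ($\psi_0\equiv1$, $\psi_1,\dots,\psi_d$ linear), with eigenvalue $\lambda_i$ for $\psi_i$; $\lambda(\varphi):=\lambda_1=\dots=\lambda_d=\int\langle x,e_1\rangle\varphi(e_1,x)\,d\sigma(x)$. A rooted tree $T$ (root $r$, $T_k$ the set of nodes at depth $k$) is of growth at most $q$ if $|T_k|\le\lceil q^k\rceil$ for every $k\in\mathbb N$. Labels: $g(r)$ is uniform on $\mathbb{S}^{d-1}$; iteratively, each node $u$ at level $\ell+1$ with parent $v$ receives, independently of the other nodes of level $\ell+1$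 given level $\ell$, a label with law $\varphi(g(v),\cdot)\,d\sigma$. $\mu_k$ is the conditional law of $g(r)$ given $(g(v))_{v\in T_k}$. Zero percolation of information means $\lim_{k\to\infty}\mathbb E[\mathrm{TV}(\mu_k,\sigma)]=0$. *)

theory Defs
  imports "HOL-Probability.Probability"
begin

text \<open>Points of R^d are represented as extensional functions nat => real supported on
  {..<d} (the carrier of the product measure PiM {..<d} (\<lambda>_. lborel)), so that the
  dimension d can be quantified inside the statement.\<close>

definition Rd :: "nat \<Rightarrow> (nat \<Rightarrow> real) measure" where
  "Rd d = PiM {..<d} (\<lambda>_. lborel)"

definition ip :: "nat \<Rightarrow> (nat \<Rightarrow> real) \<Rightarrow> (nat \<Rightarrow> real) \<Rightarrow> real" where
  "ip d x y = (\<Sum>i<d. x i * y i)"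

definition sphere_pts :: "nat \<Rightarrow> (nat \<Rightarrow> real) set" where
  "sphere_pts d = {x \<in> space (Rd d). ip d x x = 1}"

definition ball_pts :: "nat \<Rightarrow> (nat \<Rightarrow> real) set" where
  "ball_pts d = {x \<in> space (Rd d). ip d x x \<le> 1}"

definition e1 :: "nat \<Rightarrow> nat \<Rightarrow> real" where
  "e1 d = (\<lambda>i\<in>{..<d}. if i = 0 then 1 else 0)"

definition radial :: "nat \<Rightarrow> (nat \<Rightarrow> real) \<Rightarrow> (nat \<Rightarrow> real)" where
  "radial d x = (if ip d x x = 0 then e1 d else (\<lambda>i\<in>{..<d}. x i / sqrt (ip d x x)))"

text \<open>Uniform probability measure sigma on S^{d-1}: the normalized surface measure, realised as
  the cone measure, i.e. the image of the uniform distribution on the unit ball under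
  radial projection x \<mapsto> x/|x|.\<close>
definition sph :: "nat \<Rightarrow> (nat \<Rightarrow> real) measure" where
  "sph d = distr (uniform_measure (Rd d) (ball_pts d))
                 (restrict_space (Rd d) (sphere_pts d)) (radial d)"

definition markov_kernel :: "nat \<Rightarrow> (real \<Rightarrow> real) \<Rightarrow> bool" where
  "markov_kernel d f \<longleftrightarrow> (\<forall>t\<in>{-1..1}. 0 \<le> f t) \<and>
     (\<forall>x\<in>sphere_pts d. (\<integral>y. f (ip d x y) \<partial>sph d) = 1)"

definition kernel_op :: "nat \<Rightarrow> (real \<Rightarrow> real) \<Rightarrow> ((nat \<Rightarrow> real) \<Rightarrow> real) \<Rightarrow> (nat \<Rightarrow> real) \<Rightarrow> real" where
  "kernel_op d f g x = (\<integral>y. f (ip d x y) * g y \<partial>sph d)"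

definition lam :: "nat \<Rightarrow> (real \<Rightarrow> real) \<Rightarrow> real" where
  "lam d f = (\<integral>x. ip d x (e1 d) * f (ip d (e1 d) x) \<partial>sph d)"

text \<open>Polynomials in d variables, given by a finitely supported coefficient function on
  multi-indices alpha :: nat => nat (with alpha i = 0 for i >= d).\<close>
definition poly_eval :: "nat \<Rightarrow> ((nat \<Rightarrow> nat) \<Rightarrow> real) \<Rightarrow> (nat \<Rightarrow> real) \<Rightarrow> real" where
  "poly_eval d c x = (\<Sum>\<alpha>\<in>{\<alpha>. c \<alpha> \<noteq> 0}. c \<alpha> * (\<Prod>i<d. x i ^ \<alpha> i))"

text \<open>c is a homogeneous harmonic polynomial of degree k in d variables. The Laplacian of
  sum_alpha c_alpha x^alpha has coefficient at beta equal to
  sum_i (beta_i+2)(beta_i+1) c_(beta + 2 e_i).\<close>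
definition harmonic_hom_poly :: "nat \<Rightarrow> nat \<Rightarrow> ((nat \<Rightarrow> nat) \<Rightarrow> real) \<Rightarrow> bool" where
  "harmonic_hom_poly d k c \<longleftrightarrow>
     finite {\<alpha>. c \<alpha> \<noteq> 0} \<and>
     (\<forall>\<alpha>. c \<alpha> \<noteq> 0 \<longrightarrow> (\<forall>i\<ge>d. \<alpha> i = 0) \<and> (\<Sum>i<d. \<alpha> i) = k) \<and>
     (\<forall>\<beta>. (\<Sum>i<d. real ((\<beta> i + 2) * (\<beta> i + 1)) * c (\<beta>(i := \<beta> i + 2))) = 0)"

definition spherical_harmonic :: "nat \<Rightarrow> nat \<Rightarrow> ((nat \<Rightarrow> real) \<Rightarrow> real) \<Rightarrow> bool" where
  "spherical_harmonic d k \<psi> \<longleftrightarrow>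
     (\<exists>c. harmonic_hom_poly d k c \<and> (\<forall>x\<in>sphere_pts d. \<psi> x = poly_eval d c x)) \<and>
     (\<exists>x\<in>sphere_pts d. \<psi> x \<noteq> 0)"

definition spectral_bound :: "nat \<Rightarrow> (real \<Rightarrow> real) \<Rightarrow> bool" where
  "spectral_bound d f \<longleftrightarrow>
     (\<forall>k\<ge>1. \<forall>\<psi> \<mu>. spherical_harmonic d k \<psi> \<and>
        (\<forall>x\<in>sphere_pts d. kernel_op d f \<psi> x = \<mu> * \<psi> x) \<longrightarrow> \<bar>\<mu>\<bar> \<le> lam d f)"

text \<open>A rooted tree is a set of nodes nat list containing the root [] and closed under taking
  parents (parent v = butlast v). Depth of v is length v.\<close>
definition is_tree :: "nat list set \<Rightarrow> bool" where
  "is_tree T \<longleftrightarrow> [] \<in> T \<and> (\<forall>v\<in>T. v \<noteq> [] \<longrightarrow> butlast v \<in> T)"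

definition level :: "nat list set \<Rightarrow> nat \<Rightarrow> nat list set" where
  "level T k = {v\<in>T. length v = k}"

definition growth_at_most :: "real \<Rightarrow> nat list set \<Rightarrow> bool" where
  "growth_at_most q T \<longleftrightarrow> (\<forall>k. finite (level T k) \<and> real (card (level T k)) \<le> of_int \<lceil>q ^ k\<rceil>)"

text \<open>Labels of nodes of depth < k (including the root) are u, labels of level k are y.
  The joint law of all labels up to depth k has density
  prod_{v, 1 <= depth v <= k} phi(g(parent v), g(v)) w.r.t. the product of sigma's
  (root uniform, each child drawn independently from phi(g(parent),.) d sigma).\<close>
definition inner_nodes :: "nat list set \<Rightarrow> nat \<Rightarrow> nat list set" where
  "inner_nodes T k = {v\<in>T. length v < k}"

definition joint_dens :: "nat \<Rightarrow> (real \<Rightarrow> real) \<Rightarrow> nat list set \<Rightarrow> nat \<Rightarrow>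
     (nat list \<Rightarrow> nat \<Rightarrow> real) \<Rightarrow> (nat list \<Rightarrow> nat \<Rightarrow> real) \<Rightarrow> real" where
  "joint_dens d f T k u y =
     (let g = (\<lambda>v. if length v < k then u v else y v)
      in \<Prod>v\<in>{v\<in>T. 0 < length v \<and> length v \<le> k}. f (ip d (g (butlast v)) (g v)))"

definition obs_dens :: "nat \<Rightarrow> (real \<Rightarrow> real) \<Rightarrow> nat list set \<Rightarrow> nat \<Rightarrow> (nat list \<Rightarrow> nat \<Rightarrow> real) \<Rightarrow> real" where
  "obs_dens d f T k y = (\<integral>u. joint_dens d f T k u y \<partial>PiM (inner_nodes T k) (\<lambda>_. sph d))"

definition obs_law :: "nat \<Rightarrow> (real \<Rightarrow> real) \<Rightarrow> nat list set \<Rightarrow> nat \<Rightarrow> (nat list \<Rightarrow> nat \<Rightarrow> real) measure" where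
  "obs_law d f T k = density (PiM (level T k) (\<lambda>_. sph d)) (\<lambda>y. ennreal (obs_dens d f T k y))"

definition posterior :: "nat \<Rightarrow> (real \<Rightarrow> real) \<Rightarrow> nat list set \<Rightarrow> nat \<Rightarrow> (nat list \<Rightarrow> nat \<Rightarrow> real) \<Rightarrow> (nat \<Rightarrow> real) measure" where
  "posterior d f T k y =
     distr (density (PiM (inner_nodes T k) (\<lambda>_. sph d))
              (\<lambda>u. ennreal (joint_dens d f T k u y / obs_dens d f T k y)))
           (sph d) (\<lambda>u. u [])"

definition TV :: "'a measure \<Rightarrow> 'a measure \<Rightarrow> real" where
  "TV \<mu> \<nu> = (SUP A\<in>sets \<nu>. \<bar>measure \<mu> A - measure \<nu> A\<bar>)"

definition expected_TV :: "nat \<Rightarrow> (real \<Rightarrow> real) \<Rightarrow> nat list set \<Rightarrow> nat \<Rightarrow> real" where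
  "expected_TV d f T k = (\<integral>y. TV (posterior d f T k y) (sph d) \<partial>obs_law d f T k)"

definition zero_percolation :: "nat \<Rightarrow> (real \<Rightarrow> real) \<Rightarrow> nat list set \<Rightarrow> bool" where
  "zero_percolation d f T \<longleftrightarrow> (\<lambda>k. expected_TV d f T k) \<longlonglongrightarrow> 0"

end

theory Submission
  imports Defs
begin

text \<open>Let \<open>A\<close> be the averaging operator of the kernel. Coupling along the reflection that exchanges two
  points shows that, for monotone \<open>f\<close>, \<open>A\<close> multiplies Lipschitz constants by the eigenvalue \<open>lam d f\<close> of the
  linear functions. Since \<open>A\<close> is self-adjoint, it then contracts mean-zero functions in \<open>L\<^sup>2\<close> by the same
  factor, and
  \<open>\<parallel>A\<^sup>n g - \<integral>g\<parallel> \<le> 4 \<parallel>g\<parallel> / s\<^sup>n\<close> in sup norm, where \<open>s = exp (1 / (4 M))\<close> and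
  \<open>M = ln (\<lambda> (1 - \<lambda>) / f 1) / ln \<lambda>\<close>.

  For a likelihood \<open>F z y\<close> of an observation \<open>y\<close> given the label \<open>z\<close>, let \<open>C\<close> be the least number such that
  \<open>\<integral>|A\<^sup>n (F \<cdot> y - mean) z| dy \<le> C / s\<^sup>n\<close> for all \<open>n\<close> and \<open>z\<close>. Passing one edge of the tree divides \<open>C\<close> by \<open>s\<close>;
  combining conditionally independent observations multiplies \<open>1 + 4 C\<close>; and always \<open>C \<le> 4\<close>. Hence
  \<open>ln (1 + 4 C)\<close> is subadditive over the children of a node and shrinks along every edge by a factor
  \<open>\<eta> = 1 - (1 - 1 / s) / 34\<close>, so that at the root it is at most \<open>\<eta>\<^bsup>k-1\<^esup> |T\<^sub>k| ln 17\<close>, which tends to \<open>0\<close> if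
  \<open>q \<eta> < 1\<close>.\<close>

section \<open>Bounded measurable functions and symmetric Markov kernels\<close>

text \<open>Asking for decay at every time n, and not only at n = 0, lets the induction on the tree
  close. In a product of two centred likelihoods only the \<open>L1\<close> size C D survives;
  mixing restores its decay in n at the price of a factor 4, which is why 1 + 4 C is the
  multiplicative quantity. The cap C \<le> 4 matters because ln (1 + x / s) behaves like ln (1 + x)
  - ln s for large x, so a proportional contraction holds only on a bounded range of x. The rate s
  is deliberately slower than 1 / \<lambda>: the natural sup-norm estimate of the powers of A
  carries a factor sqrt (f 1), from the mean-square size of a kernel section, and M turns this
  factor into a longer time scale, leaving the universal constant 4. A continuous profile f need not
  be Lipschitz, so polynomials stand in for it; this is harmless because the mean-square contraction
  does not remember the Lipschitz constant. The only symmetries of the sphere that are used are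
  reflections.\<close>

definition bdd_meas :: "'a measure \<Rightarrow> ('a \<Rightarrow> real) \<Rightarrow> bool" where
  "bdd_meas M g \<longleftrightarrow> g \<in> borel_measurable M \<and> (\<exists>c. \<forall>x\<in>space M. \<bar>g x\<bar> \<le> c)"

lemma bdd_measI: "g \<in> borel_measurable M \<Longrightarrow> (\<And>x. x \<in> space M \<Longrightarrow> \<bar>g x\<bar> \<le> c) \<Longrightarrow> bdd_meas M g"
  unfolding bdd_meas_def by blast

lemma bdd_measD [measurable_dest]: "bdd_meas M g \<Longrightarrow> g \<in> borel_measurable M"
  unfolding bdd_meas_def by blast

lemma bdd_measE:
  assumes "bdd_meas M g"
  obtains c where "c \<ge> 0" "\<And>x. x \<in> space M \<Longrightarrow> \<bar>g x\<bar> \<le> c"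
proof -
  from assms obtain c where "\<forall>x\<in>space M. \<bar>g x\<bar> \<le> c" unfolding bdd_meas_def by blast
  then show thesis by (intro that[of "max c 0"]) fastforce+
qed

lemma bdd_meas_const: "bdd_meas M (\<lambda>x. c)"
  by (rule bdd_measI[where c="\<bar>c\<bar>"]) auto

lemma bdd_meas_add:
  assumes "bdd_meas M g" "bdd_meas M h"
  shows "bdd_meas M (\<lambda>x. g x + h x)"
proof -
  note [measurable] = assms[THEN bdd_measD]
  from assms obtain c c' where "\<And>x. x \<in> space M \<Longrightarrow> \<bar>g x\<bar> \<le> c" "\<And>x. x \<in> space M \<Longrightarrow> \<bar>h x\<bar> \<le> c'"
    by (metis bdd_measE)
  then show ?thesis by (intro bdd_measI[where c="c+c'"]) (auto intro: order_trans[OF abs_triangle_ineq] add_mono)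
qed

lemma bdd_meas_mult:
  assumes "bdd_meas M g" "bdd_meas M h"
  shows "bdd_meas M (\<lambda>x. g x * h x)"
proof -
  note [measurable] = assms[THEN bdd_measD]
  from assms obtain c c' where "c \<ge> 0" "\<And>x. x \<in> space M \<Longrightarrow> \<bar>g x\<bar> \<le> c" "\<And>x. x \<in> space M \<Longrightarrow> \<bar>h x\<bar> \<le> c'"
    by (metis bdd_measE)
  then show ?thesis by (intro bdd_measI[where c="c*c'"]) (auto simp: abs_mult intro!: mult_mono)
qed

lemma bdd_meas_diff:
  assumes "bdd_meas M g" "bdd_meas M h"
  shows "bdd_meas M (\<lambda>x. g x - h x)"
  using bdd_meas_add[OF assms(1) bdd_meas_mult[OF bdd_meas_const[of _ "-1"] assms(2)]] by simp

lemma bdd_meas_abs: "bdd_meas M g \<Longrightarrow> bdd_meas M (\<lambda>x. \<bar>g x\<bar>)"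
  unfolding bdd_meas_def by auto

lemma bdd_meas_prod:
  assumes "\<And>i. i \<in> I \<Longrightarrow> bdd_meas M (g i)"
  shows "bdd_meas M (\<lambda>x. \<Prod>i\<in>I. g i x)"
  using assms by (induction I rule: infinite_finite_induct) (auto intro: bdd_meas_const bdd_meas_mult)

lemma bdd_meas_compose:
  assumes "bdd_meas N g" "h \<in> measurable M N"
  shows "bdd_meas M (\<lambda>x. g (h x))"
proof -
  note [measurable] = assms(2) assms(1)[THEN bdd_measD]
  from assms(1) obtain c where "\<And>x. x \<in> space N \<Longrightarrow> \<bar>g x\<bar> \<le> c" by (metis bdd_measE)
  then show ?thesis by (intro bdd_measI[where c=c]) (auto simp: measurable_space[OF assms(2)])
qed

lemma bdd_meas_cong: "(\<And>x. x \<in> space M \<Longrightarrow> g x = h x) \<Longrightarrow> bdd_meas M g = bdd_meas M h"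
  unfolding bdd_meas_def using measurable_cong[of M g h borel] by simp

lemma (in finite_measure) bdd_meas_integrable: "bdd_meas M g \<Longrightarrow> integrable M g"
  unfolding bdd_meas_def using integrable_const_bound[of g] by auto

lemma (in prob_space) abs_integral_le:
  fixes g :: "'a \<Rightarrow> real"
  assumes "g \<in> borel_measurable M" "\<And>x. x \<in> space M \<Longrightarrow> \<bar>g x\<bar> \<le> c"
  shows "\<bar>\<integral>x. g x \<partial>M\<bar> \<le> c"
proof -
  have i: "integrable M g" by (rule bdd_meas_integrable) (use assms in \<open>auto intro: bdd_measI\<close>)
  have "\<bar>\<integral>x. g x \<partial>M\<bar> \<le> (\<integral>x. \<bar>g x\<bar> \<partial>M)" by (rule integral_abs_bound)
  also have "\<dots> \<le> (\<integral>x. c \<partial>M)" using i assms by (intro integral_mono) auto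
  finally show ?thesis by (simp add: prob_space)
qed

lemma bdd_meas_lebesgue_integral:
  assumes "prob_space N" and G: "bdd_meas (M \<Otimes>\<^sub>M N) (\<lambda>(z, y). G z y)"
  shows "bdd_meas M (\<lambda>z. \<integral>y. G z y \<partial>N)"
proof -
  interpret N: prob_space N by fact
  note [measurable] = G[THEN bdd_measD]
  from G obtain c where c: "\<And>z y. z \<in> space M \<Longrightarrow> y \<in> space N \<Longrightarrow> \<bar>G z y\<bar> \<le> c"
    by (force elim: bdd_measE simp: space_pair_measure)
  show ?thesis by (intro bdd_measI[where c=c] N.abs_integral_le c) auto
qed

lemma bdd_meas_swap:
  "bdd_meas (M \<Otimes>\<^sub>M N) (\<lambda>(z, y). G z y) \<Longrightarrow> bdd_meas (N \<Otimes>\<^sub>M M) (\<lambda>(y, z). G z y)"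
  using bdd_meas_compose[of "M \<Otimes>\<^sub>M N" "\<lambda>(z, y). G z y" "\<lambda>(y, z). (z, y)" "N \<Otimes>\<^sub>M M"]
  by (auto simp: case_prod_beta')

lemma bdd_meas_fst: "bdd_meas M g \<Longrightarrow> bdd_meas (M \<Otimes>\<^sub>M N) (\<lambda>(z, y). g z)"
  using bdd_meas_compose[of M g fst "M \<Otimes>\<^sub>M N"] by (auto simp: case_prod_beta')

lemma bdd_meas_snd: "bdd_meas N g \<Longrightarrow> bdd_meas (M \<Otimes>\<^sub>M N) (\<lambda>(z, y). g y)"
  using bdd_meas_compose[of N g snd "M \<Otimes>\<^sub>M N"] by (auto simp: case_prod_beta')

lemma bdd_meas_section:
  "bdd_meas (M \<Otimes>\<^sub>M N) (\<lambda>(z, y). G z y) \<Longrightarrow> y \<in> space N \<Longrightarrow> bdd_meas M (\<lambda>z. G z y)"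
  using bdd_meas_compose[of "M \<Otimes>\<^sub>M N" "\<lambda>(z, y). G z y" "\<lambda>z. (z, y)" M] by auto

lemma bdd_meas_section':
  "bdd_meas (M \<Otimes>\<^sub>M N) (\<lambda>(z, y). G z y) \<Longrightarrow> z \<in> space M \<Longrightarrow> bdd_meas N (\<lambda>y. G z y)"
  using bdd_meas_compose[of "M \<Otimes>\<^sub>M N" "\<lambda>(z, y). G z y" "\<lambda>y. (z, y)" N] by auto

lemma bdd_meas_mult2:
  "bdd_meas (M \<Otimes>\<^sub>M N) (\<lambda>(z, y). G z y) \<Longrightarrow> bdd_meas (M \<Otimes>\<^sub>M N) (\<lambda>(z, y). H z y) \<Longrightarrow>
   bdd_meas (M \<Otimes>\<^sub>M N) (\<lambda>(z, y). G z y * H z y)"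
  using bdd_meas_mult[of "M \<Otimes>\<^sub>M N" "\<lambda>(z, y). G z y" "\<lambda>(z, y). H z y"] by (simp add: case_prod_beta')

lemma bdd_meas_diff2:
  "bdd_meas (M \<Otimes>\<^sub>M N) (\<lambda>(z, y). G z y) \<Longrightarrow> bdd_meas (M \<Otimes>\<^sub>M N) (\<lambda>(z, y). H z y) \<Longrightarrow>
   bdd_meas (M \<Otimes>\<^sub>M N) (\<lambda>(z, y). G z y - H z y)"
  using bdd_meas_diff[of "M \<Otimes>\<^sub>M N" "\<lambda>(z, y). G z y" "\<lambda>(z, y). H z y"] by (simp add: case_prod_beta')

lemma bdd_meas_Fubini:
  assumes "prob_space M" "prob_space N" "bdd_meas (M \<Otimes>\<^sub>M N) (\<lambda>(z, y). G z y)"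
  shows "(\<integral>z. (\<integral>y. G z y \<partial>N) \<partial>M) = (\<integral>y. (\<integral>z. G z y \<partial>M) \<partial>N)"
proof -
  interpret M: prob_space M by fact
  interpret N: prob_space N by fact
  interpret P: pair_prob_space M N ..
  show ?thesis by (rule P.Fubini_integral[OF P.bdd_meas_integrable[OF assms(3)], symmetric])
qed

section \<open>The averaging operator of a symmetric kernel on an abstract probability space\<close>

locale symmetric_kernel = prob_space S for S :: "'a measure" +
  fixes \<phi> :: "'a \<Rightarrow> 'a \<Rightarrow> real"
  assumes kernel_bdd: "bdd_meas (S \<Otimes>\<^sub>M S) (\<lambda>(x, y). \<phi> x y)"
    and kernel_nonneg: "x \<in> space S \<Longrightarrow> y \<in> space S \<Longrightarrow> 0 \<le> \<phi> x y"
    and kernel_sym: "x \<in> space S \<Longrightarrow> y \<in> space S \<Longrightarrow> \<phi> x y = \<phi> y x"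
    and kernel_integral: "x \<in> space S \<Longrightarrow> (\<integral>y. \<phi> x y \<partial>S) = 1"
begin

definition avg :: "('a \<Rightarrow> real) \<Rightarrow> 'a \<Rightarrow> real" where
  "avg g x = (\<integral>y. \<phi> x y * g y \<partial>S)"

definition center :: "('a \<Rightarrow> real) \<Rightarrow> 'a \<Rightarrow> real" where
  "center g x = g x - (\<integral>y. g y \<partial>S)"

lemma kernel_section: "x \<in> space S \<Longrightarrow> bdd_meas S (\<phi> x)"
  using bdd_meas_section'[OF kernel_bdd] .

text \<open>The observation y is carried along as a parameter: the integrand lives on (S x N) x S
  and the last variable is integrated out. The Fubini exchanges below need measurability in (z, y)
  jointly, not only section by section.\<close>

lemma avg_joint:
  assumes "prob_space N" "bdd_meas (S \<Otimes>\<^sub>M N) (\<lambda>(z, y). G z y)"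
  shows "bdd_meas (S \<Otimes>\<^sub>M N) (\<lambda>(z, y). avg (\<lambda>z. G z y) z)"
proof -
  have "bdd_meas ((S \<Otimes>\<^sub>M N) \<Otimes>\<^sub>M S) (\<lambda>(p, w). \<phi> (fst p) w)"
    using bdd_meas_compose[OF kernel_bdd, of "\<lambda>(p, w). (fst p, w)" "(S \<Otimes>\<^sub>M N) \<Otimes>\<^sub>M S"]
    by (auto simp: case_prod_beta')
  moreover have "bdd_meas ((S \<Otimes>\<^sub>M N) \<Otimes>\<^sub>M S) (\<lambda>(p, w). G w (snd p))"
    using bdd_meas_compose[OF assms(2), of "\<lambda>(p, w). (w, snd p)" "(S \<Otimes>\<^sub>M N) \<Otimes>\<^sub>M S"]
    by (auto simp: case_prod_beta')
  ultimately have "bdd_meas ((S \<Otimes>\<^sub>M N) \<Otimes>\<^sub>M S) (\<lambda>(p, w). \<phi> (fst p) w * G w (snd p))"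
    by (rule bdd_meas_mult2)
  from bdd_meas_lebesgue_integral[OF prob_space_axioms this]
  show ?thesis by (simp add: avg_def case_prod_beta')
qed

lemma avg_bdd: "bdd_meas S g \<Longrightarrow> bdd_meas S (avg g)"
proof -
  assume g: "bdd_meas S g"
  show ?thesis unfolding avg_def
    by (rule bdd_meas_lebesgue_integral[OF prob_space_axioms bdd_meas_mult2[OF kernel_bdd bdd_meas_snd[OF g]]])
qed

lemma avg_pow_bdd: "bdd_meas S g \<Longrightarrow> bdd_meas S ((avg ^^ n) g)"
  by (induction n) (auto intro: avg_bdd)

lemma avg_pow_joint:
  assumes "prob_space N" "bdd_meas (S \<Otimes>\<^sub>M N) (\<lambda>(z, y). G z y)"
  shows "bdd_meas (S \<Otimes>\<^sub>M N) (\<lambda>(z, y). (avg ^^ n) (\<lambda>z. G z y) z)"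
  using assms by (induction n) (auto dest: avg_joint)

lemma avg_cong: "(\<And>y. y \<in> space S \<Longrightarrow> g y = h y) \<Longrightarrow> avg g x = avg h x"
  unfolding avg_def by (rule Bochner_Integration.integral_cong) auto

lemma avg_pow_cong:
  "(\<And>y. y \<in> space S \<Longrightarrow> g y = h y) \<Longrightarrow> x \<in> space S \<Longrightarrow> (avg ^^ n) g x = (avg ^^ n) h x"
  by (induction n arbitrary: x) (auto intro: avg_cong)

lemma kernel_mult_integrable:
  "bdd_meas S g \<Longrightarrow> x \<in> space S \<Longrightarrow> integrable S (\<lambda>y. \<phi> x y * g y)"
  by (intro bdd_meas_integrable bdd_meas_mult kernel_section)

lemma avg_diff: "bdd_meas S g \<Longrightarrow> bdd_meas S h \<Longrightarrow> x \<in> space S \<Longrightarrow> avg (\<lambda>y. g y - h y) x = avg g x - avg h x"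
  unfolding avg_def by (simp add: right_diff_distrib kernel_mult_integrable)

lemma avg_add: "bdd_meas S g \<Longrightarrow> bdd_meas S h \<Longrightarrow> x \<in> space S \<Longrightarrow> avg (\<lambda>y. g y + h y) x = avg g x + avg h x"
  unfolding avg_def by (simp add: distrib_left kernel_mult_integrable)

lemma avg_cmult: "avg (\<lambda>y. c * g y) x = c * avg g x"
  unfolding avg_def by (simp add: mult.left_commute[of _ c])

lemma avg_const: "x \<in> space S \<Longrightarrow> avg (\<lambda>y. c) x = c"
  unfolding avg_def by (simp add: kernel_integral)

lemma avg_pow_diff: "bdd_meas S g \<Longrightarrow> bdd_meas S h \<Longrightarrow> x \<in> space S \<Longrightarrow>
  (avg ^^ n) (\<lambda>y. g y - h y) x = (avg ^^ n) g x - (avg ^^ n) h x"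
proof (induction n arbitrary: x)
  case (Suc n)
  then show ?case
    using avg_cong[of "(avg ^^ n) (\<lambda>y. g y - h y)" "\<lambda>x. (avg ^^ n) g x - (avg ^^ n) h x" x]
    by (simp add: avg_diff avg_pow_bdd)
qed simp

lemma avg_pow_add: "bdd_meas S g \<Longrightarrow> bdd_meas S h \<Longrightarrow> x \<in> space S \<Longrightarrow>
  (avg ^^ n) (\<lambda>y. g y + h y) x = (avg ^^ n) g x + (avg ^^ n) h x"
proof (induction n arbitrary: x)
  case (Suc n)
  then show ?case
    using avg_cong[of "(avg ^^ n) (\<lambda>y. g y + h y)" "\<lambda>x. (avg ^^ n) g x + (avg ^^ n) h x" x]
    by (simp add: avg_add avg_pow_bdd)
qed simp

lemma avg_pow_cmult: "(avg ^^ n) (\<lambda>y. c * g y) x = c * (avg ^^ n) g x"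
proof (induction n arbitrary: x)
  case (Suc n)
  have "(avg ^^ n) (\<lambda>y. c * g y) = (\<lambda>y. c * (avg ^^ n) g y)" using Suc by blast
  then show ?case by (simp add: avg_cmult)
qed simp

lemma avg_pow_const: "x \<in> space S \<Longrightarrow> (avg ^^ n) (\<lambda>y. c) x = c"
proof (induction n arbitrary: x)
  case (Suc n)
  then show ?case using avg_cong[of "(avg ^^ n) (\<lambda>y. c)" "\<lambda>y. c" x] by (simp add: avg_const)
qed simp

lemma avg_bound:
  assumes "bdd_meas S g" "\<And>y. y \<in> space S \<Longrightarrow> \<bar>g y\<bar> \<le> c" "x \<in> space S"
  shows "\<bar>avg g x\<bar> \<le> c"
proof -
  have "\<bar>avg g x\<bar> \<le> (\<integral>y. \<bar>\<phi> x y * g y\<bar> \<partial>S)" unfolding avg_def by (rule integral_abs_bound)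
  also have "\<dots> \<le> (\<integral>y. \<phi> x y * c \<partial>S)"
    using assms kernel_nonneg
    by (intro integral_mono integrable_abs kernel_mult_integrable bdd_meas_const)
       (auto simp: abs_mult intro!: mult_mono)
  finally show ?thesis using assms by (simp add: kernel_integral)
qed

lemma avg_pow_bound:
  assumes "bdd_meas S g" "\<And>y. y \<in> space S \<Longrightarrow> \<bar>g y\<bar> \<le> c" "x \<in> space S"
  shows "\<bar>(avg ^^ n) g x\<bar> \<le> c"
  using assms(3) by (induction n arbitrary: x) (auto intro: assms avg_bound avg_pow_bdd)

lemma avg_self_adjoint:
  assumes g: "bdd_meas S g" and h: "bdd_meas S h"
  shows "(\<integral>x. g x * avg h x \<partial>S) = (\<integral>x. avg g x * h x \<partial>S)"
proof -
  have b: "bdd_meas (S \<Otimes>\<^sub>M S) (\<lambda>(x, y). g x * (\<phi> x y * h y))"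
    by (intro bdd_meas_mult2 bdd_meas_fst bdd_meas_snd kernel_bdd g h)
  have "(\<integral>x. g x * avg h x \<partial>S) = (\<integral>x. (\<integral>y. g x * (\<phi> x y * h y) \<partial>S) \<partial>S)"
    by (simp add: avg_def)
  also have "\<dots> = (\<integral>y. (\<integral>x. g x * (\<phi> x y * h y) \<partial>S) \<partial>S)"
    by (rule bdd_meas_Fubini[OF prob_space_axioms prob_space_axioms b])
  also have "\<dots> = (\<integral>y. (\<integral>x. (\<phi> y x * g x) * h y \<partial>S) \<partial>S)"
    by (intro Bochner_Integration.integral_cong refl) (simp add: kernel_sym)
  also have "\<dots> = (\<integral>x. avg g x * h x \<partial>S)"
    by (simp add: avg_def)
  finally show ?thesis .
qed

lemma avg_pow_self_adjoint:
  assumes g: "bdd_meas S g" and h: "bdd_meas S h"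
  shows "(\<integral>x. g x * (avg ^^ n) h x \<partial>S) = (\<integral>x. (avg ^^ n) g x * h x \<partial>S)"
  using g h
proof (induction n arbitrary: g)
  case (Suc n)
  have "(\<integral>x. g x * (avg ^^ Suc n) h x \<partial>S) = (\<integral>x. avg g x * (avg ^^ n) h x \<partial>S)"
    using Suc by (simp add: avg_self_adjoint avg_pow_bdd)
  also have "\<dots> = (\<integral>x. (avg ^^ n) (avg g) x * h x \<partial>S)"
    using Suc avg_bdd by blast
  finally show ?case by (simp add: funpow_swap1)
qed simp

lemma avg_integral: "bdd_meas S g \<Longrightarrow> (\<integral>x. avg g x \<partial>S) = (\<integral>x. g x \<partial>S)"
proof -
  assume g: "bdd_meas S g"
  have "(\<integral>x. avg g x \<partial>S) = (\<integral>x. g x * avg (\<lambda>_. 1) x \<partial>S)"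
    using avg_self_adjoint[OF g bdd_meas_const[of _ 1]] by simp
  also have "\<dots> = (\<integral>x. g x \<partial>S)"
    by (intro Bochner_Integration.integral_cong refl) (simp add: avg_const)
  finally show ?thesis .
qed

lemma avg_pow_integral: "bdd_meas S g \<Longrightarrow> (\<integral>x. (avg ^^ n) g x \<partial>S) = (\<integral>x. g x \<partial>S)"
  by (induction n) (simp_all add: avg_integral avg_pow_bdd)

lemma center_bdd: "bdd_meas S g \<Longrightarrow> bdd_meas S (center g)"
  unfolding center_def by (intro bdd_meas_diff bdd_meas_const)

lemma center_integral: "bdd_meas S g \<Longrightarrow> (\<integral>x. center g x \<partial>S) = 0"
  unfolding center_def by (simp add: bdd_meas_integrable prob_space)

lemma avg_center:
  "bdd_meas S g \<Longrightarrow> x \<in> space S \<Longrightarrow> center (avg g) x = avg (center g) x"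
  unfolding center_def by (simp add: avg_diff bdd_meas_const avg_const avg_integral)

lemma center_joint:
  assumes G: "bdd_meas (S \<Otimes>\<^sub>M N) (\<lambda>(z, y). G z y)"
  shows "bdd_meas (S \<Otimes>\<^sub>M N) (\<lambda>(z, y). center (\<lambda>z. G z y) z)"
  unfolding center_def
  by (intro bdd_meas_diff2 G bdd_meas_snd bdd_meas_lebesgue_integral[OF prob_space_axioms bdd_meas_swap[OF G]])

text \<open>\<open>avg\<close> acts on the label and the integral on the observation, so Fubini
  exchanges them step by step. Once a sign has been frozen, this turns an \<open>L1\<close> norm
  over observations into a power of \<open>avg\<close> applied to one function of the label.\<close>

lemma avg_pow_integral_commute:
  assumes N: "prob_space N" and G: "bdd_meas (S \<Otimes>\<^sub>M N) (\<lambda>(z, y). G z y)" and z: "z \<in> space S"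
  shows "(\<integral>y. (avg ^^ n) (\<lambda>z. G z y) z \<partial>N) = (avg ^^ n) (\<lambda>z. \<integral>y. G z y \<partial>N) z"
  using z
proof (induction n arbitrary: z)
  case (Suc n)
  have b: "bdd_meas (N \<Otimes>\<^sub>M S) (\<lambda>(y, w). \<phi> z w * (avg ^^ n) (\<lambda>z. G z y) w)"
    by (intro bdd_meas_mult2 bdd_meas_snd kernel_section Suc.prems
          bdd_meas_swap[OF avg_pow_joint[OF N G]])
  have "(\<integral>y. (avg ^^ Suc n) (\<lambda>z. G z y) z \<partial>N) = (\<integral>y. (\<integral>w. \<phi> z w * (avg ^^ n) (\<lambda>z. G z y) w \<partial>S) \<partial>N)"
    by (simp add: avg_def)
  also have "\<dots> = (\<integral>w. (\<integral>y. \<phi> z w * (avg ^^ n) (\<lambda>z. G z y) w \<partial>N) \<partial>S)"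
    by (rule bdd_meas_Fubini[OF N prob_space_axioms b])
  also have "\<dots> = (\<integral>w. \<phi> z w * (avg ^^ n) (\<lambda>z. \<integral>y. G z y \<partial>N) w \<partial>S)"
    by (intro Bochner_Integration.integral_cong refl) (simp add: Suc.IH)
  finally show ?case by (simp add: avg_def[symmetric])
qed simp

end

section \<open>Information carried by independent observations\<close>

text \<open>All that the sphere has to supply is a rate \<open>s\<close>; any dependence on
  \<open>f 1\<close> and \<open>lam d f\<close> sits in it, the prefactor 4 being universal. The
  same 4 reappears as the cap on \<open>C\<close> and in \<open>1 + 4 * C\<close>.\<close>

locale mixing_kernel = symmetric_kernel +
  fixes s :: real
  assumes s_gt: "s > 1"
    and mixing: "bdd_meas S g \<Longrightarrow> (\<And>x. x \<in> space S \<Longrightarrow> \<bar>g x\<bar> \<le> c) \<Longrightarrow> z \<in> space S \<Longrightarrow>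
      \<bar>(avg ^^ n) (center g) z\<bar> \<le> 4 * c / s ^ n"
begin

text \<open>Duality. With z and n fixed, the sign \<open>\<epsilon> y\<close> of the value at z
  depends on y alone, hence passes through \<open>avg\<close> and \<open>center\<close>. Testing
  against it replaces the family \<open>G\<close> by the single function \<open>g\<close>, bounded
  by c, to which the sup-norm mixing applies.\<close>

lemma mixing_L1:
  assumes N: "prob_space N" and G: "bdd_meas (S \<Otimes>\<^sub>M N) (\<lambda>(z, y). G z y)"
    and c: "\<And>z. z \<in> space S \<Longrightarrow> (\<integral>y. \<bar>G z y\<bar> \<partial>N) \<le> c" and z: "z \<in> space S"
  shows "(\<integral>y. \<bar>(avg ^^ n) (center (\<lambda>z. G z y)) z\<bar> \<partial>N) \<le> 4 * c / s ^ n"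
proof -
  interpret N: prob_space N by fact
  let ?H = "\<lambda>y. (avg ^^ n) (center (\<lambda>z. G z y)) z"
  have H: "bdd_meas N ?H"
    by (rule bdd_meas_section'[OF avg_pow_joint[OF N center_joint[OF G]] z])
  define \<epsilon> where "\<epsilon> y = sgn (?H y)" for y
  have [measurable]: "?H \<in> borel_measurable N" by (rule bdd_measD[OF H])
  have \<epsilon>H: "\<epsilon> y * ?H y = \<bar>?H y\<bar>" for y
    by (simp add: \<epsilon>_def abs_sgn mult.commute)
  have \<epsilon>: "bdd_meas N \<epsilon>"
    by (rule bdd_measI[where c=1]) (auto simp: \<epsilon>_def[abs_def] abs_sgn_eq)
  have \<epsilon>G: "bdd_meas (S \<Otimes>\<^sub>M N) (\<lambda>(z, y). \<epsilon> y * G z y)"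
    by (intro bdd_meas_mult2 bdd_meas_snd \<epsilon> G)
  have \<epsilon>C: "bdd_meas (S \<Otimes>\<^sub>M N) (\<lambda>(z, y). \<epsilon> y * center (\<lambda>z. G z y) z)"
    by (intro bdd_meas_mult2 bdd_meas_snd \<epsilon> center_joint G)
  define g where "g w = (\<integral>y. \<epsilon> y * G w y \<partial>N)" for w
  have g: "bdd_meas S g" unfolding g_def by (rule bdd_meas_lebesgue_integral[OF N \<epsilon>G])
  have gc: "\<bar>g w\<bar> \<le> c" if "w \<in> space S" for w
  proof -
    have "\<bar>g w\<bar> \<le> (\<integral>y. \<bar>\<epsilon> y * G w y\<bar> \<partial>N)" unfolding g_def by (rule integral_abs_bound)
    also have "\<dots> \<le> (\<integral>y. \<bar>G w y\<bar> \<partial>N)"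
      by (intro integral_mono N.bdd_meas_integrable bdd_meas_abs bdd_meas_section'[OF \<epsilon>G that] bdd_meas_section'[OF G that])
         (auto simp: \<epsilon>_def abs_mult abs_sgn_eq)
    finally show ?thesis using c[OF that] by simp
  qed
  have eq: "(\<integral>y. \<epsilon> y * center (\<lambda>z. G z y) w \<partial>N) = center g w" if "w \<in> space S" for w
  proof -
    have 1: "bdd_meas N (\<lambda>y. \<epsilon> y * G w y)" by (rule bdd_meas_section'[OF \<epsilon>G that])
    have 2: "bdd_meas N (\<lambda>y. \<epsilon> y * (\<integral>z. G z y \<partial>S))"
      by (intro bdd_meas_mult \<epsilon> bdd_meas_lebesgue_integral[OF prob_space_axioms bdd_meas_swap[OF G]])
    have "(\<integral>y. \<epsilon> y * center (\<lambda>z. G z y) w \<partial>N) =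
        (\<integral>y. \<epsilon> y * G w y \<partial>N) - (\<integral>y. \<epsilon> y * (\<integral>z. G z y \<partial>S) \<partial>N)"
      unfolding center_def using 1 2 by (simp add: right_diff_distrib N.bdd_meas_integrable)
    also have "(\<integral>y. \<epsilon> y * (\<integral>z. G z y \<partial>S) \<partial>N) = (\<integral>z. g z \<partial>S)"
      unfolding g_def using bdd_meas_Fubini[OF prob_space_axioms N \<epsilon>G] by simp
    finally show ?thesis by (simp add: center_def g_def)
  qed
  have "(\<integral>y. \<bar>?H y\<bar> \<partial>N) = (\<integral>y. (avg ^^ n) (\<lambda>w. \<epsilon> y * center (\<lambda>z. G z y) w) z \<partial>N)"
    by (simp add: avg_pow_cmult \<epsilon>H)
  also have "\<dots> = (avg ^^ n) (\<lambda>w. \<integral>y. \<epsilon> y * center (\<lambda>z. G z y) w \<partial>N) z"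
    by (rule avg_pow_integral_commute[OF N \<epsilon>C z])
  also have "\<dots> = (avg ^^ n) (center g) z"
    by (rule avg_pow_cong[OF eq z])
  also have "\<dots> \<le> 4 * c / s ^ n" using mixing[OF g gc z, of n] by auto
  finally show ?thesis .
qed

text \<open>A likelihood \<open>F z y\<close> for the observation \<open>y\<close> (of which only the coordinates in \<open>I\<close> matter)
  given the label \<open>z\<close>; \<open>C\<close> measures how much \<open>y\<close> reveals about \<open>z\<close>, uniformly over all times \<open>n\<close> of
  an additional noise.\<close>
definition observation :: "'i set \<Rightarrow> 'i set \<Rightarrow> real \<Rightarrow> ('a \<Rightarrow> ('i \<Rightarrow> 'a) \<Rightarrow> real) \<Rightarrow> bool" where
  "observation K I C F \<longleftrightarrow>
     bdd_meas (S \<Otimes>\<^sub>M PiM K (\<lambda>_. S)) (\<lambda>(z, y). F z y) \<and>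
     (\<forall>z\<in>space S. \<forall>y\<in>space (PiM K (\<lambda>_. S)). 0 \<le> F z y) \<and>
     (\<forall>z y y'. (\<forall>i\<in>I. y i = y' i) \<longrightarrow> F z y = F z y') \<and>
     (\<forall>z\<in>space S. (\<integral>y. F z y \<partial>PiM K (\<lambda>_. S)) = 1) \<and>
     0 \<le> C \<and> C \<le> 4 \<and>
     (\<forall>n. \<forall>z\<in>space S. (\<integral>y. \<bar>(avg ^^ n) (center (\<lambda>z. F z y)) z\<bar> \<partial>PiM K (\<lambda>_. S)) \<le> C / s ^ n)"

lemma prob_space_Pi: "prob_space (PiM K (\<lambda>_. S))"
  by (intro prob_space_PiM prob_space_axioms)

text \<open>Independence of disjoint blocks of coordinates. The index set is split into
  \<open>I\<close> and \<open>K - I\<close> rather than \<open>I\<close> and \<open>J\<close>, so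
  that coordinates outside both blocks need no separate treatment. Keeping all functions on one
  space over \<open>K\<close> avoids changing the space when observations are combined.\<close>

lemma integral_PiM_mult_disjoint:
  fixes X Y :: "('i \<Rightarrow> 'a) \<Rightarrow> real"
  assumes K: "finite K" "I \<subseteq> K" "J \<subseteq> K" "I \<inter> J = {}"
    and X: "bdd_meas (PiM K (\<lambda>_. S)) X" "\<And>y y'. (\<And>i. i \<in> I \<Longrightarrow> y i = y' i) \<Longrightarrow> X y = X y'"
    and Y: "bdd_meas (PiM K (\<lambda>_. S)) Y" "\<And>y y'. (\<And>i. i \<in> J \<Longrightarrow> y i = y' i) \<Longrightarrow> Y y = Y y'"
  shows "(\<integral>y. X y * Y y \<partial>PiM K (\<lambda>_. S)) = (\<integral>y. X y \<partial>PiM K (\<lambda>_. S)) * (\<integral>y. Y y \<partial>PiM K (\<lambda>_. S))"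
proof -
  interpret P: product_sigma_finite "\<lambda>_::'i. S" ..
  interpret PK: prob_space "PiM K (\<lambda>_. S)" by (rule prob_space_Pi)
  interpret PI: prob_space "PiM I (\<lambda>_. S)" by (rule prob_space_Pi)
  interpret PJ: prob_space "PiM (K - I) (\<lambda>_. S)" by (rule prob_space_Pi)
  have KU: "I \<union> (K - I) = K" using K by auto
  have fin: "finite I" "finite (K - I)" using K finite_subset by auto
  have fold: "(\<integral>y. Z y \<partial>PiM K (\<lambda>_. S)) =
      (\<integral>x. (\<integral>y. Z (merge I (K - I) (x, y)) \<partial>PiM (K - I) (\<lambda>_. S)) \<partial>PiM I (\<lambda>_. S))"
    if "bdd_meas (PiM K (\<lambda>_. S)) Z" for Z :: "('i \<Rightarrow> 'a) \<Rightarrow> real"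
    using P.product_integral_fold[of I "K - I" Z] fin PK.bdd_meas_integrable[OF that] KU by auto
  have mX: "X (merge I (K - I) (x, y)) = X x" for x y
    by (rule X(2)) (auto simp: merge_def)
  have mY: "Y (merge I (K - I) (x, y)) = Y y" for x y
    by (rule Y(2)) (use K in \<open>auto simp: merge_def\<close>)
  show ?thesis
    unfolding fold[OF bdd_meas_mult[OF X(1) Y(1)]] fold[OF X(1)] fold[OF Y(1)] mX mY
    by (simp add: PI.prob_space PJ.prob_space)
qed

text \<open>The unit for \<open>observation_mult\<close>: it starts the induction over children and
  covers vertices that have none.\<close>

lemma observation_const: "observation K {} 0 (\<lambda>z y. 1)"
proof -
  interpret PK: prob_space "PiM K (\<lambda>_. S)" by (rule prob_space_Pi)
  have "(avg ^^ n) (center (\<lambda>z. 1)) z = 0" if "z \<in> space S" for n z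
    using avg_pow_const[OF that, of n 0] by (simp add: center_def[abs_def] prob_space)
  then show ?thesis
    unfolding observation_def
    by (auto simp: case_prod_beta' intro!: bdd_meas_const simp: PK.prob_space cong: Bochner_Integration.integral_cong)
qed

text \<open>With the marginals \<open>f0\<close>, \<open>g0\<close> of y and the centred parts
  \<open>cF\<close>, \<open>cG\<close>, the centred product is
  \<open>g0 * cF + f0 * cG + center (cF * cG)\<close>. Factors depending on y alone pass through
  \<open>avg\<close>; in the first two terms independence integrates the marginal to 1, which leaves
  \<open>C / s ^ n\<close> and \<open>D / s ^ n\<close>. In the third, \<open>cF * cG\<close> has
  \<open>L1\<close> norm at most \<open>C * D\<close>, and mixing gives it decay with the factor
  4.\<close>

lemma observation_mult:
  assumes K: "finite K" "I \<subseteq> K" "J \<subseteq> K" "I \<inter> J = {}"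
    and E1: "observation K I C F" and E2: "observation K J D G"
  shows "observation K (I \<union> J) (min 4 (C + D + 4 * C * D)) (\<lambda>z y. F z y * G z y)"
proof -
  let ?N = "PiM K (\<lambda>_. S)"
  have N: "prob_space ?N" by (rule prob_space_Pi)
  interpret N: prob_space ?N by (rule N)
  note F = E1[unfolded observation_def] and G = E2[unfolded observation_def]
  have bF: "bdd_meas (S \<Otimes>\<^sub>M ?N) (\<lambda>(z, y). F z y)" and bG: "bdd_meas (S \<Otimes>\<^sub>M ?N) (\<lambda>(z, y). G z y)"
    using F G by auto
  note bFG = bdd_meas_mult2[OF bF bG]
  have dF: "F z y = F z y'" if "\<And>i. i \<in> I \<Longrightarrow> y i = y' i" for z y y' using F that by blast
  have dG: "G z y = G z y'" if "\<And>i. i \<in> J \<Longrightarrow> y i = y' i" for z y y' using G that by blast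
  define f0 where "f0 y = (\<integral>z. F z y \<partial>S)" for y
  define g0 where "g0 y = (\<integral>z. G z y \<partial>S)" for y
  have f0: "bdd_meas ?N f0" and g0: "bdd_meas ?N g0"
    unfolding f0_def g0_def
    by (rule bdd_meas_lebesgue_integral[OF prob_space_axioms bdd_meas_swap[OF bF]]
          bdd_meas_lebesgue_integral[OF prob_space_axioms bdd_meas_swap[OF bG]])+
  have f0n: "0 \<le> f0 y" and g0n: "0 \<le> g0 y" if "y \<in> space ?N" for y
    unfolding f0_def g0_def using F G that by (auto intro!: integral_nonneg_AE)
  have f01: "(\<integral>y. f0 y \<partial>?N) = 1"
  proof -
    have "(\<integral>y. f0 y \<partial>?N) = (\<integral>z. (\<integral>y. F z y \<partial>?N) \<partial>S)"
      unfolding f0_def by (rule bdd_meas_Fubini[OF prob_space_axioms N bF, symmetric])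
    also have "\<dots> = (\<integral>z. 1 \<partial>S)" using F by (intro Bochner_Integration.integral_cong) auto
    finally show ?thesis by (simp add: prob_space)
  qed
  have g01: "(\<integral>y. g0 y \<partial>?N) = 1"
  proof -
    have "(\<integral>y. g0 y \<partial>?N) = (\<integral>z. (\<integral>y. G z y \<partial>?N) \<partial>S)"
      unfolding g0_def by (rule bdd_meas_Fubini[OF prob_space_axioms N bG, symmetric])
    also have "\<dots> = (\<integral>z. 1 \<partial>S)" using G by (intro Bochner_Integration.integral_cong) auto
    finally show ?thesis by (simp add: prob_space)
  qed
  have df0: "f0 y = f0 y'" if "\<And>i. i \<in> I \<Longrightarrow> y i = y' i" for y y'
    unfolding f0_def using dF[OF that] by simp
  have dg0: "g0 y = g0 y'" if "\<And>i. i \<in> J \<Longrightarrow> y i = y' i" for y y'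
    unfolding g0_def using dG[OF that] by simp
  define cF where "cF z y = center (\<lambda>z. F z y) z" for z y
  define cG where "cG z y = center (\<lambda>z. G z y) z" for z y
  have bcF: "bdd_meas (S \<Otimes>\<^sub>M ?N) (\<lambda>(z, y). cF z y)" and bcG: "bdd_meas (S \<Otimes>\<^sub>M ?N) (\<lambda>(z, y). cG z y)"
    unfolding cF_def cG_def by (intro center_joint bF bG)+
  have dcF: "cF z y = cF z y'" if "\<And>i. i \<in> I \<Longrightarrow> y i = y' i" for z y y'
    unfolding cF_def using dF[OF that] by simp
  have dcG: "cG z y = cG z y'" if "\<And>i. i \<in> J \<Longrightarrow> y i = y' i" for z y y'
    unfolding cG_def using dG[OF that] by simp
  have ecF: "F z y = f0 y + cF z y" and ecG: "G z y = g0 y + cG z y" for z y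
    by (simp_all add: cF_def cG_def f0_def g0_def center_def)
  have bcFG: "bdd_meas (S \<Otimes>\<^sub>M ?N) (\<lambda>(z, y). cF z y * cG z y)" by (intro bdd_meas_mult2 bcF bcG)
  have TF: "(\<integral>y. \<bar>(avg ^^ n) (\<lambda>z. cF z y) z\<bar> \<partial>?N) \<le> C / s ^ n"
    and TG: "(\<integral>y. \<bar>(avg ^^ n) (\<lambda>z. cG z y) z\<bar> \<partial>?N) \<le> D / s ^ n" if "z \<in> space S" for n z
    using F G that by (auto simp: cF_def[abs_def] cG_def[abs_def])
  have int1: "(\<integral>y. F z y * G z y \<partial>?N) = 1" if z: "z \<in> space S" for z
    using integral_PiM_mult_disjoint[OF K bdd_meas_section'[OF bF z] dF bdd_meas_section'[OF bG z] dG] F G z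
    by simp
  \<comment> \<open>Only the time n = 0 of both hypotheses enters; the decay in n of the quadratic
    term comes from \<open>mixing_L1\<close>.\<close>
  have prodC: "(\<integral>y. \<bar>cF z y * cG z y\<bar> \<partial>?N) \<le> C * D" if z: "z \<in> space S" for z
  proof -
    have "(\<integral>y. \<bar>cF z y * cG z y\<bar> \<partial>?N) = (\<integral>y. \<bar>cF z y\<bar> \<partial>?N) * (\<integral>y. \<bar>cG z y\<bar> \<partial>?N)"
      unfolding abs_mult
      by (rule integral_PiM_mult_disjoint[OF K bdd_meas_abs[OF bdd_meas_section'[OF bcF z]] _
            bdd_meas_abs[OF bdd_meas_section'[OF bcG z]]])
         (rule arg_cong[where f=abs], rule dcF dcG, assumption)+
    also have "\<dots> \<le> C * D"
      using TF[OF z, of 0] TG[OF z, of 0] F by (intro mult_mono) auto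
    finally show ?thesis .
  qed
  \<comment> \<open>The cap: \<open>F z y * G z y\<close> is itself a probability density in y, so
    \<open>mixing_L1\<close> applies with c = 1 however large \<open>C\<close> and \<open>D\<close>
    are.\<close>
  have le4: "(\<integral>y. \<bar>(avg ^^ n) (center (\<lambda>z. F z y * G z y)) z\<bar> \<partial>?N) \<le> 4 / s ^ n"
    if z: "z \<in> space S" for n z
  proof -
    have "(\<integral>y. \<bar>F w y * G w y\<bar> \<partial>?N) \<le> 1" if "w \<in> space S" for w
    proof -
      have "(\<integral>y. \<bar>F w y * G w y\<bar> \<partial>?N) = (\<integral>y. F w y * G w y \<partial>?N)"
        using F G that by (intro Bochner_Integration.integral_cong) auto
      then show ?thesis using int1[OF that] by simp
    qed
    from mixing_L1[OF N bFG this z, of n] show ?thesis by simp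
  qed
  have le: "(\<integral>y. \<bar>(avg ^^ n) (center (\<lambda>z. F z y * G z y)) z\<bar> \<partial>?N) \<le> (C + D + 4 * C * D) / s ^ n"
    if z: "z \<in> space S" for n z
  proof -
    have eq: "(avg ^^ n) (center (\<lambda>z. F z y * G z y)) z =
        (g0 y * (avg ^^ n) (\<lambda>z. cF z y) z + f0 y * (avg ^^ n) (\<lambda>z. cG z y) z) +
        (avg ^^ n) (center (\<lambda>z. cF z y * cG z y)) z" if y: "y \<in> space ?N" for y
    proof -
      have 1: "bdd_meas S (\<lambda>z. cF z y)" "bdd_meas S (\<lambda>z. cG z y)" "bdd_meas S (\<lambda>z. cF z y * cG z y)"
        using bdd_meas_section[OF bcF y] bdd_meas_section[OF bcG y] bdd_meas_mult by auto
      have 0: "(\<integral>z. cF z y \<partial>S) = 0" "(\<integral>z. cG z y \<partial>S) = 0"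
        unfolding cF_def cG_def by (intro center_integral bdd_meas_section[OF bF y] bdd_meas_section[OF bG y])+
      have "(\<lambda>z. F z y * G z y) = (\<lambda>z. f0 y * g0 y + (g0 y * cF z y + f0 y * cG z y) + cF z y * cG z y)"
        by (simp add: ecF ecG algebra_simps)
      moreover have "(\<integral>z. f0 y * g0 y + (g0 y * cF z y + f0 y * cG z y) + cF z y * cG z y \<partial>S) =
          f0 y * g0 y + (\<integral>z. cF z y * cG z y \<partial>S)"
        using 1 0 by (simp add: bdd_meas_integrable prob_space)
      ultimately have c: "center (\<lambda>z. F z y * G z y) =
          (\<lambda>z. (g0 y * cF z y + f0 y * cG z y) + center (\<lambda>z. cF z y * cG z y) z)"
        by (simp add: center_def fun_eq_iff)
      show ?thesis
        unfolding c using 1 z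
        by (simp add: avg_pow_add avg_pow_cmult bdd_meas_add bdd_meas_mult bdd_meas_const center_bdd)
    qed
    have bA: "bdd_meas ?N (\<lambda>y. (avg ^^ n) (\<lambda>z. cF z y) z)" "bdd_meas ?N (\<lambda>y. (avg ^^ n) (\<lambda>z. cG z y) z)"
      "bdd_meas ?N (\<lambda>y. (avg ^^ n) (center (\<lambda>z. cF z y * cG z y)) z)"
      "bdd_meas ?N (\<lambda>y. (avg ^^ n) (center (\<lambda>z. F z y * G z y)) z)"
      by (intro bdd_meas_section'[OF avg_pow_joint[OF N] z] bcF bcG center_joint[OF bcFG] center_joint[OF bFG])+
    have p1: "(\<integral>y. g0 y * \<bar>(avg ^^ n) (\<lambda>z. cF z y) z\<bar> \<partial>?N) = (\<integral>y. \<bar>(avg ^^ n) (\<lambda>z. cF z y) z\<bar> \<partial>?N)"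
    proof -
      have "\<bar>(avg ^^ n) (\<lambda>z. cF z y) z\<bar> = \<bar>(avg ^^ n) (\<lambda>z. cF z y') z\<bar>" if "\<And>i. i \<in> I \<Longrightarrow> y i = y' i" for y y'
        using dcF[OF that] by simp
      from integral_PiM_mult_disjoint[OF K(1,3,2) _ g0 dg0 bdd_meas_abs[OF bA(1)] this] K(4) g01
      show ?thesis by (simp add: Int_commute)
    qed
    have p2: "(\<integral>y. f0 y * \<bar>(avg ^^ n) (\<lambda>z. cG z y) z\<bar> \<partial>?N) = (\<integral>y. \<bar>(avg ^^ n) (\<lambda>z. cG z y) z\<bar> \<partial>?N)"
    proof -
      have "\<bar>(avg ^^ n) (\<lambda>z. cG z y) z\<bar> = \<bar>(avg ^^ n) (\<lambda>z. cG z y') z\<bar>" if "\<And>i. i \<in> J \<Longrightarrow> y i = y' i" for y y'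
        using dcG[OF that] by simp
      from integral_PiM_mult_disjoint[OF K f0 df0 bdd_meas_abs[OF bA(2)] this] f01
      show ?thesis by simp
    qed
    have "(\<integral>y. \<bar>(avg ^^ n) (center (\<lambda>z. F z y * G z y)) z\<bar> \<partial>?N) \<le>
       (\<integral>y. (g0 y * \<bar>(avg ^^ n) (\<lambda>z. cF z y) z\<bar> + f0 y * \<bar>(avg ^^ n) (\<lambda>z. cG z y) z\<bar>) +
          \<bar>(avg ^^ n) (center (\<lambda>z. cF z y * cG z y)) z\<bar> \<partial>?N)"
    proof (intro integral_mono N.bdd_meas_integrable bdd_meas_add bdd_meas_mult bdd_meas_abs bA f0 g0)
      fix y assume y: "y \<in> space ?N"
      have tri: "\<bar>g * p + f * q + r\<bar> \<le> g * \<bar>p\<bar> + f * \<bar>q\<bar> + \<bar>r\<bar>" if "0 \<le> g" "0 \<le> f" for g f p q r :: real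
      proof -
        have "\<bar>g * p + f * q + r\<bar> \<le> \<bar>g * p\<bar> + \<bar>f * q\<bar> + \<bar>r\<bar>" by linarith
        then show ?thesis using that by (simp add: abs_mult)
      qed
      show "\<bar>(avg ^^ n) (center (\<lambda>z. F z y * G z y)) z\<bar> \<le>
        (g0 y * \<bar>(avg ^^ n) (\<lambda>z. cF z y) z\<bar> + f0 y * \<bar>(avg ^^ n) (\<lambda>z. cG z y) z\<bar>) +
          \<bar>(avg ^^ n) (center (\<lambda>z. cF z y * cG z y)) z\<bar>"
        unfolding eq[OF y] by (rule tri[OF g0n[OF y] f0n[OF y]])
    qed
    also have "\<dots> = (\<integral>y. g0 y * \<bar>(avg ^^ n) (\<lambda>z. cF z y) z\<bar> \<partial>?N) +
          (\<integral>y. f0 y * \<bar>(avg ^^ n) (\<lambda>z. cG z y) z\<bar> \<partial>?N) +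
          (\<integral>y. \<bar>(avg ^^ n) (center (\<lambda>z. cF z y * cG z y)) z\<bar> \<partial>?N)"
      using bA f0 g0 by (simp add: N.bdd_meas_integrable bdd_meas_add bdd_meas_mult bdd_meas_abs)
    also have "\<dots> = (\<integral>y. \<bar>(avg ^^ n) (\<lambda>z. cF z y) z\<bar> \<partial>?N) + (\<integral>y. \<bar>(avg ^^ n) (\<lambda>z. cG z y) z\<bar> \<partial>?N) +
          (\<integral>y. \<bar>(avg ^^ n) (center (\<lambda>z. cF z y * cG z y)) z\<bar> \<partial>?N)"
      unfolding p1 p2 ..
    also have "\<dots> \<le> C / s ^ n + D / s ^ n + 4 * (C * D) / s ^ n"
      using TF[OF z, of n] TG[OF z, of n] mixing_L1[OF N bcFG prodC z, of n] by auto
    also have "\<dots> = (C + D + 4 * C * D) / s ^ n" by (simp add: add_divide_distrib)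
    finally show ?thesis .
  qed
  have nn: "0 \<le> C" "0 \<le> D" using F G by auto
  show ?thesis
    unfolding observation_def
  proof (intro conjI allI ballI impI bFG)
    show "0 \<le> F z y * G z y" if "z \<in> space S" "y \<in> space ?N" for z y
      using F G that by auto
    show "F z y * G z y = F z y' * G z y'" if "\<forall>i\<in>I \<union> J. y i = y' i" for z y y'
      using dF[of y y' z] dG[of y y' z] that by auto
    show "(\<integral>y. \<bar>(avg ^^ n) (center (\<lambda>z. F z y * G z y)) z\<bar> \<partial>?N) \<le> min 4 (C + D + 4 * C * D) / s ^ n"
      if "z \<in> space S" for n z
      using le[OF that, of n] le4[OF that, of n] by (auto simp: min_def)
  qed (use int1 nn in auto)
qed

text \<open>Centring commutes with \<open>avg\<close>, so n noise steps after the edge are n + 1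
  noise steps before it, and \<open>C / s ^ Suc n\<close> is the bound at time n with constant
  \<open>C / s\<close>.\<close>

lemma observation_avg:
  assumes E: "observation K I C F"
  shows "observation K I (C / s) (\<lambda>z y. avg (\<lambda>z. F z y) z)"
proof -
  let ?N = "PiM K (\<lambda>_. S)"
  have N: "prob_space ?N" by (rule prob_space_Pi)
  note F = E[unfolded observation_def]
  have bF: "bdd_meas (S \<Otimes>\<^sub>M ?N) (\<lambda>(z, y). F z y)" using F by auto
  have le: "C / s \<le> 4"
  proof -
    have "C / s \<le> C / 1" using F s_gt by (intro divide_left_mono) auto
    then show ?thesis using F by simp
  qed
  show ?thesis
    unfolding observation_def
  proof (intro conjI allI ballI impI le avg_joint[OF N bF])
    show "0 \<le> avg (\<lambda>z. F z y) z" if "z \<in> space S" "y \<in> space ?N" for z y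
      unfolding avg_def using F that kernel_nonneg by (auto intro!: integral_nonneg_AE)
    show "avg (\<lambda>z. F z y) z = avg (\<lambda>z. F z y') z" if "\<forall>i\<in>I. y i = y' i" for z y y'
    proof -
      have "F z y = F z y'" for z using F that by blast
      then show ?thesis by simp
    qed
    show "(\<integral>y. avg (\<lambda>z. F z y) z \<partial>?N) = 1" if z: "z \<in> space S" for z
    proof -
      have "(\<integral>y. avg (\<lambda>z. F z y) z \<partial>?N) = avg (\<lambda>z. \<integral>y. F z y \<partial>?N) z"
        using avg_pow_integral_commute[OF N bF z, of 1] by simp
      also have "\<dots> = avg (\<lambda>z. 1) z" by (rule avg_cong) (use F in auto)
      finally show ?thesis using avg_const[OF z] by simp
    qed
    show "0 \<le> C / s" using F s_gt by auto
    show "(\<integral>y. \<bar>(avg ^^ n) (center (avg (\<lambda>z. F z y))) z\<bar> \<partial>?N) \<le> C / s / s ^ n" if z: "z \<in> space S" for n z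
    proof -
      have "(avg ^^ n) (center (avg (\<lambda>z. F z y))) z = (avg ^^ Suc n) (center (\<lambda>z. F z y)) z" if y: "y \<in> space ?N" for y
        using avg_pow_cong[OF avg_center[OF bdd_meas_section[OF bF y]] z] by (simp add: funpow_swap1)
      then have "(\<integral>y. \<bar>(avg ^^ n) (center (avg (\<lambda>z. F z y))) z\<bar> \<partial>?N) =
         (\<integral>y. \<bar>(avg ^^ Suc n) (center (\<lambda>z. F z y)) z\<bar> \<partial>?N)"
        by (intro Bochner_Integration.integral_cong) auto
      also have "\<dots> \<le> C / s ^ Suc n" using F z by blast
      finally show ?thesis by simp
    qed
  qed
qed

text \<open>\<open>mixing_L1\<close> applied to the kernel would only give the constant 4. The
  further factor 1 / s comes from integrating over the observed label: tested against a sign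
  function \<open>\<epsilon>\<close>, the centred kernel becomes
  \<open>avg (center \<epsilon>)\<close>, one more averaging step of a function bounded by
  1.\<close>

lemma observation_leaf:
  assumes K: "finite K" "v \<in> K"
  shows "observation K {v} (4 / s) (\<lambda>z y. \<phi> z (y v))"
proof -
  let ?N = "PiM K (\<lambda>_. S)"
  have N: "prob_space ?N" by (rule prob_space_Pi)
  interpret N: prob_space ?N by (rule N)
  interpret P: product_prob_space "\<lambda>_. S" K ..
  have yv: "(\<lambda>y. y v) \<in> measurable ?N S" using K by measurable
  have b: "bdd_meas (S \<Otimes>\<^sub>M ?N) (\<lambda>(z, y). \<phi> z (y v))"
    using bdd_meas_compose[OF kernel_bdd, of "\<lambda>(z, y). (z, y v)" "S \<Otimes>\<^sub>M ?N"] yv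
    by (auto simp: case_prod_beta')
  have sp: "y v \<in> space S" if "y \<in> space ?N" for y using measurable_space[OF yv that] .
  have comp: "(\<integral>y. h (y v) \<partial>?N) = (\<integral>x. h x \<partial>S)" if h: "bdd_meas S h" for h :: "'a \<Rightarrow> real"
  proof -
    have "distr ?N S (\<lambda>y. y v) = S"
      using distr_PiM_component[of K "\<lambda>_. S" v] prob_space_axioms K by auto
    then have "(\<integral>x. h x \<partial>S) = (\<integral>x. h x \<partial>distr ?N S (\<lambda>y. y v))" by simp
    also have "\<dots> = (\<integral>y. h (y v) \<partial>?N)"
      by (rule integral_distr[OF yv]) (rule bdd_measD[OF h])
    finally show ?thesis by simp
  qed
  show ?thesis
    unfolding observation_def
  proof (intro conjI allI ballI impI b)
    show "0 \<le> \<phi> z (y v)" if "z \<in> space S" "y \<in> space ?N" for z y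
      using kernel_nonneg that sp by auto
    show "(\<integral>y. \<phi> z (y v) \<partial>?N) = 1" if "z \<in> space S" for z
      using comp[OF kernel_section[OF that]] kernel_integral[OF that] by simp
    show "(\<integral>y. \<bar>(avg ^^ n) (center (\<lambda>z. \<phi> z (y v))) z\<bar> \<partial>?N) \<le> 4 / s / s ^ n" if z: "z \<in> space S" for n z
    proof -
      define H where "H x = (avg ^^ n) (center (\<lambda>z. \<phi> z x)) z" for x
      have bH: "bdd_meas S H" unfolding H_def
        by (rule bdd_meas_section'[OF avg_pow_joint[OF prob_space_axioms center_joint[OF kernel_bdd]] z])
      then have [measurable]: "H \<in> borel_measurable S" by (rule bdd_measD)
      define \<epsilon> where "\<epsilon> x = sgn (H x)" for x
      have \<epsilon>H: "\<epsilon> x * H x = \<bar>H x\<bar>" for x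
        by (simp add: \<epsilon>_def abs_sgn mult.commute)
      have \<epsilon>: "bdd_meas S \<epsilon>"
        by (rule bdd_measI[where c=1]) (auto simp: \<epsilon>_def[abs_def] abs_sgn_eq)
      have \<epsilon>C: "bdd_meas (S \<Otimes>\<^sub>M S) (\<lambda>(z, x). \<epsilon> x * center (\<lambda>z. \<phi> z x) z)"
        by (intro bdd_meas_mult2 bdd_meas_snd \<epsilon> center_joint kernel_bdd)
      have eq: "(\<integral>x. \<epsilon> x * center (\<lambda>z. \<phi> z x) w \<partial>S) = avg (center \<epsilon>) w" if w: "w \<in> space S" for w
      proof -
        have "(\<integral>x. \<epsilon> x * center (\<lambda>z. \<phi> z x) w \<partial>S) = (\<integral>x. \<phi> w x * \<epsilon> x - \<epsilon> x \<partial>S)"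
          unfolding center_def
          by (intro Bochner_Integration.integral_cong refl)
             (simp add: kernel_sym kernel_integral algebra_simps cong: Bochner_Integration.integral_cong)
        also have "\<dots> = avg \<epsilon> w - (\<integral>x. \<epsilon> x \<partial>S)"
          unfolding avg_def by (intro Bochner_Integration.integral_diff kernel_mult_integrable bdd_meas_integrable \<epsilon> w)
        also have "\<dots> = center (avg \<epsilon>) w" unfolding center_def by (simp add: avg_integral \<epsilon>)
        finally show ?thesis using avg_center[OF \<epsilon> w] by simp
      qed
      have "(\<integral>y. \<bar>(avg ^^ n) (center (\<lambda>z. \<phi> z (y v))) z\<bar> \<partial>?N) = (\<integral>x. \<bar>H x\<bar> \<partial>S)"
        unfolding H_def[symmetric] by (rule comp[OF bdd_meas_abs[OF bH]])
      also have "\<dots> = (\<integral>x. (avg ^^ n) (\<lambda>w. \<epsilon> x * center (\<lambda>z. \<phi> z x) w) z \<partial>S)"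
        by (simp add: avg_pow_cmult H_def[symmetric] \<epsilon>H)
      also have "\<dots> = (avg ^^ n) (\<lambda>w. \<integral>x. \<epsilon> x * center (\<lambda>z. \<phi> z x) w \<partial>S) z"
        by (rule avg_pow_integral_commute[OF prob_space_axioms \<epsilon>C z])
      also have "\<dots> = (avg ^^ Suc n) (center \<epsilon>) z"
        unfolding funpow_Suc_right o_def by (rule avg_pow_cong[OF eq z])
      also have "\<dots> \<le> 4 * 1 / s ^ Suc n"
        using mixing[OF \<epsilon>, of 1 z "Suc n"] z by (auto simp: \<epsilon>_def abs_sgn_eq)
      finally show ?thesis by simp
    qed
  qed (use s_gt in \<open>auto simp: field_simps\<close>)
qed

text \<open>The number 34 only has to dominate \<open>1 + x\<close> for x = 4 C, which is at most 17
  because of the cap on C.\<close>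

definition decay :: real where "decay = 1 - (1 - 1 / s) / 34"

text \<open>Write \<open>1 + x / s\<close> as \<open>(1 + x) * (1 - \<delta> * x / (1 + x))\<close>
  and use \<open>ln u \<le> u - 1\<close>: the logarithm drops by at least
  \<open>\<delta> * x / (1 + x)\<close>. On a bounded range this is a fixed fraction of x, hence of
  \<open>ln (1 + x)\<close>.\<close>

lemma ln_contract:
  assumes x: "0 \<le> x" "x \<le> 16"
  shows "ln (1 + x / s) \<le> decay * ln (1 + x)"
proof -
  define \<delta> where "\<delta> = 1 - 1 / s"
  have \<delta>: "0 < \<delta>" "\<delta> < 1" using s_gt by (auto simp: \<delta>_def field_simps)
  have pos: "1 + x / s > 0" "1 + x > 0" using x s_gt by (auto intro!: add_pos_nonneg)
  have e: "1 + x / s = (1 + x) * (1 - \<delta> * x / (1 + x))"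
  proof -
    have "(1 + x) * (1 - \<delta> * x / (1 + x)) = (1 + x) - \<delta> * x" using x by (simp add: right_diff_distrib)
    then show ?thesis by (simp add: \<delta>_def algebra_simps)
  qed
  have lt: "1 - \<delta> * x / (1 + x) > 0" using pos e by (metis zero_less_mult_pos)
  have "ln (1 + x / s) = ln (1 + x) + ln (1 - \<delta> * x / (1 + x))"
    unfolding e using lt pos by (simp add: ln_mult)
  also have "\<dots> \<le> ln (1 + x) - \<delta> * x / (1 + x)"
    using ln_le_minus_one[OF lt] by simp
  also have "\<dots> \<le> ln (1 + x) - \<delta> / 34 * ln (1 + x)"
  proof (intro diff_left_mono)
    have "\<delta> / 34 * ln (1 + x) \<le> \<delta> / 34 * x" using \<delta> x ln_add_one_self_le_self[of x] by (intro mult_left_mono) auto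
    also have "\<dots> = (\<delta> * x) / 34" by simp
    also have "\<dots> \<le> (\<delta> * x) / (1 + x)" using x \<delta> by (intro divide_left_mono) auto
    finally show "\<delta> / 34 * ln (1 + x) \<le> \<delta> * x / (1 + x)" .
  qed
  finally show ?thesis by (simp add: decay_def \<delta>_def algebra_simps)
qed

lemma decay_bounds: "0 < decay" "decay < 1"
  using s_gt by (auto simp: decay_def field_simps)

end

section \<open>Messages on a tree\<close>

definition children :: "nat list set \<Rightarrow> nat list \<Rightarrow> nat list set" where
  "children T v = {w \<in> T. w \<noteq> [] \<and> butlast w = v}"

text \<open>The vertices of depth exactly \<open>k\<close> below \<open>v\<close>, i.e. the observed
  coordinates on which the message of \<open>v\<close> may depend. A branch that dies out before
  depth \<open>k\<close> contributes nothing.\<close>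

definition leaves :: "nat list set \<Rightarrow> nat \<Rightarrow> nat list \<Rightarrow> nat list set" where
  "leaves T k v = {w \<in> level T k. take (length v) w = v}"

lemma take_in_tree:
  assumes "is_tree T" "w \<in> T"
  shows "take n w \<in> T"
  using assms(2)
proof (induction "length w - n" arbitrary: w)
  case (Suc m)
  then have w: "w \<noteq> []" "n < length w" by auto
  then have "butlast w \<in> T" using assms(1) Suc.prems by (auto simp: is_tree_def)
  moreover have "m = length (butlast w) - n" using Suc.hyps(2) by simp
  ultimately have "take n (butlast w) \<in> T" using Suc.hyps(1) by blast
  then show ?case using w by (simp add: take_butlast)
qed simp

lemma length_children: "w \<in> children T v \<Longrightarrow> length w = Suc (length v)"
  by (auto simp: children_def)

lemma children_subset_level: "children T v \<subseteq> level T (Suc (length v))"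
  using length_children by (auto simp: level_def) (auto simp: children_def)

lemma level_Suc:
  assumes "is_tree T"
  shows "level T (Suc l) = (\<Union>v\<in>level T l. children T v)"
  using assms by (force simp: level_def children_def is_tree_def)

lemma disjoint_children: "v \<noteq> v' \<Longrightarrow> children T v \<inter> children T v' = {}"
  by (auto simp: children_def)

lemma leaves_children:
  assumes "is_tree T" "length v < k"
  shows "leaves T k v = (\<Union>w\<in>children T v. leaves T k w)"
proof (intro set_eqI iffI)
  fix u assume u: "u \<in> leaves T k v"
  define w where "w = take (Suc (length v)) u"
  have "w \<in> T" unfolding w_def using u assms(1) by (auto simp: leaves_def level_def intro: take_in_tree)
  moreover have "length w = Suc (length v)" using u assms(2) by (auto simp: w_def leaves_def level_def)
  moreover have "butlast w = v" using u assms(2) by (auto simp: w_def leaves_def level_def butlast_take)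
  ultimately have "w \<in> children T v" by (auto simp: children_def)
  moreover have "u \<in> leaves T k w" using u \<open>length w = _\<close> by (auto simp: leaves_def w_def)
  ultimately show "u \<in> (\<Union>w\<in>children T v. leaves T k w)" by blast
next
  fix u assume "u \<in> (\<Union>w\<in>children T v. leaves T k w)"
  then obtain w where w: "w \<in> children T v" "u \<in> leaves T k w" by blast
  then have "take (length v) u = take (length v) (take (length w) u)" by (auto simp: length_children min_def)
  also have "\<dots> = take (length v) w" using w by (simp add: leaves_def)
  also have "\<dots> = butlast w" using length_children[OF w(1)] by (simp add: butlast_conv_take)
  finally show "u \<in> leaves T k v" using w by (auto simp: children_def leaves_def)
qed

lemma disjoint_leaves:
  assumes "length w = length w'" "w \<noteq> w'"
  shows "leaves T k w \<inter> leaves T k w' = {}"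
  using assms by (auto simp: leaves_def)

context mixing_kernel
begin

text \<open>The logarithm turns the product rule into subadditivity. The constant is only asserted
  to exist, since the caps at 4 nest from one factor to the next.\<close>

lemma observation_prod:
  assumes K: "finite K" and W: "finite W"
    and I: "\<And>w. w \<in> W \<Longrightarrow> I w \<subseteq> K" "\<And>w w'. w \<in> W \<Longrightarrow> w' \<in> W \<Longrightarrow> w \<noteq> w' \<Longrightarrow> I w \<inter> I w' = {}"
    and E: "\<And>w. w \<in> W \<Longrightarrow> observation K (I w) (C w) (F w)"
  shows "\<exists>D. observation K (\<Union>w\<in>W. I w) D (\<lambda>z y. \<Prod>w\<in>W. F w z y) \<and>
    ln (1 + 4 * D) \<le> (\<Sum>w\<in>W. ln (1 + 4 * C w))"
  using W I E
proof (induction W)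
  case empty
  show ?case using observation_const[of K] by (intro exI[of _ 0]) simp
next
  case (insert w W)
  then obtain D where D: "observation K (\<Union>w\<in>W. I w) D (\<lambda>z y. \<Prod>w\<in>W. F w z y)"
    "ln (1 + 4 * D) \<le> (\<Sum>w\<in>W. ln (1 + 4 * C w))" by force
  have 1: "I w \<inter> (\<Union>w\<in>W. I w) = {}" using insert.prems(2)[of w] insert.hyps(2) by blast
  have 2: "I w \<subseteq> K" "(\<Union>w\<in>W. I w) \<subseteq> K" using insert.prems(1) by auto
  let ?D = "min 4 (C w + D + 4 * C w * D)"
  have "observation K (I w \<union> (\<Union>w\<in>W. I w)) ?D (\<lambda>z y. F w z y * (\<Prod>w\<in>W. F w z y))"
    using insert.prems(3)[of w] D(1) by (intro observation_mult K 1 2) auto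
  then have "observation K (\<Union>w\<in>insert w W. I w) ?D (\<lambda>z y. \<Prod>w\<in>insert w W. F w z y)"
    using insert.hyps by simp
  moreover have "ln (1 + 4 * ?D) \<le> (\<Sum>w\<in>insert w W. ln (1 + 4 * C w))"
  proof -
    have nn: "C w \<ge> 0" "D \<ge> 0" using insert.prems(3)[of w] D(1) by (auto simp: observation_def)
    \<comment> \<open>Without the minimum this is the identity behind the form
      \<open>C + D + 4 * C * D\<close>; the cap only lowers the left side.\<close>
    have "1 + 4 * ?D \<le> (1 + 4 * C w) * (1 + 4 * D)" by (simp add: algebra_simps min_def)
    moreover have "0 < 1 + 4 * ?D" using nn by (intro add_pos_nonneg) auto
    ultimately have "ln (1 + 4 * ?D) \<le> ln ((1 + 4 * C w) * (1 + 4 * D))" by simp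
    also have "\<dots> = ln (1 + 4 * C w) + ln (1 + 4 * D)" using nn by (intro ln_mult_pos) auto
    finally show ?thesis using D(2) insert.hyps by simp
  qed
  ultimately show ?case by blast
qed

text \<open>Upward belief propagation. The argument \<open>z\<close> is the label of the parent of
  \<open>v\<close>, and the value is the conditional density of the labels \<open>n\<close> levels
  below \<open>v\<close>. The label of \<open>v\<close> itself is what \<open>avg\<close> integrates
  out. For a childless \<open>v\<close> and positive \<open>n\<close> the product is empty and the
  message is 1 on the space of labels.\<close>

fun message :: "nat list set \<Rightarrow> nat \<Rightarrow> nat list \<Rightarrow> 'a \<Rightarrow> (nat list \<Rightarrow> 'a) \<Rightarrow> real" where
  "message T 0 v z y = \<phi> z (y v)"
| "message T (Suc n) v z y = avg (\<lambda>z. \<Prod>w\<in>children T v. message T n w z y) z"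

context
  fixes T :: "nat list set" and k :: nat
  assumes tree: "is_tree T" and fin: "\<And>l. finite (level T l)"
begin

lemma finite_children: "finite (children T v)"
  using children_subset_level fin finite_subset by blast

text \<open>The leaves below the children partition those below \<open>v\<close>, so a bound
  proportional to the number of leaves is additive. No edge is crossed here, and \<open>F\<close> is
  arbitrary; thus the statement serves inner vertices and also the root, which has no edge above
  it.\<close>

lemma children_observation:
  fixes a :: real
  assumes v: "length v < k"
    and E: "\<And>w. w \<in> children T v \<Longrightarrow> \<exists>C. observation (level T k) (leaves T k w) C (F w) \<and>
        ln (1 + 4 * C) \<le> a * card (leaves T k w)"
  shows "\<exists>C. observation (level T k) (leaves T k v) C (\<lambda>z y. \<Prod>w\<in>children T v. F w z y) \<and>
    ln (1 + 4 * C) \<le> a * card (leaves T k v)"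
proof -
  obtain C where C: "\<And>w. w \<in> children T v \<Longrightarrow> observation (level T k) (leaves T k w) (C w) (F w)"
      "\<And>w. w \<in> children T v \<Longrightarrow> ln (1 + 4 * C w) \<le> a * card (leaves T k w)"
    using E by metis
  have sub: "leaves T k w \<subseteq> level T k" for w by (auto simp: leaves_def)
  have dis: "leaves T k w \<inter> leaves T k w' = {}"
    if "w \<in> children T v" "w' \<in> children T v" "w \<noteq> w'" for w w'
    using that by (intro disjoint_leaves) (auto simp: length_children)
  obtain D where D: "observation (level T k) (\<Union>w\<in>children T v. leaves T k w) D (\<lambda>z y. \<Prod>w\<in>children T v. F w z y)"
    "ln (1 + 4 * D) \<le> (\<Sum>w\<in>children T v. ln (1 + 4 * C w))"
    using observation_prod[where W="children T v" and I="leaves T k" and F=F and C=C and K="level T k",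
        OF fin finite_children sub dis C(1)] by blast
  have "card (leaves T k v) = (\<Sum>w\<in>children T v. card (leaves T k w))"
    unfolding leaves_children[OF tree v]
    by (intro card_UN_disjoint finite_children ballI impI dis finite_subset[OF sub fin])
  then have "(\<Sum>w\<in>children T v. a * card (leaves T k w)) = a * card (leaves T k v)"
    by (simp add: sum_distrib_left)
  moreover have "(\<Sum>w\<in>children T v. ln (1 + 4 * C w)) \<le> (\<Sum>w\<in>children T v. a * card (leaves T k w))"
    by (intro sum_mono C)
  ultimately show ?thesis using D leaves_children[OF tree v] by auto
qed

lemma message_observation:
  assumes "v \<in> T" "length v + n = k"
  shows "\<exists>C. observation (level T k) (leaves T k v) C (message T n v) \<and>
    ln (1 + 4 * C) \<le> decay ^ n * ln 17 * card (leaves T k v)"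
  using assms
proof (induction n arbitrary: v)
  case 0
  then have v: "v \<in> level T k" "leaves T k v = {v}" by (auto simp: leaves_def level_def)
  \<comment> \<open>17 is \<open>1 + 4 * 4\<close>: the gain 1 / s of the lowest edge is given
    away.\<close>
  have "ln (1 + 4 * (4 / s)) \<le> ln (17 :: real)"
    using s_gt by (subst ln_le_cancel_iff) (auto simp: field_simps intro!: add_pos_pos)
  moreover have "message T 0 v = (\<lambda>z y. \<phi> z (y v))" by (simp add: fun_eq_iff)
  ultimately show ?case
    using observation_leaf[OF fin v(1)] v(2) by (intro exI[of _ "4 / s"]) simp
next
  case (Suc n)
  have "\<exists>C. observation (level T k) (leaves T k w) C (message T n w) \<and>
     ln (1 + 4 * C) \<le> decay ^ n * ln 17 * card (leaves T k w)" if "w \<in> children T v" for w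
  proof (rule Suc.IH)
      show "w \<in> T" "length w + n = k" using that Suc.prems length_children[of w T v] by (auto simp: children_def)
    qed
  then obtain C where C: "observation (level T k) (leaves T k v) C (\<lambda>z y. \<Prod>w\<in>children T v. message T n w z y)"
    "ln (1 + 4 * C) \<le> decay ^ n * ln 17 * card (leaves T k v)"
    using children_observation[of v "message T n" "decay ^ n * ln 17"] Suc.prems by auto
  have nn: "0 \<le> 4 * C" "4 * C \<le> 16" using C(1) by (auto simp: observation_def)
  have "ln (1 + 4 * (C / s)) \<le> decay * ln (1 + 4 * C)" using ln_contract[OF nn] by simp
  also have "\<dots> \<le> decay * (decay ^ n * ln 17 * card (leaves T k v))"
    using C(2) decay_bounds by (intro mult_left_mono) auto
  finally have "ln (1 + 4 * (C / s)) \<le> decay ^ Suc n * ln 17 * card (leaves T k v)" by simp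
  moreover have "message T (Suc n) v = (\<lambda>z y. avg (\<lambda>z. \<Prod>w\<in>children T v. message T n w z y) z)"
    by (simp add: fun_eq_iff)
  ultimately show ?case using observation_avg[OF C(1)] by (intro exI[of _ "C / s"]) simp
qed

text \<open>At the root the messages of level 1, which have height k - 1, are only multiplied. Of
  the k edges on a path down to level k, all but the lowest contribute a factor
  \<open>decay\<close>, whence the exponent.\<close>

lemma root_observation:
  assumes k: "0 < k"
  shows "\<exists>C. observation (level T k) (level T k) C (\<lambda>z y. \<Prod>w\<in>level T 1. message T (k - 1) w z y) \<and>
    ln (1 + 4 * C) \<le> decay ^ (k - 1) * ln 17 * card (level T k)"
proof -
  have "level T 0 = {[]}" using tree by (auto simp: level_def is_tree_def)
  then have c: "children T [] = level T 1" using level_Suc[OF tree, of 0] by simp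
  have l: "leaves T k [] = level T k" by (auto simp: leaves_def)
  have "\<exists>C. observation (level T k) (leaves T k w) C (message T (k - 1) w) \<and>
     ln (1 + 4 * C) \<le> decay ^ (k - 1) * ln 17 * card (leaves T k w)" if "w \<in> children T []" for w
    using that message_observation[of w "k - 1"] k by (auto simp: length_children children_def)
  from children_observation[of "[]" "message T (k - 1)" "decay ^ (k - 1) * ln 17"] this k show ?thesis
    by (auto simp: c l)
qed

text \<open>Interpolates between the joint density and the likelihood of the root label. The
  unobserved labels of depth at least \<open>l\<close> are already integrated out and represented by
  the messages of level \<open>l\<close>: for \<open>l = k\<close> these are plain kernel factors,
  and for \<open>l = 1\<close> only the root label is left.\<close>

definition partial_dens :: "nat \<Rightarrow> (nat list \<Rightarrow> 'a) \<Rightarrow> (nat list \<Rightarrow> 'a) \<Rightarrow> real" where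
  "partial_dens l u y = (\<Prod>v\<in>{v\<in>T. 0 < length v \<and> length v < l}. \<phi> (u (butlast v)) (u v)) *
     (\<Prod>v\<in>level T l. message T (k - l) v (u (butlast v)) y)"

lemma finite_inner: "finite (inner_nodes T l)"
proof -
  have "inner_nodes T l = (\<Union>i<l. level T i)" by (auto simp: inner_nodes_def level_def)
  then show ?thesis using fin by auto
qed

lemma butlast_inner: "v \<in> T \<Longrightarrow> 0 < length v \<Longrightarrow> length v \<le> l \<Longrightarrow> butlast v \<in> inner_nodes T l"
proof -
  assume v: "v \<in> T" "0 < length v" "length v \<le> l"
  then have "length (butlast v) < l" unfolding length_butlast by linarith
  then show ?thesis using tree v by (auto simp: inner_nodes_def is_tree_def)
qed

lemma message_bdd:
  assumes "v \<in> level T l" "l \<le> k" "y \<in> space (PiM (level T k) (\<lambda>_. S))"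
  shows "bdd_meas S (\<lambda>z. message T (k - l) v z y)"
proof -
  obtain C where "observation (level T k) (leaves T k v) C (message T (k - l) v)"
    using message_observation[of v "k - l"] assms by (auto simp: level_def)
  then have "bdd_meas (S \<Otimes>\<^sub>M PiM (level T k) (\<lambda>_. S)) (\<lambda>(z, y). message T (k - l) v z y)"
    by (simp add: observation_def)
  then show ?thesis by (rule bdd_meas_section[OF _ assms(3)])
qed

lemma coord_measurable: "v \<in> I \<Longrightarrow> (\<lambda>u. u v) \<in> measurable (PiM I (\<lambda>_. S)) S"
  by measurable

lemma partial_dens_bdd:
  assumes l: "1 \<le> l" "l \<le> k" and y: "y \<in> space (PiM (level T k) (\<lambda>_. S))"
  shows "bdd_meas (PiM (inner_nodes T l) (\<lambda>_. S)) (\<lambda>u. partial_dens l u y)"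
  unfolding partial_dens_def
proof (intro bdd_meas_mult bdd_meas_prod)
  fix v assume v: "v \<in> {v\<in>T. 0 < length v \<and> length v < l}"
  have "(\<lambda>u. (u (butlast v), u v)) \<in> measurable (PiM (inner_nodes T l) (\<lambda>_. S)) (S \<Otimes>\<^sub>M S)"
    using v butlast_inner[of v l] by (intro measurable_Pair coord_measurable) (auto simp: inner_nodes_def)
  from bdd_meas_compose[OF kernel_bdd this]
  show "bdd_meas (PiM (inner_nodes T l) (\<lambda>_. S)) (\<lambda>u. \<phi> (u (butlast v)) (u v))" by simp
next
  fix v assume v: "v \<in> level T l"
  show "bdd_meas (PiM (inner_nodes T l) (\<lambda>_. S)) (\<lambda>u. message T (k - l) v (u (butlast v)) y)"
    using v l butlast_inner[of v l]
    by (intro bdd_meas_compose[OF message_bdd[OF v l(2) y]] coord_measurable) (auto simp: level_def)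
qed

text \<open>Elimination of level \<open>l\<close>. With the labels of smaller depth frozen and level
  \<open>l + 1\<close> grouped by parents, the integrand factorises over the vertices of level
  \<open>l\<close>; each factor \<open>fac v\<close> holds the edge above \<open>v\<close> and the
  messages of its children. The product measure turns the integral into a product of integrals, each
  an instance of the recursion for \<open>message\<close>.\<close>

lemma partial_dens_step:
  assumes l: "1 \<le> l" "Suc l \<le> k" and y: "y \<in> space (PiM (level T k) (\<lambda>_. S))" and h: "bdd_meas S h"
  shows "(\<integral>u. h (u []) * partial_dens (Suc l) u y \<partial>PiM (inner_nodes T (Suc l)) (\<lambda>_. S)) =
    (\<integral>u. h (u []) * partial_dens l u y \<partial>PiM (inner_nodes T l) (\<lambda>_. S))"
proof -
  interpret P: product_sigma_finite "\<lambda>_::nat list. S" ..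
  interpret PS: prob_space "PiM (inner_nodes T (Suc l)) (\<lambda>_. S)" by (rule prob_space_Pi)
  let ?I = "inner_nodes T l" and ?J = "level T l"
  have IJ: "?I \<inter> ?J = {}" "inner_nodes T (Suc l) = ?I \<union> ?J" by (auto simp: inner_nodes_def level_def)
  have root: "[] \<in> inner_nodes T l'" if "1 \<le> l'" for l' using tree that by (auto simp: inner_nodes_def is_tree_def)
  have int: "integrable (PiM (?I \<union> ?J) (\<lambda>_. S)) (\<lambda>u. h (u []) * partial_dens (Suc l) u y)"
    unfolding IJ(2)[symmetric] using l root
    by (intro PS.bdd_meas_integrable bdd_meas_mult partial_dens_bdd y bdd_meas_compose[OF h] coord_measurable) auto
  have eq: "(\<integral>w. h (merge ?I ?J (x, w) []) * partial_dens (Suc l) (merge ?I ?J (x, w)) y \<partial>PiM ?J (\<lambda>_. S)) =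
     h (x []) * partial_dens l x y" if x: "x \<in> space (PiM ?I (\<lambda>_. S))" for x
  proof -
    have mI: "merge ?I ?J (x, w) v = x v" if "v \<in> T" "length v < l" for v w
      using that by (auto simp: merge_def inner_nodes_def)
    have mJ: "merge ?I ?J (x, w) v = w v" if "v \<in> level T l" for v w
      using that by (auto simp: merge_def inner_nodes_def level_def)
    have bl: "butlast v \<in> T" if "v \<in> T" "0 < length v" for v using that tree by (auto simp: is_tree_def)
    have xs: "x (butlast v) \<in> space S" if "v \<in> level T l" for v
      using x butlast_inner[of v l] that l by (auto simp: space_PiM PiE_def Pi_def level_def Suc_le_eq)
    define r where "r = (\<Prod>v\<in>{v\<in>T. 0 < length v \<and> length v < l}. \<phi> (x (butlast v)) (x v))"
    define fac where "fac v t = \<phi> (x (butlast v)) t * (\<Prod>c\<in>children T v. message T (k - Suc l) c t y)" for v t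
    have pw: "h (merge ?I ?J (x, w) []) * partial_dens (Suc l) (merge ?I ?J (x, w)) y =
        h (x []) * r * (\<Prod>v\<in>level T l. fac v (w v))" for w
    proof -
      have set: "{v\<in>T. 0 < length v \<and> length v < Suc l} = {v\<in>T. 0 < length v \<and> length v < l} \<union> level T l"
        using l by (auto simp: level_def)
      have finS: "finite {v\<in>T. 0 < length v \<and> length v < l}"
        by (rule finite_subset[OF _ finite_inner[of l]]) (auto simp: inner_nodes_def)
      have "(\<Prod>v\<in>{v\<in>T. 0 < length v \<and> length v < Suc l}. \<phi> (merge ?I ?J (x, w) (butlast v)) (merge ?I ?J (x, w) v))
         = (\<Prod>v\<in>{v\<in>T. 0 < length v \<and> length v < l}. \<phi> (merge ?I ?J (x, w) (butlast v)) (merge ?I ?J (x, w) v)) *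
           (\<Prod>v\<in>level T l. \<phi> (merge ?I ?J (x, w) (butlast v)) (merge ?I ?J (x, w) v))"
        unfolding set by (rule prod.union_disjoint[OF finS fin]) (auto simp: level_def)
      also have "(\<Prod>v\<in>{v\<in>T. 0 < length v \<and> length v < l}. \<phi> (merge ?I ?J (x, w) (butlast v)) (merge ?I ?J (x, w) v)) = r"
        unfolding r_def by (intro prod.cong refl) (auto simp: mI bl)
      also have "(\<Prod>v\<in>level T l. \<phi> (merge ?I ?J (x, w) (butlast v)) (merge ?I ?J (x, w) v)) =
          (\<Prod>v\<in>level T l. \<phi> (x (butlast v)) (w v))"
      proof (intro prod.cong refl)
        fix v assume v: "v \<in> level T l"
        then have "butlast v \<in> T" "length (butlast v) < l" using l bl[of v] by (auto simp: level_def Suc_le_eq)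
        then show "\<phi> (merge ?I ?J (x, w) (butlast v)) (merge ?I ?J (x, w) v) = \<phi> (x (butlast v)) (w v)"
          by (simp only: mJ[OF v] mI)
      qed
      finally have 1: "(\<Prod>v\<in>{v\<in>T. 0 < length v \<and> length v < Suc l}. \<phi> (merge ?I ?J (x, w) (butlast v)) (merge ?I ?J (x, w) v))
         = r * (\<Prod>v\<in>level T l. \<phi> (x (butlast v)) (w v))" .
      have "(\<Prod>c\<in>level T (Suc l). message T (k - Suc l) c (merge ?I ?J (x, w) (butlast c)) y) =
        (\<Prod>v\<in>level T l. \<Prod>c\<in>children T v. message T (k - Suc l) c (merge ?I ?J (x, w) (butlast c)) y)"
        unfolding level_Suc[OF tree]
        by (intro prod.UNION_disjoint fin ballI impI) (auto simp: finite_children disjoint_children)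
      also have "\<dots> = (\<Prod>v\<in>level T l. \<Prod>c\<in>children T v. message T (k - Suc l) c (w v) y)"
        by (intro prod.cong refl) (auto simp: children_def mJ)
      finally show ?thesis
        unfolding partial_dens_def 1 fac_def prod.distrib
        using mI[of "[]"] root[of 1] l by (simp add: inner_nodes_def)
    qed
    have fac: "bdd_meas S (fac v)" if "v \<in> level T l" for v
      unfolding fac_def
    proof (intro bdd_meas_mult bdd_meas_prod kernel_section xs that)
      fix c assume "c \<in> children T v"
      then show "bdd_meas S (\<lambda>t. message T (k - Suc l) c t y)"
        using that l level_Suc[OF tree, of l] by (intro message_bdd y) auto
    qed
    have "(\<integral>w. (\<Prod>v\<in>level T l. fac v (w v)) \<partial>PiM ?J (\<lambda>_. S)) = (\<Prod>v\<in>level T l. \<integral>t. fac v t \<partial>S)"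
      by (intro P.product_integral_prod fin bdd_meas_integrable fac)
    also have "\<dots> = (\<Prod>v\<in>level T l. message T (k - l) v (x (butlast v)) y)"
    proof (intro prod.cong refl)
      fix v
      \<comment> \<open>The height of \<open>v\<close> is positive since
        \<open>Suc l \<le> k\<close>, so the recursive clause of \<open>message\<close> applies and
        not the base clause.\<close>
      have "k - l = Suc (k - Suc l)" using l by simp
      then show "(\<integral>t. fac v t \<partial>S) = message T (k - l) v (x (butlast v)) y"
        by (simp add: fac_def avg_def)
    qed
    finally show ?thesis unfolding pw by (simp add: partial_dens_def r_def)
  qed
  show ?thesis
    unfolding IJ(2) P.product_integral_fold[OF IJ(1) finite_inner fin int]
    by (intro Bochner_Integration.integral_cong refl eq)
qed

text \<open>The test function \<open>h\<close> of the root label serves two purposes: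
  \<open>h = 1\<close> yields the density of the observation, an indicator yields the numerator of
  the posterior probability of a set.\<close>

lemma integral_joint:
  assumes k: "1 \<le> k" and y: "y \<in> space (PiM (level T k) (\<lambda>_. S))" and h: "bdd_meas S h"
  shows "(\<integral>u. h (u []) * partial_dens k u y \<partial>PiM (inner_nodes T k) (\<lambda>_. S)) =
    (\<integral>z. h z * (\<Prod>w\<in>level T 1. message T (k - 1) w z y) \<partial>S)"
proof -
  interpret P: product_sigma_finite "\<lambda>_::nat list. S" ..
  have "l \<le> k \<Longrightarrow> (\<integral>u. h (u []) * partial_dens l u y \<partial>PiM (inner_nodes T l) (\<lambda>_. S)) =
    (\<integral>u. h (u []) * partial_dens 1 u y \<partial>PiM (inner_nodes T 1) (\<lambda>_. S))" if "1 \<le> l" for l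
    using that by (induction l rule: dec_induct) (auto simp: partial_dens_step[OF _ _ y h])
  from this[OF k] have "(\<integral>u. h (u []) * partial_dens k u y \<partial>PiM (inner_nodes T k) (\<lambda>_. S)) =
    (\<integral>u. h (u []) * partial_dens 1 u y \<partial>PiM (inner_nodes T 1) (\<lambda>_. S))" by simp
  also have "inner_nodes T 1 = {[]}" using tree by (auto simp: inner_nodes_def is_tree_def)
  also have "(\<lambda>u. h (u []) * partial_dens 1 u y) =
    (\<lambda>u. (\<lambda>z. h z * (\<Prod>w\<in>level T 1. message T (k - 1) w z y)) (u []))"
  proof
    fix u
    have "{v \<in> T. 0 < length v \<and> length v < 1} = {}" by auto
    moreover have "butlast v = []" if "v \<in> level T 1" for v using that
      by (cases v) (auto simp: level_def)
    ultimately show "h (u []) * partial_dens 1 u y = (\<lambda>z. h z * (\<Prod>w\<in>level T 1. message T (k - 1) w z y)) (u [])"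
      unfolding partial_dens_def by (simp only:) simp
  qed
  also have "(\<integral>u. (\<lambda>z. h z * (\<Prod>w\<in>level T 1. message T (k - 1) w z y)) (u []) \<partial>PiM {[] :: nat list} (\<lambda>_. S)) =
    (\<integral>z. h z * (\<Prod>w\<in>level T 1. message T (k - 1) w z y) \<partial>S)"
  proof -
    have "bdd_meas S (\<lambda>z. h z * (\<Prod>w\<in>level T 1. message T (k - 1) w z y))"
      by (intro bdd_meas_mult h bdd_meas_prod message_bdd y k)
    from P.product_integral_singleton[OF bdd_measD[OF this], of "[]"] show ?thesis .
  qed
  finally show ?thesis .
qed

end

end

section \<open>Total variation of the posterior\<close>

lemma joint_dens_split:
  assumes "is_tree T" "\<And>l. finite (level T l)" "0 < k"
  shows "joint_dens d f T k u y = (\<Prod>v\<in>{v\<in>T. 0 < length v \<and> length v < k}. f (ip d (u (butlast v)) (u v))) *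
     (\<Prod>v\<in>level T k. f (ip d (u (butlast v)) (y v)))"
proof -
  let ?g = "\<lambda>v. if length v < k then u v else y v"
  have S: "{v\<in>T. 0 < length v \<and> length v \<le> k} = {v\<in>T. 0 < length v \<and> length v < k} \<union> level T k"
    using assms(3) by (auto simp: level_def)
  have fin: "finite {v\<in>T. 0 < length v \<and> length v < k}"
    by (rule finite_subset[of _ "\<Union>l<k. level T l"]) (auto simp: assms(2), auto simp: level_def)
  have "joint_dens d f T k u y = (\<Prod>v\<in>{v\<in>T. 0 < length v \<and> length v < k}. f (ip d (?g (butlast v)) (?g v))) *
     (\<Prod>v\<in>level T k. f (ip d (?g (butlast v)) (?g v)))"
    unfolding joint_dens_def Let_def S
    by (rule prod.union_disjoint[OF fin assms(2)]) (auto simp: level_def)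
  also have "(\<Prod>v\<in>{v\<in>T. 0 < length v \<and> length v < k}. f (ip d (?g (butlast v)) (?g v))) =
      (\<Prod>v\<in>{v\<in>T. 0 < length v \<and> length v < k}. f (ip d (u (butlast v)) (u v)))"
    by (intro prod.cong refl) auto
  also have "(\<Prod>v\<in>level T k. f (ip d (?g (butlast v)) (?g v))) = (\<Prod>v\<in>level T k. f (ip d (u (butlast v)) (y v)))"
    using assms(3) by (intro prod.cong refl) (auto simp: level_def)
  finally show ?thesis .
qed

text \<open>By Bayes the posterior has denominator \<open>obs_dens\<close>, and the expectation
  carries the same weight, so the normalisation cancels. The expected distance is at most the double
  integral of the absolute value of \<open>center P\<close>, and the time n = 0 clause of
  \<open>observation\<close>, averaged over the root label, bounds it by \<open>C\<close>.\<close>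

lemma expected_TV_bound:
  assumes mk: "mixing_kernel (sph d) (\<lambda>x y. f (ip d x y)) s"
    and tree: "is_tree T" and fin: "\<And>l. finite (level T l)" and k: "0 < k"
  shows "\<exists>C\<ge>0. 0 \<le> expected_TV d f T k \<and> expected_TV d f T k \<le> C \<and>
    ln (1 + 4 * C) \<le> mixing_kernel.decay s ^ (k - 1) * ln 17 * card (level T k)"
proof -
  interpret mixing_kernel "sph d" "\<lambda>x y. f (ip d x y)" s by (rule mk)
  let ?S = "sph d"
  let ?N = "PiM (level T k) (\<lambda>_. ?S)" and ?R = "PiM (inner_nodes T k) (\<lambda>_. ?S)"
  interpret N: prob_space ?N by (rule prob_space_Pi)
  interpret R: prob_space ?R by (rule prob_space_Pi)
  define P where "P z y = (\<Prod>w\<in>level T 1. message T (k - 1) w z y)" for z y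
  obtain C where C: "observation (level T k) (level T k) C P"
    "ln (1 + 4 * C) \<le> decay ^ (k - 1) * ln 17 * card (level T k)"
    using root_observation[OF tree fin k] unfolding P_def by blast
  note O = C(1)[unfolded observation_def]
  have bP: "bdd_meas (?S \<Otimes>\<^sub>M ?N) (\<lambda>(z, y). P z y)" using O by blast
  have k1: "1 \<le> k" using k by simp
  have root: "[] \<in> inner_nodes T k" using tree k by (auto simp: inner_nodes_def is_tree_def)
  have joint: "joint_dens d f T k u y = partial_dens T k k u y" for u y
    unfolding joint_dens_split[OF tree fin k] partial_dens_def[OF tree fin] by simp
  have bJ: "bdd_meas ?R (\<lambda>u. joint_dens d f T k u y)" if "y \<in> space ?N" for y
    unfolding joint using partial_dens_bdd[OF tree fin k1 order_refl that] .
  have J: "(\<integral>u. h (u []) * joint_dens d f T k u y \<partial>?R) = (\<integral>z. h z * P z y \<partial>?S)"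
    if "bdd_meas ?S h" "y \<in> space ?N" for h y
    unfolding joint P_def by (rule integral_joint[OF tree fin k1 that(2,1)])
  have obs: "obs_dens d f T k y = (\<integral>z. P z y \<partial>?S)" if "y \<in> space ?N" for y
    using J[OF bdd_meas_const[of _ 1] that] by (simp add: obs_dens_def)
  have bobs: "bdd_meas ?N (obs_dens d f T k)"
    using bdd_meas_cong[of ?N "obs_dens d f T k" "\<lambda>y. \<integral>z. P z y \<partial>?S", OF obs]
      bdd_meas_lebesgue_integral[OF prob_space_axioms bdd_meas_swap[OF bP]] by simp
  have obs0: "0 \<le> obs_dens d f T k y" if "y \<in> space ?N" for y
    unfolding obs[OF that] using O that by (auto intro!: integral_nonneg_AE)
  have joint0: "0 \<le> joint_dens d f T k u y" if "u \<in> space ?R" "y \<in> space ?N" for u y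
  proof -
    have gs: "(if length v < k then u v else y v) \<in> space ?S" if "v \<in> T" "length v \<le> k" for v
      using that \<open>u \<in> space ?R\<close> \<open>y \<in> space ?N\<close>
      by (auto simp: space_PiM inner_nodes_def level_def PiE_def Pi_def)
    show ?thesis
      unfolding joint_dens_def Let_def
    proof (intro prod_nonneg kernel_nonneg gs; elim CollectE conjE)
      fix v assume "v \<in> T" "0 < length v" "length v \<le> k"
      then show "butlast v \<in> T" "length (butlast v) \<le> k" using tree by (auto simp: is_tree_def)
    qed
  qed
  have post: "measure (posterior d f T k y) A = (\<integral>z. indicator A z * P z y \<partial>?S) / obs_dens d f T k y"
    if A: "A \<in> sets ?S" and y: "y \<in> space ?N" for A y
  proof -
    let ?j = "\<lambda>u. joint_dens d f T k u y / obs_dens d f T k y"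
    let ?B = "(\<lambda>u. u []) -` A \<inter> space ?R"
    note [measurable] = bJ[OF y, THEN bdd_measD]
    have m: "(\<lambda>u. u []) \<in> measurable ?R ?S" by (rule coord_measurable[OF tree fin root])
    have B: "?B \<in> sets ?R" by (rule measurable_sets[OF m A])
    have "bdd_meas ?S (indicator A :: _ \<Rightarrow> real)" using A by (intro bdd_measI[where c=1]) (auto simp: indicator_def)
    note bA = this
    have b: "bdd_meas ?R (\<lambda>u. indicator A (u []) * joint_dens d f T k u y)"
      by (intro bdd_meas_mult bJ y bdd_meas_compose[OF bA m])
    have "emeasure (density ?R (\<lambda>u. ennreal (?j u))) ?B = (\<integral>\<^sup>+u. ennreal (?j u) * indicator ?B u \<partial>?R)"
      by (rule emeasure_density[OF _ B]) measurable
    also have "\<dots> = (\<integral>\<^sup>+u. ennreal (indicator A (u []) * joint_dens d f T k u y / obs_dens d f T k y) \<partial>?R)"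
      by (intro nn_integral_cong) (auto simp: indicator_def)
    also have "\<dots> = ennreal (\<integral>u. indicator A (u []) * joint_dens d f T k u y / obs_dens d f T k y \<partial>?R)"
      using joint0[OF _ y] obs0[OF y] by (intro nn_integral_eq_integral integrable_divide R.bdd_meas_integrable b AE_I2)
        (auto intro!: divide_nonneg_nonneg)
    also have "(\<integral>u. indicator A (u []) * joint_dens d f T k u y / obs_dens d f T k y \<partial>?R) =
       (\<integral>z. indicator A z * P z y \<partial>?S) / obs_dens d f T k y"
      using J[OF bA y] by simp
    finally have "emeasure (density ?R (\<lambda>u. ennreal (?j u))) ?B = ennreal ((\<integral>z. indicator A z * P z y \<partial>?S) / obs_dens d f T k y)" .
    moreover have "measure (posterior d f T k y) A = measure (density ?R (\<lambda>u. ennreal (?j u))) ?B"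
      unfolding posterior_def using m A by (subst measure_distr) (auto simp: measurable_def)
    moreover have "0 \<le> (\<integral>z. indicator A z * P z y \<partial>?S) / obs_dens d f T k y"
      using O y obs0[OF y] by (auto intro!: divide_nonneg_nonneg integral_nonneg_AE)
    ultimately show ?thesis by (simp add: measure_def)
  qed
  define D where "D y = (\<integral>z. \<bar>center (\<lambda>z. P z y) z\<bar> \<partial>?S)" for y
  have bC: "bdd_meas (?S \<Otimes>\<^sub>M ?N) (\<lambda>(z, y). \<bar>center (\<lambda>z. P z y) z\<bar>)"
    using bdd_meas_abs[OF center_joint[OF bP]] by (simp add: case_prod_beta')
  have bD: "bdd_meas ?N D"
    unfolding D_def by (rule bdd_meas_lebesgue_integral[OF prob_space_axioms bdd_meas_swap[OF bC]])
  have diff: "\<bar>measure (posterior d f T k y) A - measure ?S A\<bar> \<le> D y / obs_dens d f T k y"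
    if A: "A \<in> sets ?S" and y: "y \<in> space ?N" and pos: "obs_dens d f T k y > 0" for A y
  proof -
    have bA: "bdd_meas ?S (indicator A :: _ \<Rightarrow> real)" using A by (intro bdd_measI[where c=1]) (auto simp: indicator_def)
    have bPy: "bdd_meas ?S (\<lambda>z. P z y)" by (rule bdd_meas_section[OF bP y])
    have "(\<integral>z. indicator A z * center (\<lambda>z. P z y) z \<partial>?S) =
        (\<integral>z. indicator A z * P z y \<partial>?S) - (\<integral>z. indicator A z * obs_dens d f T k y \<partial>?S)"
      unfolding center_def obs[OF y] right_diff_distrib
      by (intro Bochner_Integration.integral_diff bdd_meas_integrable bdd_meas_mult bA bPy bdd_meas_const)
    also have "(\<integral>z. indicator A z * obs_dens d f T k y \<partial>?S) = measure ?S A * obs_dens d f T k y"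
      using A by simp
    finally have "measure (posterior d f T k y) A - measure ?S A =
       (\<integral>z. indicator A z * center (\<lambda>z. P z y) z \<partial>?S) / obs_dens d f T k y"
      unfolding post[OF A y] using pos by (simp add: field_simps)
    moreover have "\<bar>\<integral>z. indicator A z * center (\<lambda>z. P z y) z \<partial>?S\<bar> \<le> D y"
    proof -
      have "\<bar>\<integral>z. indicator A z * center (\<lambda>z. P z y) z \<partial>?S\<bar> \<le> (\<integral>z. \<bar>indicator A z * center (\<lambda>z. P z y) z\<bar> \<partial>?S)"
        by (rule integral_abs_bound)
      also have "\<dots> \<le> D y" unfolding D_def
        by (intro integral_mono bdd_meas_integrable bdd_meas_abs bdd_meas_mult bA center_bdd bPy)
           (auto simp: indicator_def)
      finally show ?thesis .
    qed
    ultimately show ?thesis using pos by (simp add: divide_right_mono)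
  qed
  have ne: "sets ?S \<noteq> {}" using sets.top[of ?S] by blast
  have TV0: "0 \<le> TV (posterior d f T k y) ?S" if y: "y \<in> space ?N" for y
  proof -
    have "\<bar>measure (posterior d f T k y) A - measure ?S A\<bar> \<le> max 1 (D y / obs_dens d f T k y)"
      if A: "A \<in> sets ?S" for A
    proof (cases "obs_dens d f T k y > 0")
      case True
      then show ?thesis using diff[OF A y] by simp
    next
      \<comment> \<open>Division by 0 gives 0, so at an impossible observation every posterior
        measure is 0 and the difference is at most 1. Only boundedness is wanted here, to make the
        real supremum in \<open>TV\<close> meaningful.\<close>
      case False
      then show ?thesis using post[OF A y] obs0[OF y] by simp
    qed
    then have "bdd_above ((\<lambda>A. \<bar>measure (posterior d f T k y) A - measure ?S A\<bar>) ` sets ?S)"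
      by (intro bdd_aboveI2)
    from cSUP_upper2[OF this, of "{}" 0] show ?thesis unfolding TV_def by simp
  qed
  have TVle: "obs_dens d f T k y * TV (posterior d f T k y) ?S \<le> D y" if y: "y \<in> space ?N" for y
  proof (cases "obs_dens d f T k y > 0")
    case True
    have "TV (posterior d f T k y) ?S \<le> D y / obs_dens d f T k y"
      unfolding TV_def by (rule cSUP_least[OF ne diff[OF _ y True]])
    then show ?thesis using True by (simp add: field_simps)
  next
    case False
    then show ?thesis using obs0[OF y] by (simp add: D_def)
  qed
  have DC: "(\<integral>y. D y \<partial>?N) \<le> C"
  proof -
    have "(\<integral>y. D y \<partial>?N) = (\<integral>z. (\<integral>y. \<bar>center (\<lambda>z. P z y) z\<bar> \<partial>?N) \<partial>?S)"
      unfolding D_def by (rule bdd_meas_Fubini[OF prob_space_axioms N.prob_space_axioms bC, symmetric])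
    also have "\<dots> \<le> (\<integral>z. C \<partial>?S)"
    proof (intro integral_mono bdd_meas_integrable bdd_meas_const bdd_meas_lebesgue_integral[OF N.prob_space_axioms bC])
      fix z assume z: "z \<in> space ?S"
      have "(\<integral>y. \<bar>(avg ^^ 0) (center (\<lambda>z. P z y)) z\<bar> \<partial>?N) \<le> C / s ^ 0" using O z by blast
      then show "(\<integral>y. \<bar>center (\<lambda>z. P z y) z\<bar> \<partial>?N) \<le> C" by simp
    qed
    finally show ?thesis by (simp add: prob_space)
  qed
  have C0: "0 \<le> C" using O by blast
  have "0 \<le> expected_TV d f T k"
    unfolding expected_TV_def obs_law_def by (intro integral_nonneg_AE AE_I2) (simp add: TV0)
  moreover have "expected_TV d f T k \<le> C"
  \<comment> \<open>Measurability in y of the supremum over all measurable sets is not claimed. If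
    the integrand is not integrable, its integral is 0 by convention and the bound reduces to
    \<open>0 \<le> C\<close>.\<close>
  proof (cases "integrable (obs_law d f T k) (\<lambda>y. TV (posterior d f T k y) ?S)")
    case False
    then show ?thesis unfolding expected_TV_def using C0 by (simp add: not_integrable_integral_eq)
  next
    case True
    then have m: "(\<lambda>y. TV (posterior d f T k y) ?S) \<in> borel_measurable ?N"
      using borel_measurable_integrable[OF True] by (simp add: obs_law_def)
    note mo = bdd_measD[OF bobs]
    have "expected_TV d f T k = (\<integral>y. obs_dens d f T k y * TV (posterior d f T k y) ?S \<partial>?N)"
      unfolding expected_TV_def obs_law_def
      using integral_density[OF m mo] obs0 by simp
    also have "\<dots> \<le> (\<integral>y. D y \<partial>?N)"
    proof (intro integral_mono N.bdd_meas_integrable[OF bD] TVle)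
      show "integrable ?N (\<lambda>y. obs_dens d f T k y * TV (posterior d f T k y) ?S)"
        using True integrable_density[OF m mo] obs0 by (simp add: obs_law_def)
    qed
    finally show ?thesis using DC by simp
  qed
  ultimately show ?thesis using C(2) C0 by (intro exI[of _ C]) simp
qed

section \<open>Reflection invariance of the uniform measure on the sphere\<close>

text \<open>Reflection in the hyperplane orthogonal to \<open>w\<close>. As division by 0 gives 0,
  it is the identity on \<open>space (Rd d)\<close> when \<open>w\<close> vanishes, so the
  reflection exchanging two points makes sense even if they coincide.\<close>

definition refl_pt :: "nat \<Rightarrow> (nat \<Rightarrow> real) \<Rightarrow> (nat \<Rightarrow> real) \<Rightarrow> nat \<Rightarrow> real" where
  "refl_pt d w x = (\<lambda>i\<in>{..<d}. x i - 2 / ip d w w * ip d x w * w i)"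

lemma space_Rd: "space (Rd d) = {..<d} \<rightarrow>\<^sub>E UNIV"
  by (simp add: Rd_def space_PiM)

lemma ip_commute: "ip d x y = ip d y x"
  by (simp add: ip_def mult.commute)

lemma ip_diff: "ip d (\<lambda>i. x i - y i) z = ip d x z - ip d y z"
  "ip d z (\<lambda>i. x i - y i) = ip d z x - ip d z y"
  by (simp_all add: ip_def sum_subtractf algebra_simps)

lemma ip_cmult: "ip d (\<lambda>i. c * y i) z = c * ip d y z" "ip d z (\<lambda>i. c * y i) = c * ip d z y"
  by (simp_all add: ip_def sum_distrib_left algebra_simps)

lemma ip_restrict: "ip d (\<lambda>i\<in>{..<d}. g i) y = ip d g y" "ip d y (\<lambda>i\<in>{..<d}. g i) = ip d y g"
  by (simp_all add: ip_def)

lemma ip_nonneg: "0 \<le> ip d x x"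
  by (simp add: ip_def sum_nonneg)

lemma ip_eq_0: "ip d x x = 0 \<longleftrightarrow> (\<forall>i<d. x i = 0)"
  by (auto simp: ip_def sum_nonneg_eq_0_iff)

lemma ip_eq_0': "ip d x x = 0 \<Longrightarrow> ip d x y = 0"
  by (auto simp: ip_eq_0) (auto simp: ip_def)

lemma Cauchy_Schwarz_ip: "(ip d x y)\<^sup>2 \<le> ip d x x * ip d y y"
  using Cauchy_Schwarz_ineq_sum[of x y "{..<d}"] by (simp add: ip_def power2_eq_square)

lemma ip_refl_pt:
  "ip d (refl_pt d w x) y = ip d x y - 2 / ip d w w * ip d x w * ip d y w"
  "ip d y (refl_pt d w x) = ip d y x - 2 / ip d w w * ip d x w * ip d y w"
  unfolding refl_pt_def ip_restrict ip_diff mult.assoc ip_cmult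
  by (simp_all add: mult.assoc ip_commute[of d y w])

lemma ip_refl_pt_refl_pt: "ip d (refl_pt d w x) (refl_pt d w y) = ip d x y"
  by (cases "ip d w w = 0") (simp_all add: ip_refl_pt field_simps)

lemma refl_pt_space: "refl_pt d w x \<in> space (Rd d)"
  by (simp add: space_Rd refl_pt_def)

lemma refl_pt_involution:
  assumes "x \<in> space (Rd d)"
  shows "refl_pt d w (refl_pt d w x) = x"
proof (rule ext)
  fix i
  show "refl_pt d w (refl_pt d w x) i = x i"
  proof (cases "i < d")
    case True
    have "refl_pt d w (refl_pt d w x) i = refl_pt d w x i - 2 / ip d w w * ip d (refl_pt d w x) w * w i"
      using True by (simp add: refl_pt_def[of d w "refl_pt d w x"])
    also have "\<dots> = x i - 2 / ip d w w * ip d x w * w i - 2 / ip d w w * (ip d x w - 2 / ip d w w * ip d x w * ip d w w) * w i"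
      using True by (simp only: ip_refl_pt) (simp add: refl_pt_def)
    also have "\<dots> = x i" by (cases "ip d w w = 0") (auto simp: field_simps)
    finally show ?thesis .
  next
    case False
    then show ?thesis using assms by (auto simp: refl_pt_def space_Rd PiE_def extensional_def)
  qed
qed

section \<open>Lebesgue measure on \<open>Rd d\<close> under translations, sign change and
  reflections\<close>

lemma ip_measurable:
  assumes "\<And>i. i < d \<Longrightarrow> (\<lambda>x. g x i) \<in> borel_measurable M" "\<And>i. i < d \<Longrightarrow> (\<lambda>x. h x i) \<in> borel_measurable M"
  shows "(\<lambda>x. ip d (g x) (h x)) \<in> borel_measurable M"
  unfolding ip_def using assms by (intro borel_measurable_sum borel_measurable_times) auto

lemma coord_Rd [measurable]: "i < d \<Longrightarrow> (\<lambda>x. x i) \<in> borel_measurable (Rd d)"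
  unfolding Rd_def by measurable

lemma measurable_Rd:
  assumes "\<And>i. i < d \<Longrightarrow> (\<lambda>x. g x i) \<in> borel_measurable M"
  shows "(\<lambda>x. \<lambda>i\<in>{..<d}. g x i) \<in> measurable M (Rd d)"
  unfolding Rd_def using assms by (intro measurable_restrict) auto

lemma refl_pt_measurable: "refl_pt d w \<in> measurable (Rd d) (Rd d)"
  unfolding refl_pt_def
  by (intro measurable_Rd borel_measurable_diff borel_measurable_times ip_measurable) auto

text \<open>Translations and x -> -x act coordinate by coordinate, so comparing measures of boxes
  reduces their invariance to the line. Reflections mix the coordinates and cannot be treated this
  way.\<close>

lemma distr_Rd_coordinatewise:
  fixes h :: "nat \<Rightarrow> real \<Rightarrow> real"
  assumes h: "\<And>i. distr lborel borel (h i) = lborel" and [measurable]: "\<And>i. h i \<in> borel_measurable borel"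
  shows "distr (Rd d) (Rd d) (\<lambda>x. \<lambda>i\<in>{..<d}. h i (x i)) = Rd d"
proof -
  interpret P: product_sigma_finite "\<lambda>_::nat. lborel :: real measure" ..
  have m: "(\<lambda>x. \<lambda>i\<in>{..<d}. h i (x i)) \<in> measurable (Rd d) (Rd d)"
    by (rule measurable_Rd) measurable
  show ?thesis
    unfolding Rd_def
  proof (rule P.PiM_eqI)
    fix A :: "nat \<Rightarrow> real set" assume A: "\<And>i. i \<in> {..<d} \<Longrightarrow> A i \<in> sets lborel"
    have pre: "(\<lambda>x. \<lambda>i\<in>{..<d}. h i (x i)) -` (Pi\<^sub>E {..<d} A) \<inter> space (Rd d) = Pi\<^sub>E {..<d} (\<lambda>i. h i -` A i)"
      by (auto simp: space_Rd PiE_def Pi_def extensional_def restrict_def)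
    have s: "h i -` A i \<in> sets lborel" if "i < d" for i
      using A[of i] that measurable_sets[of "h i" borel borel "A i"] by simp
    have "emeasure (distr (Rd d) (Rd d) (\<lambda>x. \<lambda>i\<in>{..<d}. h i (x i))) (Pi\<^sub>E {..<d} A) =
        emeasure (Rd d) (Pi\<^sub>E {..<d} (\<lambda>i. h i -` A i))"
      unfolding pre[symmetric] using A by (intro emeasure_distr m) (auto simp: Rd_def intro!: sets_PiM_I_finite)
    also have "\<dots> = (\<Prod>i\<in>{..<d}. emeasure lborel (h i -` A i))"
      unfolding Rd_def using s by (intro P.emeasure_PiM) auto
    also have "\<dots> = (\<Prod>i\<in>{..<d}. emeasure (distr lborel borel (h i)) (A i))"
      using A by (intro prod.cong refl) (simp add: emeasure_distr)
    also have "\<dots> = (\<Prod>i\<in>{..<d}. emeasure lborel (A i))" by (simp add: h)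
    finally show "emeasure (distr (PiM {..<d} (\<lambda>_. lborel)) (PiM {..<d} (\<lambda>_. lborel)) (\<lambda>x. \<lambda>i\<in>{..<d}. h i (x i))) (Pi\<^sub>E {..<d} A) = (\<Prod>i\<in>{..<d}. emeasure lborel (A i))"
      by (simp add: Rd_def)
  qed simp_all
qed

lemma nn_integral_Rd_translate:
  assumes g: "g \<in> borel_measurable (Rd d)"
  shows "(\<integral>\<^sup>+x. g (\<lambda>i\<in>{..<d}. a i + x i) \<partial>Rd d) = (\<integral>\<^sup>+x. g x \<partial>Rd d)"
proof -
  have e: "distr (Rd d) (Rd d) (\<lambda>x. \<lambda>i\<in>{..<d}. a i + x i) = Rd d"
    using distr_Rd_coordinatewise[of "\<lambda>i. (+) (a i)" d] by (simp add: lborel_distr_plus)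
  have "(\<integral>\<^sup>+x. g x \<partial>Rd d) = (\<integral>\<^sup>+x. g x \<partial>distr (Rd d) (Rd d) (\<lambda>x. \<lambda>i\<in>{..<d}. a i + x i))" by (simp only: e)
  also have "\<dots> = (\<integral>\<^sup>+x. g (\<lambda>i\<in>{..<d}. a i + x i) \<partial>Rd d)"
    by (rule nn_integral_distr) (intro measurable_Rd borel_measurable_add borel_measurable_const, auto simp: g)
  finally show ?thesis by simp
qed

lemma nn_integral_Rd_uminus:
  assumes g: "g \<in> borel_measurable (Rd d)"
  shows "(\<integral>\<^sup>+x. g (\<lambda>i\<in>{..<d}. - x i) \<partial>Rd d) = (\<integral>\<^sup>+x. g x \<partial>Rd d)"
proof -
  have e: "distr (Rd d) (Rd d) (\<lambda>x. \<lambda>i\<in>{..<d}. - x i) = Rd d"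
    using distr_Rd_coordinatewise[of "\<lambda>i. uminus" d] by (simp add: lborel_distr_uminus)
  have "(\<integral>\<^sup>+x. g x \<partial>Rd d) = (\<integral>\<^sup>+x. g x \<partial>distr (Rd d) (Rd d) (\<lambda>x. \<lambda>i\<in>{..<d}. - x i))" by (simp only: e)
  also have "\<dots> = (\<integral>\<^sup>+x. g (\<lambda>i\<in>{..<d}. - x i) \<partial>Rd d)"
    by (rule nn_integral_distr) (intro measurable_Rd borel_measurable_uminus, auto simp: g)
  finally show ?thesis by simp
qed

lemma sigma_finite_Rd: "sigma_finite_measure (Rd d)"
proof -
  interpret P: product_sigma_finite "\<lambda>_::nat. lborel :: real measure" ..
  show ?thesis unfolding Rd_def by (rule P.sigma_finite) simp
qed

lemma ball_pts_sets: "ball_pts d \<in> sets (Rd d)"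
proof -
  have [measurable]: "(\<lambda>x. ip d x x) \<in> borel_measurable (Rd d)" by (intro ip_measurable) auto
  show ?thesis unfolding ball_pts_def by measurable
qed

lemma sphere_pts_sets: "sphere_pts d \<in> sets (Rd d)"
proof -
  have [measurable]: "(\<lambda>x. ip d x x) \<in> borel_measurable (Rd d)" by (intro ip_measurable) auto
  show ?thesis unfolding sphere_pts_def by measurable
qed

lemma emeasure_cube: "emeasure (Rd d) (Pi\<^sub>E {..<d} (\<lambda>_. {-a..a})) = ennreal ((2 * a) ^ d)" if "a \<ge> 0"
proof -
  interpret P: product_sigma_finite "\<lambda>_::nat. lborel :: real measure" ..
  show ?thesis unfolding Rd_def using that by (subst P.emeasure_PiM) (auto simp: ennreal_power)
qed

lemma emeasure_ball_pts: "emeasure (Rd d) (ball_pts d) \<noteq> 0" "emeasure (Rd d) (ball_pts d) \<noteq> \<infinity>"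
proof -
  have cs: "Pi\<^sub>E {..<d} (\<lambda>_. {-a..a}) \<in> sets (Rd d)" for a :: real
    unfolding Rd_def by (intro sets_PiM_I_finite) auto
  \<comment> \<open>Each square is at most \<open>?a\<close> because \<open>?a \<le> 1\<close>, so d
    of them sum to at most d / (d + 1); the added 1 keeps the quotient meaningful for d = 0.\<close>
  let ?a = "1 / (real d + 1)"
  have "Pi\<^sub>E {..<d} (\<lambda>_. {-?a..?a}) \<subseteq> ball_pts d"
  proof
    fix x assume x: "x \<in> Pi\<^sub>E {..<d} (\<lambda>_. {-?a..?a})"
    have "x i * x i \<le> ?a" if "i < d" for i
    proof -
      have "\<bar>x i\<bar> \<le> ?a" using x that by (auto simp: PiE_def Pi_def abs_le_iff minus_le_iff)
      moreover have "?a \<le> 1" by simp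
      then have "\<bar>x i\<bar> \<le> 1" using calculation by linarith
      ultimately have "\<bar>x i\<bar> * \<bar>x i\<bar> \<le> ?a * 1" by (intro mult_mono) auto
      then show ?thesis by simp
    qed
    then have "ip d x x \<le> (\<Sum>i<d. ?a)" unfolding ip_def by (intro sum_mono) auto
    also have "\<dots> \<le> 1" by (simp add: field_simps)
    finally show "x \<in> ball_pts d" using x by (auto simp: ball_pts_def space_Rd PiE_def)
  qed
  then have "emeasure (Rd d) (Pi\<^sub>E {..<d} (\<lambda>_. {-?a..?a})) \<le> emeasure (Rd d) (ball_pts d)"
    by (rule emeasure_mono[OF _ ball_pts_sets])
  moreover have "emeasure (Rd d) (Pi\<^sub>E {..<d} (\<lambda>_. {-?a..?a})) > 0"
    by (subst emeasure_cube) auto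
  ultimately show "emeasure (Rd d) (ball_pts d) \<noteq> 0" by auto
  have "ball_pts d \<subseteq> Pi\<^sub>E {..<d} (\<lambda>_. {-1..1})"
  proof
    fix x assume x: "x \<in> ball_pts d"
    have "\<bar>x i\<bar> \<le> 1" if "i < d" for i
    proof -
      have "x i * x i \<le> ip d x x" unfolding ip_def using that by (intro member_le_sum) auto
      then have "(x i)\<^sup>2 \<le> 1" using x by (auto simp: ball_pts_def power2_eq_square)
      then show ?thesis by (simp add: abs_square_le_1)
    qed
    then show "x \<in> Pi\<^sub>E {..<d} (\<lambda>_. {-1..1})"
      using x by (auto simp: ball_pts_def space_Rd PiE_def Pi_def abs_le_iff minus_le_iff)
  qed
  then have "emeasure (Rd d) (ball_pts d) \<le> emeasure (Rd d) (Pi\<^sub>E {..<d} (\<lambda>_. {-1..1}))"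
    by (rule emeasure_mono[OF _ cs])
  also have "\<dots> < \<infinity>" by (subst emeasure_cube) auto
  finally show "emeasure (Rd d) (ball_pts d) \<noteq> \<infinity>" by simp
qed

text \<open>The image of Lebesgue measure under a linear isometry is again translation invariant, so the
  usual Fubini proof of the uniqueness of Haar measure applies; the unit ball fixes the constant.\<close>
lemma nn_integral_Rd_refl_pt:
  assumes g: "g \<in> borel_measurable (Rd d)"
  shows "(\<integral>\<^sup>+x. g (refl_pt d w x) \<partial>Rd d) = (\<integral>\<^sup>+x. g x \<partial>Rd d)"
proof -
  interpret L: sigma_finite_measure "Rd d" by (rule sigma_finite_Rd)
  interpret P: pair_sigma_finite "Rd d" "Rd d" ..
  let ?L = "Rd d" and ?R = "refl_pt d w"
  define f :: "(nat \<Rightarrow> real) \<Rightarrow> ennreal" where "f x = indicator (ball_pts d) x" for x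
  define add where "add x y = (\<lambda>i\<in>{..<d}. x i + y i)" for x y :: "nat \<Rightarrow> real"
  define neg where "neg x = (\<lambda>i\<in>{..<d}. - x i)" for x :: "nat \<Rightarrow> real"
  have [measurable]: "f \<in> borel_measurable ?L" unfolding f_def using ball_pts_sets by measurable
  note [measurable] = g refl_pt_measurable
  have c1: "(\<lambda>p. fst p i) \<in> borel_measurable (?L \<Otimes>\<^sub>M ?L)" "(\<lambda>p. snd p i) \<in> borel_measurable (?L \<Otimes>\<^sub>M ?L)" if "i < d" for i
    using measurable_compose[OF measurable_fst coord_Rd[OF that]] measurable_compose[OF measurable_snd coord_Rd[OF that]] by auto
  have [measurable]: "(\<lambda>p. add (fst p) (snd p)) \<in> measurable (?L \<Otimes>\<^sub>M ?L) ?L"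
    unfolding add_def by (intro measurable_Rd borel_measurable_add c1)
  have [measurable]: "neg \<in> measurable ?L ?L"
    unfolding neg_def by (intro measurable_Rd borel_measurable_uminus) auto
  have addm: "(\<lambda>x. add (h x) (k x)) \<in> measurable M ?L" if [measurable]: "h \<in> measurable M ?L" "k \<in> measurable M ?L" for h k and M :: "'c measure"
    using measurable_compose[of "\<lambda>x. (h x, k x)" M "?L \<Otimes>\<^sub>M ?L" "\<lambda>p. add (fst p) (snd p)" ?L] by simp
  have adda: "add a \<in> measurable ?L ?L" if "a \<in> space ?L" for a
    using that by (intro addm) measurable
  have gadd: "(\<lambda>y. h (add a y)) \<in> borel_measurable ?L" if "a \<in> space ?L" "h \<in> borel_measurable ?L"
    for h :: "(nat \<Rightarrow> real) \<Rightarrow> ennreal" and a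
    using measurable_compose[OF adda[OF that(1)] that(2)] .
  have negs: "neg x \<in> space ?L" for x by (simp add: neg_def space_Rd)
  have tr: "(\<integral>\<^sup>+x. h (add a x) \<partial>?L) = (\<integral>\<^sup>+x. h x \<partial>?L)" if "h \<in> borel_measurable ?L" for h a
    unfolding add_def by (rule nn_integral_Rd_translate[OF that])
  have spi: "x \<in> space ?L \<Longrightarrow> (\<lambda>i\<in>{..<d}. x i) = x" for x
    by (auto simp: space_Rd PiE_def extensional_def)
  \<comment> \<open>By linearity and involutivity, shifting x by the reflected y turns
    \<open>?R x\<close> into \<open>?R x\<close> plus y. This substitution moves y from the argument
    of \<open>g\<close> to that of \<open>f\<close>, where the second exchange of integrals can
    remove it.\<close>
  have sub0: "?R (add (?R y) x) = add (?R x) y" if "y \<in> space ?L" for x y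
  proof
    fix i
    have ipa: "ip d (add (?R y) x) w = ip d (?R y) w + ip d x w"
      by (simp add: add_def ip_def sum.distrib algebra_simps)
    show "?R (add (?R y) x) i = add (?R x) y i"
    proof (cases "i < d")
      case True
      have "?R (add (?R y) x) i = ?R (?R y) i + ?R x i"
        using True unfolding refl_pt_def[of d w "add (?R y) x"] refl_pt_def[of d w "?R y"] refl_pt_def[of d w x]
        by (simp add: ipa algebra_simps) (simp add: add_def)
      then show ?thesis using True refl_pt_involution[OF that] by (simp add: add_def)
    qed (simp add: add_def refl_pt_def)
  qed
  have sub1: "add (neg (?R (add (?R y) x))) y = neg (?R x)" if "y \<in> space ?L" for x y
    unfolding sub0[OF that] by (auto simp: add_def neg_def)
  have "(\<integral>\<^sup>+x. f (?R x) \<partial>?L) * (\<integral>\<^sup>+y. g y \<partial>?L) = (\<integral>\<^sup>+x. (\<integral>\<^sup>+y. f (?R x) * g y \<partial>?L) \<partial>?L)"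
    by (simp add: nn_integral_cmult nn_integral_multc)
  also have "\<dots> = (\<integral>\<^sup>+x. (\<integral>\<^sup>+y. f (?R x) * g (add (neg (?R x)) y) \<partial>?L) \<partial>?L)"
  proof (rule nn_integral_cong)
    fix x
    have "(\<lambda>y. g (add (neg (?R x)) y)) \<in> borel_measurable ?L" by (rule gadd[OF negs g])
    then show "(\<integral>\<^sup>+y. f (?R x) * g y \<partial>?L) = (\<integral>\<^sup>+y. f (?R x) * g (add (neg (?R x)) y) \<partial>?L)"
      by (simp add: nn_integral_cmult tr g)
  qed
  also have "\<dots> = (\<integral>\<^sup>+y. (\<integral>\<^sup>+x. f (?R x) * g (add (neg (?R x)) y) \<partial>?L) \<partial>?L)"
  proof (rule P.Fubini'[symmetric])
    have [measurable]: "(\<lambda>p. add (neg (?R (fst p))) (snd p)) \<in> measurable (?L \<Otimes>\<^sub>M ?L) ?L" by (intro addm) measurable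
    show "(\<lambda>(x, y). f (?R x) * g (add (neg (?R x)) y)) \<in> borel_measurable (?L \<Otimes>\<^sub>M ?L)"
      unfolding case_prod_beta' by measurable
  qed
  also have "\<dots> = (\<integral>\<^sup>+y. (\<integral>\<^sup>+x. f (?R (add (?R y) x)) * g (neg (?R x)) \<partial>?L) \<partial>?L)"
  proof (rule nn_integral_cong)
    fix y assume y: "y \<in> space ?L"
    have [measurable]: "(\<lambda>x. add (neg (?R x)) y) \<in> measurable ?L ?L" using y by (intro addm) measurable
    have "(\<integral>\<^sup>+x. f (?R x) * g (add (neg (?R x)) y) \<partial>?L) =
       (\<integral>\<^sup>+x. f (?R (add (?R y) x)) * g (add (neg (?R (add (?R y) x))) y) \<partial>?L)"
      by (rule tr[of "\<lambda>x. f (?R x) * g (add (neg (?R x)) y)", symmetric]) measurable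
    also have "\<dots> = (\<integral>\<^sup>+x. f (?R (add (?R y) x)) * g (neg (?R x)) \<partial>?L)"
      using y by (intro nn_integral_cong) (simp add: sub1)
    finally show "(\<integral>\<^sup>+x. f (?R x) * g (add (neg (?R x)) y) \<partial>?L) = (\<integral>\<^sup>+x. f (?R (add (?R y) x)) * g (neg (?R x)) \<partial>?L)" .
  qed
  also have "\<dots> = (\<integral>\<^sup>+y. (\<integral>\<^sup>+x. f (add (?R x) y) * g (neg (?R x)) \<partial>?L) \<partial>?L)"
    by (intro nn_integral_cong) (simp add: sub0)
  also have "\<dots> = (\<integral>\<^sup>+x. (\<integral>\<^sup>+y. f (add (?R x) y) * g (neg (?R x)) \<partial>?L) \<partial>?L)"
  proof (rule P.Fubini')
    have [measurable]: "(\<lambda>p. add (?R (fst p)) (snd p)) \<in> measurable (?L \<Otimes>\<^sub>M ?L) ?L" by (intro addm) measurable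
    show "(\<lambda>(x, y). f (add (?R x) y) * g (neg (?R x))) \<in> borel_measurable (?L \<Otimes>\<^sub>M ?L)"
      unfolding case_prod_beta' by measurable
  qed
  also have "\<dots> = (\<integral>\<^sup>+x. (\<integral>\<^sup>+y. f y \<partial>?L) * g (neg (?R x)) \<partial>?L)"
    by (intro nn_integral_cong) (simp add: nn_integral_multc tr gadd refl_pt_space)
  also have "\<dots> = (\<integral>\<^sup>+y. f y \<partial>?L) * (\<integral>\<^sup>+x. g (neg (?R x)) \<partial>?L)"
    by (simp add: nn_integral_cmult)
  finally have main: "(\<integral>\<^sup>+x. f (?R x) \<partial>?L) * (\<integral>\<^sup>+y. g y \<partial>?L) = (\<integral>\<^sup>+y. f y \<partial>?L) * (\<integral>\<^sup>+x. g (neg (?R x)) \<partial>?L)" .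
  have "(\<integral>\<^sup>+x. f (?R x) \<partial>?L) = (\<integral>\<^sup>+y. f y \<partial>?L)"
    by (intro nn_integral_cong) (simp add: f_def ball_pts_def indicator_def ip_refl_pt_refl_pt refl_pt_space)
  moreover have "(\<integral>\<^sup>+y. f y \<partial>?L) = emeasure ?L (ball_pts d)"
    unfolding f_def using ball_pts_sets by simp
  \<comment> \<open>The ball is invariant under the isometry and has finite positive measure, so its
    measure cancels from \<open>main\<close>. A sign is left over; it commutes with the reflection
    and Lebesgue measure is even.\<close>
  ultimately have "(\<integral>\<^sup>+y. g y \<partial>?L) = (\<integral>\<^sup>+x. g (neg (?R x)) \<partial>?L)"
    using main emeasure_ball_pts[of d] by (simp add: ennreal_mult_cancel_left)
  also have "\<dots> = (\<integral>\<^sup>+x. g (?R (neg x)) \<partial>?L)"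
  proof (intro nn_integral_cong arg_cong[where f=g])
    fix x
    have "ip d (neg x) w = - ip d x w" by (simp add: neg_def ip_def sum_negf)
    then show "neg (?R x) = ?R (neg x)" by (auto simp: neg_def refl_pt_def)
  qed
  also have "\<dots> = (\<integral>\<^sup>+x. g (?R x) \<partial>?L)"
    unfolding neg_def by (rule nn_integral_Rd_uminus) measurable
  finally show ?thesis by simp
qed

section \<open>The cone measure \<open>sph d\<close> and its symmetries\<close>

lemma e1_sphere: "1 \<le> d \<Longrightarrow> e1 d \<in> sphere_pts d"
proof -
  assume "1 \<le> d"
  then have "ip d (e1 d) (e1 d) = (\<Sum>i<d. if i = 0 then 1 else 0)"
    unfolding ip_def e1_def by (intro sum.cong) auto
  with \<open>1 \<le> d\<close> show ?thesis by (auto simp: sphere_pts_def space_Rd e1_def[of d])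
qed

lemma radial_sphere:
  assumes "1 \<le> d" shows "radial d x \<in> sphere_pts d"
proof (cases "ip d x x = 0")
  case True
  then show ?thesis using e1_sphere[OF assms] by (simp add: radial_def)
next
  case False
  then have pos: "ip d x x > 0" using ip_nonneg[of d x] by simp
  have "ip d (radial d x) (radial d x) = (\<Sum>i<d. x i * x i / ip d x x)"
    unfolding ip_def[of d "radial d x"] using False pos by (simp add: radial_def)
  also have "\<dots> = 1" using False by (simp add: sum_divide_distrib[symmetric] ip_def)
  finally show ?thesis using False by (simp add: sphere_pts_def space_Rd radial_def)
qed

lemma radial_measurable:
  assumes "1 \<le> d" shows "radial d \<in> measurable (Rd d) (restrict_space (Rd d) (sphere_pts d))"
proof (rule measurable_restrict_space2)
  show "radial d \<in> space (Rd d) \<rightarrow> sphere_pts d" using radial_sphere[OF assms] by auto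
  have [measurable]: "(\<lambda>x. ip d x x) \<in> borel_measurable (Rd d)" by (intro ip_measurable) auto
  have m: "(\<lambda>x. \<lambda>i\<in>{..<d}. x i / sqrt (ip d x x)) \<in> measurable (Rd d) (Rd d)"
    by (intro measurable_Rd) measurable
  have "e1 d \<in> space (Rd d)" using e1_sphere[OF assms] by (simp add: sphere_pts_def)
  then show "radial d \<in> measurable (Rd d) (Rd d)"
    unfolding radial_def using m by (intro measurable_If measurable_const) simp_all
qed

lemma space_sph: "space (sph d) = sphere_pts d"
  using sphere_pts_sets[THEN sets.sets_into_space] by (auto simp: sph_def space_restrict_space)

lemma sets_sph: "sets (sph d) = sets (restrict_space (Rd d) (sphere_pts d))"
  by (simp add: sph_def)

lemma measurable_sph: "measurable (sph d) N = measurable (restrict_space (Rd d) (sphere_pts d)) N"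
  "measurable N (sph d) = measurable N (restrict_space (Rd d) (sphere_pts d))"
  by (rule measurable_cong_sets; simp add: sets_sph)+

lemma radial_measurable':
  "1 \<le> d \<Longrightarrow> radial d \<in> measurable (uniform_measure (Rd d) (ball_pts d)) (sph d)"
  using radial_measurable by (simp add: measurable_sph cong: measurable_cong_sets)

lemma prob_space_sph: "1 \<le> d \<Longrightarrow> prob_space (sph d)"
  unfolding sph_def
  by (intro prob_space.prob_space_distr prob_space_uniform_measure emeasure_ball_pts)
     (auto intro: radial_measurable cong: measurable_cong_sets)

text \<open>\<open>radial\<close> sends the origin to the arbitrary point \<open>e1 d\<close>, a
  choice that reflections need not respect. The exceptional point lies in the hyperplane where
  coordinate 0 vanishes; this coordinate exists as \<open>1 \<le> d\<close>.\<close>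

lemma AE_Rd_nonzero:
  assumes "1 \<le> d" shows "AE x in Rd d. ip d x x \<noteq> 0"
proof (rule AE_I)
  interpret P: product_sigma_finite "\<lambda>_::nat. lborel :: real measure" ..
  let ?N = "Pi\<^sub>E {..<d} (\<lambda>i. if i = 0 then {0 :: real} else UNIV)"
  show "{x \<in> space (Rd d). \<not> ip d x x \<noteq> 0} \<subseteq> ?N"
    by (auto simp: ip_eq_0 space_Rd PiE_def Pi_def)
  have "emeasure (Rd d) ?N = (\<Prod>i<d. emeasure lborel (if i = 0 then {0 :: real} else UNIV))"
    unfolding Rd_def by (intro P.emeasure_PiM) auto
  also have "\<dots> = 0" using assms by (intro prod_zero bexI[of _ 0]) auto
  finally show "emeasure (Rd d) ?N = 0" .
  show "?N \<in> sets (Rd d)" unfolding Rd_def by (intro sets_PiM_I_finite) auto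
qed

lemma refl_pt_sphere: "refl_pt d w x \<in> sphere_pts d" if "x \<in> sphere_pts d"
  using that by (simp add: sphere_pts_def refl_pt_space ip_refl_pt_refl_pt)

lemma refl_pt_sph_measurable: "refl_pt d w \<in> measurable (sph d) (sph d)"
  unfolding measurable_sph
  by (rule measurable_restrict_space2)
     (auto simp: space_restrict_space refl_pt_sphere intro: measurable_restrict_space1 refl_pt_measurable)

lemma distr_Rd_refl_pt: "distr (Rd d) (Rd d) (refl_pt d w) = Rd d"
proof (rule measure_eqI)
  fix A assume "A \<in> sets (distr (Rd d) (Rd d) (refl_pt d w))"
  then have A: "A \<in> sets (Rd d)" by simp
  have "emeasure (distr (Rd d) (Rd d) (refl_pt d w)) A = (\<integral>\<^sup>+x. indicator A x \<partial>distr (Rd d) (Rd d) (refl_pt d w))"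
    using A by simp
  also have "\<dots> = (\<integral>\<^sup>+x. indicator A (refl_pt d w x) \<partial>Rd d)"
    using A by (intro nn_integral_distr refl_pt_measurable) simp
  also have "\<dots> = (\<integral>\<^sup>+x. indicator A x \<partial>Rd d)"
    using A by (intro nn_integral_Rd_refl_pt) simp
  finally show "emeasure (distr (Rd d) (Rd d) (refl_pt d w)) A = emeasure (Rd d) A" using A by simp
qed simp

lemma distr_uniform_refl_pt:
  "distr (uniform_measure (Rd d) (ball_pts d)) (Rd d) (refl_pt d w) = uniform_measure (Rd d) (ball_pts d)"
proof (rule measure_eqI)
  fix A assume "A \<in> sets (distr (uniform_measure (Rd d) (ball_pts d)) (Rd d) (refl_pt d w))"
  then have A: "A \<in> sets (Rd d)" by simp
  have m: "refl_pt d w -` A \<inter> space (Rd d) \<in> sets (Rd d)" by (rule measurable_sets[OF refl_pt_measurable A])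
  have "emeasure (distr (uniform_measure (Rd d) (ball_pts d)) (Rd d) (refl_pt d w)) A =
     emeasure (uniform_measure (Rd d) (ball_pts d)) (refl_pt d w -` A \<inter> space (Rd d))"
    using A refl_pt_measurable by (subst emeasure_distr) (auto cong: measurable_cong_sets)
  also have "\<dots> = emeasure (Rd d) (ball_pts d \<inter> (refl_pt d w -` A \<inter> space (Rd d))) / emeasure (Rd d) (ball_pts d)"
    by (rule emeasure_uniform_measure[OF ball_pts_sets m])
  also have "ball_pts d \<inter> (refl_pt d w -` A \<inter> space (Rd d)) = refl_pt d w -` (ball_pts d \<inter> A) \<inter> space (Rd d)"
    by (auto simp: ball_pts_def refl_pt_space ip_refl_pt_refl_pt)
  also have "emeasure (Rd d) \<dots> = emeasure (distr (Rd d) (Rd d) (refl_pt d w)) (ball_pts d \<inter> A)"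
    using A ball_pts_sets by (intro emeasure_distr[symmetric] refl_pt_measurable) auto
  also have "\<dots> / emeasure (Rd d) (ball_pts d) = emeasure (uniform_measure (Rd d) (ball_pts d)) A"
    unfolding distr_Rd_refl_pt by (rule emeasure_uniform_measure[OF ball_pts_sets A, symmetric])
  finally show "emeasure (distr (uniform_measure (Rd d) (ball_pts d)) (Rd d) (refl_pt d w)) A =
    emeasure (uniform_measure (Rd d) (ball_pts d)) A" .
qed simp

lemma radial_refl_pt:
  assumes "ip d x x \<noteq> 0"
  shows "radial d (refl_pt d w x) = refl_pt d w (radial d x)"
proof -
  have "ip d (radial d x) w = ip d x w / sqrt (ip d x x)"
    using assms by (simp add: radial_def ip_restrict) (simp add: ip_def sum_divide_distrib)
  then show ?thesis
    using assms unfolding radial_def[of d "refl_pt d w x"] ip_refl_pt_refl_pt refl_pt_def[of d w "radial d x"]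
    by (auto simp: radial_def[of d x] refl_pt_def diff_divide_distrib)
qed

text \<open>Away from the origin the radial projection commutes with reflections, so the invariance
  of the uniform measure on the ball descends to the sphere.\<close>

lemma distr_sph_refl_pt:
  assumes d: "1 \<le> d" shows "distr (sph d) (sph d) (refl_pt d w) = sph d"
proof -
  let ?U = "uniform_measure (Rd d) (ball_pts d)"
  have rm: "radial d \<in> measurable ?U (sph d)" by (rule radial_measurable'[OF d])
  have Rm: "refl_pt d w \<in> measurable ?U ?U" using refl_pt_measurable by (simp cong: measurable_cong_sets)
  have sph: "sph d = distr ?U (sph d) (radial d)"
    unfolding sph_def by (rule distr_cong) auto
  have "distr (sph d) (sph d) (refl_pt d w) = distr (distr ?U (sph d) (radial d)) (sph d) (refl_pt d w)"
    using sph by simp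
  also have "\<dots> = distr ?U (sph d) (refl_pt d w \<circ> radial d)"
    by (rule distr_distr[OF refl_pt_sph_measurable rm])
  also have "\<dots> = distr ?U (sph d) (radial d \<circ> refl_pt d w)"
  proof (rule distr_cong_AE[OF refl refl])
    show "AE x in ?U. (refl_pt d w \<circ> radial d) x = (radial d \<circ> refl_pt d w) x"
      using AE_Rd_nonzero[OF d] by (intro AE_uniform_measureI ball_pts_sets) (auto simp: radial_refl_pt)
  qed (auto intro: measurable_comp rm Rm refl_pt_sph_measurable)
  also have "\<dots> = distr (distr ?U ?U (refl_pt d w)) (sph d) (radial d)"
    by (rule distr_distr[OF rm Rm, symmetric])
  also have "distr ?U ?U (refl_pt d w) = ?U"
    using distr_uniform_refl_pt[of d w] distr_cong[of ?U ?U ?U "Rd d" "refl_pt d w" "refl_pt d w"] by simp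
  finally show ?thesis using sph by simp
qed

lemma integral_sph_refl_pt:
  fixes g :: "(nat \<Rightarrow> real) \<Rightarrow> real"
  assumes d: "1 \<le> d" and g: "g \<in> borel_measurable (sph d)"
  shows "(\<integral>x. g (refl_pt d w x) \<partial>sph d) = (\<integral>x. g x \<partial>sph d)"
  using integral_distr[OF refl_pt_sph_measurable g] distr_sph_refl_pt[OF d] by simp

lemma abs_ip_sphere: "\<bar>ip d x y\<bar> \<le> 1" if "x \<in> sphere_pts d" "y \<in> sphere_pts d"
  using Cauchy_Schwarz_ip[of d x y] that by (simp add: sphere_pts_def abs_square_le_1)

lemma coord_sph: "i < d \<Longrightarrow> (\<lambda>x. x i) \<in> borel_measurable (sph d)"
  unfolding measurable_sph by (intro measurable_restrict_space1 coord_Rd)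

lemma ip_sph_bdd: "bdd_meas (sph d) (\<lambda>x. ip d x y)"
proof (rule bdd_measI)
  show "(\<lambda>x. ip d x y) \<in> borel_measurable (sph d)" by (intro ip_measurable coord_sph) auto
  fix x assume "x \<in> space (sph d)"
  then have "(ip d x y)\<^sup>2 \<le> ip d y y" using Cauchy_Schwarz_ip[of d x y] by (simp add: space_sph sphere_pts_def)
  then show "\<bar>ip d x y\<bar> \<le> sqrt (ip d y y)" using real_sqrt_le_mono by fastforce
qed

lemma ip_sph_joint: "(\<lambda>(x, y). ip d x y) \<in> borel_measurable (sph d \<Otimes>\<^sub>M sph d)"
  unfolding case_prod_beta'
  by (intro ip_measurable measurable_compose[OF measurable_fst coord_sph] measurable_compose[OF measurable_snd coord_sph])

lemma ip_dist_bound: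
  assumes "x \<in> sphere_pts d"
  shows "\<bar>ip d x y - ip d x y'\<bar> \<le> sqrt (ip d (\<lambda>i. y i - y' i) (\<lambda>i. y i - y' i))"
proof -
  have "(ip d x y - ip d x y')\<^sup>2 \<le> ip d (\<lambda>i. y i - y' i) (\<lambda>i. y i - y' i)"
    using Cauchy_Schwarz_ip[of d x "\<lambda>i. y i - y' i"] assms by (simp add: ip_diff(2) sphere_pts_def)
  then show ?thesis using real_sqrt_le_mono by fastforce
qed

lemma markov_kernel_symmetric_kernel:
  assumes d: "1 \<le> d" and mk: "markov_kernel d f" and cont: "continuous_on {-1..1} f"
  shows "symmetric_kernel (sph d) (\<lambda>x y. f (ip d x y))"
proof -
  interpret prob_space "sph d" by (rule prob_space_sph[OF d])
  \<comment> \<open>Nothing is known about \<open>f\<close> outside the interval, so its argument is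
    clamped; inner products of points of the sphere are not affected.\<close>
  have m: "(\<lambda>t. f (max (-1) (min 1 t))) \<in> borel_measurable borel"
    by (intro borel_measurable_continuous_onI continuous_on_compose2[OF cont] continuous_intros) auto
  have in11: "ip d x y \<in> {-1..1}" if "x \<in> sphere_pts d" "y \<in> sphere_pts d" for x y
    using abs_ip_sphere[OF that] by auto
  obtain B where B: "\<And>t. t \<in> {-1..1} \<Longrightarrow> \<bar>f t\<bar> \<le> B"
    using compact_imp_bounded[OF compact_continuous_image[OF cont compact_Icc]] unfolding bounded_iff by fastforce
  show ?thesis
  proof
    show "bdd_meas (sph d \<Otimes>\<^sub>M sph d) (\<lambda>(x, y). f (ip d x y))"
    proof (rule bdd_measI[where c=B])
      have "(\<lambda>p. f (max (-1) (min 1 (case p of (x, y) \<Rightarrow> ip d x y)))) \<in> borel_measurable (sph d \<Otimes>\<^sub>M sph d)"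
        by (rule measurable_compose[OF ip_sph_joint m])
      also have "?this \<longleftrightarrow> (\<lambda>(x, y). f (ip d x y)) \<in> borel_measurable (sph d \<Otimes>\<^sub>M sph d)"
      proof (intro measurable_cong)
        fix p assume "p \<in> space (sph d \<Otimes>\<^sub>M sph d)"
        then have "-1 \<le> ip d (fst p) (snd p)" "ip d (fst p) (snd p) \<le> 1"
          using in11[of "fst p" "snd p"] by (auto simp: space_pair_measure space_sph)
        then show "f (max (-1) (min 1 (case p of (x, y) \<Rightarrow> ip d x y))) = (case p of (x, y) \<Rightarrow> f (ip d x y))"
          by (simp add: case_prod_beta min_def max_def)
      qed
      finally show "(\<lambda>(x, y). f (ip d x y)) \<in> borel_measurable (sph d \<Otimes>\<^sub>M sph d)" .
    qed (use in11 B in \<open>auto simp: space_pair_measure space_sph\<close>)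
  qed (use mk in11 in \<open>auto simp: markov_kernel_def space_sph ip_commute\<close>)
qed

section \<open>Contraction of monotone zonal kernels\<close>

text \<open>Log-convexity makes the ratios of successive terms nondecreasing. If one ratio exceeded
  \<open>\<rho>\<close>, all later ones would be at least as large and the sequence would outgrow
  \<open>K * \<rho> ^ n\<close>. So every ratio is at most \<open>\<rho>\<close>, and
  \<open>K\<close> disappears from the conclusion.\<close>

lemma log_convex_ratio_bound:
  fixes a :: "nat \<Rightarrow> real"
  assumes nn: "\<And>n. 0 \<le> a n" and conv: "\<And>n. (a (Suc n))\<^sup>2 \<le> a n * a (Suc (Suc n))"
    and K: "\<And>n. a n \<le> K * \<rho> ^ n" and \<rho>: "0 < \<rho>"
  shows "a n \<le> \<rho> ^ n * a 0"
proof -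
  have step: "a (Suc m) \<le> \<rho> * a m" for m
  proof (rule ccontr)
    assume "\<not> ?thesis"
    then have gt: "\<rho> * a m < a (Suc m)" by simp
    then have pos1: "0 < a (Suc m)" using nn[of m] \<rho> by (smt (verit) mult_nonneg_nonneg)
    have pos0: "0 < a m"
    proof (rule ccontr)
      assume "\<not> ?thesis"
      then have "a m = 0" using nn[of m] by simp
      then have "(a (Suc m))\<^sup>2 \<le> 0" using conv[of m] by simp
      then show False using pos1 by simp
    qed
    define r where "r = a (Suc m) / a m"
    have r: "\<rho> < r" using gt pos0 by (simp add: r_def field_simps)
    have ind: "0 < a (m + n) \<and> r * a (m + n) \<le> a (Suc (m + n))" for n
    proof (induction n)
      case 0
      then show ?case using pos0 by (simp add: r_def)
    next
      case (Suc n)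
      have p: "0 < a (Suc (m + n))" using Suc r \<rho> by (smt (verit) mult_pos_pos)
      have "r * a (Suc (m + n)) * a (m + n) \<le> (a (Suc (m + n)))\<^sup>2"
        using Suc p by (simp add: power2_eq_square mult.assoc mult.left_commute)
      also have "\<dots> \<le> a (m + n) * a (Suc (Suc (m + n)))" by (rule conv)
      finally have "r * a (Suc (m + n)) \<le> a (Suc (Suc (m + n)))" using Suc by (simp add: mult.commute)
      then show ?case using p by simp
    qed
    have geo: "r ^ n * a m \<le> a (m + n)" for n
    proof (induction n)
      case (Suc n)
      have "r ^ Suc n * a m \<le> r * a (m + n)" using Suc r \<rho> by (simp add: mult.assoc)
      also have "\<dots> \<le> a (m + Suc n)" using ind[of n] by simp
      finally show ?case .
    qed simp
    have "1 < r / \<rho>" using r \<rho> by simp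
    then obtain n where n: "K * \<rho> ^ m / a m < (r / \<rho>) ^ n" using real_arch_pow by blast
    then have "K * \<rho> ^ m * \<rho> ^ n < r ^ n * a m" using pos0 \<rho> by (simp add: field_simps power_divide)
    also have "\<dots> \<le> K * \<rho> ^ (m + n)" using geo[of n] K[of "m + n"] by simp
    finally show False by (simp add: power_add mult.assoc)
  qed
  show ?thesis
  proof (induction n)
    case (Suc n)
    have "a (Suc n) \<le> \<rho> * a n" by (rule step)
    also have "\<dots> \<le> \<rho> * (\<rho> ^ n * a 0)" using Suc \<rho> by (intro mult_left_mono) auto
    finally show ?case by (simp add: mult.assoc)
  qed simp
qed

lemma (in finite_measure) Cauchy_Schwarz_integral:
  assumes u: "bdd_meas M u" and v: "bdd_meas M v"
  shows "(\<integral>x. u x * v x \<partial>M)\<^sup>2 \<le> (\<integral>x. (u x)\<^sup>2 \<partial>M) * (\<integral>x. (v x)\<^sup>2 \<partial>M)"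
proof -
  define a where "a = (\<integral>x. (u x)\<^sup>2 \<partial>M)"
  define b where "b = (\<integral>x. u x * v x \<partial>M)"
  define c where "c = (\<integral>x. (v x)\<^sup>2 \<partial>M)"
  have int: "integrable M (\<lambda>x. (u x)\<^sup>2)" "integrable M (\<lambda>x. u x * v x)" "integrable M (\<lambda>x. (v x)\<^sup>2)"
    unfolding power2_eq_square by (intro bdd_meas_integrable bdd_meas_mult u v)+
  have q: "0 \<le> p\<^sup>2 * a - 2 * p * q * b + q\<^sup>2 * c" for p q
  proof -
    have "0 \<le> (\<integral>x. (p * u x - q * v x)\<^sup>2 \<partial>M)" by simp
    also have "\<dots> = (\<integral>x. p\<^sup>2 * (u x)\<^sup>2 - 2 * p * q * (u x * v x) + q\<^sup>2 * (v x)\<^sup>2 \<partial>M)"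
      by (intro Bochner_Integration.integral_cong refl) (simp add: power2_eq_square algebra_simps)
    also have "\<dots> = p\<^sup>2 * a - 2 * p * q * b + q\<^sup>2 * c"
      using int by (simp add: a_def b_def c_def)
    finally show ?thesis .
  qed
  have c0: "0 \<le> c" by (simp add: c_def)
  have "b\<^sup>2 \<le> a * c"
  proof (cases "c = 0")
    case False
    then have "0 < c" using c0 by simp
    \<comment> \<open>The coefficients p = c, q = b make the quadratic form equal to c times the
      discriminant.\<close>
    moreover have "0 \<le> c * (a * c - b\<^sup>2)" using q[of c b] by (simp add: power2_eq_square algebra_simps)
    ultimately show ?thesis by (simp add: zero_le_mult_iff)
  next
    case True
    have "b = 0"
    proof (rule ccontr)
      assume b: "b \<noteq> 0"
      \<comment> \<open>With c = 0 the form is linear in q, and this value of q would make it equal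
        to -1.\<close>
      have "0 \<le> a - (a + 1)" using q[of 1 "(a + 1) / (2 * b)"] True b by simp
      then show False by simp
    qed
    then show ?thesis using True by simp
  qed
  then show ?thesis by (simp add: a_def b_def c_def)
qed

text \<open>Supplies Lipschitz approximants to a profile that is merely continuous. The sup bound
  \<open>B\<close> is carried along for the product case.\<close>

lemma real_polynomial_function_Lipschitz:
  fixes p :: "real \<Rightarrow> real"
  assumes "real_polynomial_function p"
  shows "\<exists>L B. 0 \<le> L \<and> (\<forall>t\<in>{-1..1}. \<bar>p t\<bar> \<le> B) \<and> (\<forall>t\<in>{-1..1}. \<forall>u\<in>{-1..1}. \<bar>p t - p u\<bar> \<le> L * \<bar>t - u\<bar>)"
  using assms
proof induction
  case (linear g)
  then obtain c where c: "\<And>x. g x = x * c" using real_bounded_linear by auto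
  have "\<bar>g t\<bar> \<le> \<bar>c\<bar>" if "t \<in> {-1..1}" for t
    using that mult_right_mono[of "\<bar>t\<bar>" 1 "\<bar>c\<bar>"] by (auto simp: c abs_mult)
  moreover have "\<bar>g t - g u\<bar> \<le> \<bar>c\<bar> * \<bar>t - u\<bar>" for t u
  proof -
    have "g t - g u = c * (t - u)" by (simp add: c algebra_simps)
    then show ?thesis by (simp add: abs_mult)
  qed
  ultimately show ?case by (intro exI[of _ "\<bar>c\<bar>"]) auto
next
  case (const c)
  show ?case by (rule exI[of _ 0], rule exI[of _ "\<bar>c\<bar>"]) auto
next
  case (add f g)
  from add.IH(1) obtain L B where h1: "0 \<le> L" "\<forall>t\<in>{-1..1}. \<bar>f t\<bar> \<le> B"
    "\<forall>t\<in>{-1..1}. \<forall>u\<in>{-1..1}. \<bar>f t - f u\<bar> \<le> L * \<bar>t - u\<bar>" by auto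
  from add.IH(2) obtain L' B' where h2: "0 \<le> L'" "\<forall>t\<in>{-1..1}. \<bar>g t\<bar> \<le> B'"
    "\<forall>t\<in>{-1..1}. \<forall>u\<in>{-1..1}. \<bar>g t - g u\<bar> \<le> L' * \<bar>t - u\<bar>" by auto
  note h = h1(1) h1(2)[rule_format] h1(3)[rule_format] h2(1) h2(2)[rule_format] h2(3)[rule_format]
  show ?case
  proof (rule exI[of _ "L + L'"], rule exI[of _ "B + B'"], intro conjI ballI)
    fix t :: real assume t: "t \<in> {-1..1}"
    show "\<bar>f t + g t\<bar> \<le> B + B'" using h(2)[OF t] h(5)[OF t] by linarith
    fix u :: real assume u: "u \<in> {-1..1}"
    show "\<bar>f t + g t - (f u + g u)\<bar> \<le> (L + L') * \<bar>t - u\<bar>"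
      using h(3)[OF t u] h(6)[OF t u] unfolding distrib_right by linarith
  qed (simp add: h1(1) h2(1))
next
  case (mult f g)
  from mult.IH(1) obtain L B where h1: "0 \<le> L" "\<forall>t\<in>{-1..1}. \<bar>f t\<bar> \<le> B"
    "\<forall>t\<in>{-1..1}. \<forall>u\<in>{-1..1}. \<bar>f t - f u\<bar> \<le> L * \<bar>t - u\<bar>" by auto
  from mult.IH(2) obtain L' B' where h2: "0 \<le> L'" "\<forall>t\<in>{-1..1}. \<bar>g t\<bar> \<le> B'"
    "\<forall>t\<in>{-1..1}. \<forall>u\<in>{-1..1}. \<bar>g t - g u\<bar> \<le> L' * \<bar>t - u\<bar>" by auto
  note h = h1(1) h1(2)[rule_format] h1(3)[rule_format] h2(1) h2(2)[rule_format] h2(3)[rule_format]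
  have B: "0 \<le> B" "0 \<le> B'" using h(2)[of 0] h(5)[of 0] by auto
  show ?case
  proof (rule exI[of _ "B * L' + B' * L"], rule exI[of _ "B * B'"], intro conjI ballI)
    fix t :: real assume t: "t \<in> {-1..1}"
    show "\<bar>f t * g t\<bar> \<le> B * B'" unfolding abs_mult using h(2)[OF t] h(5)[OF t] B by (intro mult_mono) auto
    fix u :: real assume u: "u \<in> {-1..1}"
    have "f t * g t - f u * g u = f t * (g t - g u) + g u * (f t - f u)" by (simp add: algebra_simps)
    then have "\<bar>f t * g t - f u * g u\<bar> \<le> \<bar>f t\<bar> * \<bar>g t - g u\<bar> + \<bar>g u\<bar> * \<bar>f t - f u\<bar>"
      by (metis abs_mult abs_triangle_ineq)
    also have "\<dots> \<le> B * (L' * \<bar>t - u\<bar>) + B' * (L * \<bar>t - u\<bar>)"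
      using h(2)[OF t] h(5)[OF u] h(3)[OF t u] h(6)[OF t u] B by (intro add_mono mult_mono) auto
    finally show "\<bar>f t * g t - f u * g u\<bar> \<le> (B * L' + B' * L) * \<bar>t - u\<bar>" by (simp add: algebra_simps)
  qed (simp add: h1(1) h2(1) B)
qed

text \<open>Points of equal norm are exchanged by the reflection along their difference, and a
  reflection is its own adjoint, so it may act on y instead of on x and x'.\<close>

lemma ip_refl_pt_swap:
  fixes x x' :: "nat \<Rightarrow> real"
  assumes "x \<in> sphere_pts d" "x' \<in> sphere_pts d"
  defines "w \<equiv> \<lambda>i. x i - x' i"
  shows "ip d x (refl_pt d w y) = ip d x' y" "ip d x' (refl_pt d w y) = ip d x y"
proof -
  have xx: "ip d x x = 1" "ip d x' x' = 1" using assms(1,2) by (auto simp: sphere_pts_def)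
  have ww: "ip d w w = 2 - 2 * ip d x x'" "ip d x w = 1 - ip d x x'" "ip d x' w = ip d x x' - 1"
    "ip d y w = ip d x y - ip d x' y"
    by (simp_all add: w_def ip_diff xx ip_commute[of d x' x] ip_commute[of d y])
  have z: "ip d y w = 0" if "ip d w w = 0" using ip_eq_0'[OF that, of y] by (simp add: ip_commute)
  show "ip d x (refl_pt d w y) = ip d x' y"
  proof (cases "ip d w w = 0")
    case True
    then show ?thesis using z[OF True] ww(4) by (simp add: ip_refl_pt)
  next
    case False
    then have "2 / ip d w w * ip d x w = 1" using ww by (simp add: field_simps)
    then have "2 / ip d w w * ip d y w * ip d x w = ip d y w" by (metis mult.commute mult.assoc mult_1)
    then show ?thesis using ww(4) by (simp add: ip_refl_pt(2))
  qed
  show "ip d x' (refl_pt d w y) = ip d x y"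
  proof (cases "ip d w w = 0")
    case True
    then show ?thesis using z[OF True] ww(4) by (simp add: ip_refl_pt)
  next
    case False
    then have "2 / ip d w w * ip d x' w = -1" using ww by (simp add: field_simps)
    then have "2 / ip d w w * ip d y w * ip d x' w = - ip d y w" by (metis mult.commute mult.assoc mult_minus1)
    then show ?thesis using ww(4) by (simp add: ip_refl_pt(2))
  qed
qed

text \<open>The chordal distance. It makes the displacement of y under a reflection proportional to
  \<open>\<bar>ip d y w\<bar>\<close>, which ties Lipschitz estimates to linear functions.\<close>

definition edist :: "nat \<Rightarrow> (nat \<Rightarrow> real) \<Rightarrow> (nat \<Rightarrow> real) \<Rightarrow> real" where
  "edist d x y = sqrt (ip d (\<lambda>i. x i - y i) (\<lambda>i. x i - y i))"

definition Lipschitz_sphere :: "nat \<Rightarrow> real \<Rightarrow> ((nat \<Rightarrow> real) \<Rightarrow> real) \<Rightarrow> bool" where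
  "Lipschitz_sphere d L g \<longleftrightarrow> (\<forall>x\<in>sphere_pts d. \<forall>y\<in>sphere_pts d. \<bar>g x - g y\<bar> \<le> L * edist d x y)"

lemma edist_refl_pt: "edist d y (refl_pt d w y) = 2 * \<bar>ip d y w\<bar> / sqrt (ip d w w)"
proof -
  let ?c = "2 / ip d w w * ip d y w"
  have "ip d (\<lambda>i. y i - refl_pt d w y i) (\<lambda>i. y i - refl_pt d w y i) = ip d (\<lambda>i. ?c * w i) (\<lambda>i. ?c * w i)"
    unfolding ip_def by (intro sum.cong refl) (simp add: refl_pt_def ip_def)
  also have "\<dots> = ?c\<^sup>2 * ip d w w" by (simp only: ip_cmult) (simp add: power2_eq_square)
  finally have "edist d y (refl_pt d w y) = \<bar>?c\<bar> * sqrt (ip d w w)"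
    unfolding edist_def by (simp only: real_sqrt_mult real_sqrt_abs)
  also have "\<dots> = 2 * \<bar>ip d y w\<bar> / sqrt (ip d w w)"
  proof (cases "ip d w w = 0")
    case False
    then have "0 < ip d w w" using ip_nonneg[of d w] by simp
    then have "sqrt (ip d w w) * sqrt (ip d w w) = ip d w w" "0 < sqrt (ip d w w)" by simp_all
    then show ?thesis using \<open>0 < ip d w w\<close> by (simp add: abs_mult field_simps)
  qed simp
  finally show ?thesis .
qed

lemma edist_sphere_le: "x \<in> sphere_pts d \<Longrightarrow> y \<in> sphere_pts d \<Longrightarrow> edist d x y \<le> 2"
proof -
  assume xy: "x \<in> sphere_pts d" "y \<in> sphere_pts d"
  then have "ip d (\<lambda>i. x i - y i) (\<lambda>i. x i - y i) = 2 - 2 * ip d x y"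
    by (simp add: ip_diff sphere_pts_def ip_commute[of d y x])
  also have "\<dots> \<le> 4" using abs_ip_sphere[OF xy] by linarith
  finally show ?thesis unfolding edist_def using real_sqrt_le_mono[of _ 4] by simp
qed

section \<open>Monotone zonal kernels: linear eigenfunctions and Lipschitz contraction\<close>

locale monotone_zonal_kernel =
  fixes d :: nat and f :: "real \<Rightarrow> real"
  assumes d: "1 \<le> d" and markov: "markov_kernel d f" and mono: "mono_on {-1..1} f"
    and cont: "continuous_on {-1..1} f"
begin

sublocale symmetric_kernel "sph d" "\<lambda>x y. f (ip d x y)"
  by (rule markov_kernel_symmetric_kernel[OF d markov cont])

lemma ip_in: "x \<in> sphere_pts d \<Longrightarrow> y \<in> sphere_pts d \<Longrightarrow> ip d x y \<in> {-1..1}"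
  using abs_ip_sphere[of x d y] by auto

lemma refl_bdd: "bdd_meas (sph d) g \<Longrightarrow> bdd_meas (sph d) (\<lambda>y. g (refl_pt d w y))"
  by (rule bdd_meas_compose[OF _ refl_pt_sph_measurable])

lemma integral_refl: "bdd_meas (sph d) g \<Longrightarrow> (\<integral>y. g (refl_pt d w y) \<partial>sph d) = (\<integral>y. g y \<partial>sph d)"
  by (rule integral_sph_refl_pt[OF d bdd_measD])

lemma kernel_bdd': "x \<in> sphere_pts d \<Longrightarrow> bdd_meas (sph d) (\<lambda>y. f (ip d x y))"
  using kernel_section[of x] by (simp add: space_sph)

lemma integral_diag:
  assumes x: "x \<in> sphere_pts d"
  shows "(\<integral>y. f (ip d x y) * ip d y x \<partial>sph d) = lam d f"
proof -
  let ?R = "refl_pt d (\<lambda>i. x i - e1 d i)"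
  have b: "bdd_meas (sph d) (\<lambda>y. f (ip d x y) * ip d x y)"
    using ip_sph_bdd[of d x] by (intro bdd_meas_mult kernel_bdd' x) (simp add: ip_commute)
  have "(\<integral>y. f (ip d x y) * ip d y x \<partial>sph d) = (\<integral>y. f (ip d x (?R y)) * ip d x (?R y) \<partial>sph d)"
    using integral_refl[OF b] by (simp add: ip_commute[of d _ x])
  also have "\<dots> = lam d f"
    unfolding lam_def ip_refl_pt_swap(1)[OF x e1_sphere[OF d]] by (simp add: ip_commute[of d "e1 d"] mult.commute)
  finally show ?thesis .
qed

text \<open>Split w into its component along x and a vector v orthogonal to x. The reflection along
  v fixes \<open>ip d x y\<close> and changes the sign of \<open>ip d y v\<close>, so v contributes
  nothing; the component along x gives \<open>lam d f\<close> by
  \<open>integral_diag\<close>.\<close>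

lemma avg_ip:
  assumes x: "x \<in> sphere_pts d"
  shows "avg (\<lambda>y. ip d y w) x = lam d f * ip d x w"
proof -
  define v where "v = (\<lambda>i. w i - ip d x w * x i)"
  have xv: "ip d x v = 0" using x by (simp add: v_def ip_diff ip_cmult sphere_pts_def)
  have ipv: "ip d y v = ip d y w - ip d x w * ip d y x" for y by (simp only: v_def ip_diff ip_cmult)
  let ?R = "refl_pt d v"
  have b: "bdd_meas (sph d) (\<lambda>y. f (ip d x y) * ip d y v)"
    by (intro bdd_meas_mult kernel_bdd' x ip_sph_bdd)
  have "(\<integral>y. f (ip d x y) * ip d y v \<partial>sph d) = (\<integral>y. f (ip d x (?R y)) * ip d (?R y) v \<partial>sph d)"
    by (rule integral_refl[OF b, symmetric])
  also have "\<dots> = (\<integral>y. - (f (ip d x y) * ip d y v) \<partial>sph d)"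
  proof (intro Bochner_Integration.integral_cong refl)
    fix y
    have "ip d (?R y) v = - ip d y v"
      using ip_eq_0'[of d v y] by (cases "ip d v v = 0") (simp_all add: ip_refl_pt ip_commute[of d y v])
    then show "f (ip d x (?R y)) * ip d (?R y) v = - (f (ip d x y) * ip d y v)"
      by (simp add: ip_refl_pt(2) xv)
  qed
  finally have 0: "(\<integral>y. f (ip d x y) * ip d y v \<partial>sph d) = 0" by simp
  have "avg (\<lambda>y. ip d y w) x = (\<integral>y. f (ip d x y) * ip d y v + ip d x w * (f (ip d x y) * ip d y x) \<partial>sph d)"
    unfolding avg_def by (intro Bochner_Integration.integral_cong refl) (simp add: ipv algebra_simps)
  also have "\<dots> = ip d x w * lam d f"
    using b by (simp add: 0 integral_diag[OF x, symmetric] bdd_meas_integrable bdd_meas_mult kernel_bdd' x ip_sph_bdd)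
  finally show ?thesis by simp
qed

text \<open>Coupling by the reflection exchanging \<open>x\<close> and \<open>x'\<close>: monotonicity makes the loss equal to that of
  the linear function \<open>\<langle>\<cdot>, x - x'\<rangle>\<close>, which is an eigenfunction.\<close>
lemma avg_Lipschitz:
  assumes g: "bdd_meas (sph d) g" and L: "Lipschitz_sphere d L g" "0 \<le> L"
  shows "Lipschitz_sphere d (lam d f * L) (avg g)"
  unfolding Lipschitz_sphere_def
proof (intro ballI)
  fix x x' assume x: "x \<in> sphere_pts d" and x': "x' \<in> sphere_pts d"
  define w where "w = (\<lambda>i. x i - x' i)"
  let ?R = "refl_pt d w"
  have wed: "edist d x x' = sqrt (ip d w w)" by (simp add: edist_def w_def)
  have yw: "ip d y w = ip d x y - ip d x' y" for y
    by (simp add: w_def ip_diff ip_commute[of d y])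
  have sw: "ip d x (?R y) = ip d x' y" "ip d x' (?R y) = ip d x y" for y
    unfolding w_def by (rule ip_refl_pt_swap[OF x x'])+
  have ints: "bdd_meas (sph d) (\<lambda>y. f (ip d z y) * g y)" "bdd_meas (sph d) (\<lambda>y. f (ip d z y) * g (?R y))"
    "bdd_meas (sph d) (\<lambda>y. f (ip d z y) * ip d y w)"
    if "z \<in> sphere_pts d" for z
    by (intro bdd_meas_mult kernel_bdd' that g refl_bdd ip_sph_bdd)+
  have 1: "avg g x = (\<integral>y. f (ip d x' y) * g (?R y) \<partial>sph d)"
    using integral_refl[OF ints(1)[OF x], of w] by (simp add: avg_def sw)
  have 2: "avg g x' = (\<integral>y. f (ip d x y) * g (?R y) \<partial>sph d)"
    using integral_refl[OF ints(1)[OF x'], of w] by (simp add: avg_def sw)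
  \<comment> \<open>Each average is taken once directly and once through the reflection. The
    integrand is the product of \<open>f (ip d x y) - f (ip d x' y)\<close> and
    \<open>g y - g (?R y)\<close>.\<close>
  have eq: "2 * (avg g x - avg g x') = (\<integral>y. (f (ip d x y) * g y - f (ip d x y) * g (?R y)) -
      (f (ip d x' y) * g y - f (ip d x' y) * g (?R y)) \<partial>sph d)"
    using 1 2 ints[OF x] ints[OF x'] by (simp add: bdd_meas_integrable) (simp add: avg_def)
  have "\<bar>2 * (avg g x - avg g x')\<bar> \<le> (\<integral>y. \<bar>(f (ip d x y) * g y - f (ip d x y) * g (?R y)) -
      (f (ip d x' y) * g y - f (ip d x' y) * g (?R y))\<bar> \<partial>sph d)"
    unfolding eq by (rule integral_abs_bound)
  also have "\<dots> \<le> (\<integral>y. 2 * L / sqrt (ip d w w) * (f (ip d x y) * ip d y w - f (ip d x' y) * ip d y w) \<partial>sph d)"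
  proof (rule integral_mono)
    show "integrable (sph d) (\<lambda>y. \<bar>(f (ip d x y) * g y - f (ip d x y) * g (?R y)) -
      (f (ip d x' y) * g y - f (ip d x' y) * g (?R y))\<bar>)"
      by (rule bdd_meas_integrable[OF bdd_meas_abs[OF bdd_meas_diff[OF
            bdd_meas_diff[OF ints(1)[OF x] ints(2)[OF x]] bdd_meas_diff[OF ints(1)[OF x'] ints(2)[OF x']]]]])
    show "integrable (sph d) (\<lambda>y. 2 * L / sqrt (ip d w w) * (f (ip d x y) * ip d y w - f (ip d x' y) * ip d y w))"
      by (rule bdd_meas_integrable[OF bdd_meas_mult[OF bdd_meas_const bdd_meas_diff[OF ints(3)[OF x] ints(3)[OF x']]]])
    fix y assume "y \<in> space (sph d)"
    then have y: "y \<in> sphere_pts d" by (simp add: space_sph)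
    have "\<bar>(f (ip d x y) * g y - f (ip d x y) * g (?R y)) - (f (ip d x' y) * g y - f (ip d x' y) * g (?R y))\<bar>
      = \<bar>f (ip d x y) - f (ip d x' y)\<bar> * \<bar>g y - g (?R y)\<bar>"
      by (simp add: abs_mult[symmetric] algebra_simps)
    also have "\<dots> \<le> \<bar>f (ip d x y) - f (ip d x' y)\<bar> * (L * (2 * \<bar>ip d y w\<bar> / sqrt (ip d w w)))"
      using L y refl_pt_sphere[OF y, of w] unfolding Lipschitz_sphere_def edist_refl_pt[symmetric]
      by (intro mult_left_mono) auto
    also have "\<dots> = 2 * L / sqrt (ip d w w) * (\<bar>f (ip d x y) - f (ip d x' y)\<bar> * \<bar>ip d y w\<bar>)"
      by simp
    \<comment> \<open>Since \<open>f\<close> is increasing, both factors have the same sign, so the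
      absolute values drop and only averages of a linear function remain.\<close>
    also have "\<bar>f (ip d x y) - f (ip d x' y)\<bar> * \<bar>ip d y w\<bar> = (f (ip d x y) - f (ip d x' y)) * ip d y w"
    proof (cases "ip d x' y \<le> ip d x y")
      case True
      then have "f (ip d x' y) \<le> f (ip d x y)" by (rule mono_onD[OF mono ip_in[OF x' y] ip_in[OF x y]])
      then show ?thesis using True by (simp add: yw)
    next
      case False
      then have "f (ip d x y) \<le> f (ip d x' y)" by (intro mono_onD[OF mono ip_in[OF x y] ip_in[OF x' y]]) simp
      then show ?thesis using False by (simp add: yw abs_if) (simp add: algebra_simps)
    qed
    finally show "\<bar>(f (ip d x y) * g y - f (ip d x y) * g (?R y)) - (f (ip d x' y) * g y - f (ip d x' y) * g (?R y))\<bar>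
      \<le> 2 * L / sqrt (ip d w w) * (f (ip d x y) * ip d y w - f (ip d x' y) * ip d y w)"
      by (simp add: left_diff_distrib)
  qed
  also have "\<dots> = 2 * L / sqrt (ip d w w) * (avg (\<lambda>y. ip d y w) x - avg (\<lambda>y. ip d y w) x')"
    using ints(3)[OF x] ints(3)[OF x'] by (simp add: avg_def bdd_meas_integrable)
  also have "\<dots> = 2 * L / sqrt (ip d w w) * (lam d f * ip d w w)"
    unfolding avg_ip[OF x] avg_ip[OF x'] by (simp add: yw[of w] right_diff_distrib)
  also have "\<dots> = 2 * (lam d f * L * sqrt (ip d w w))"
    using real_sqrt_mult_self[of "ip d w w"] ip_nonneg[of d w]
    by (cases "ip d w w = 0") (simp_all add: field_simps)
  finally show "\<bar>avg g x - avg g x'\<bar> \<le> lam d f * L * edist d x x'"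
    unfolding wed by (simp add: abs_mult)
qed

end

section \<open>Mean-square contraction and decay in sup norm\<close>

context monotone_zonal_kernel
begin

lemma one_le_f1: "1 \<le> f 1"
proof -
  have x: "e1 d \<in> sphere_pts d" by (rule e1_sphere[OF d])
  have "1 = (\<integral>y. f (ip d (e1 d) y) \<partial>sph d)" using kernel_integral[of "e1 d"] x by (simp add: space_sph)
  also have "\<dots> \<le> (\<integral>y. f 1 \<partial>sph d)"
  proof (intro integral_mono bdd_meas_integrable kernel_bdd' bdd_meas_const x)
    fix y assume "y \<in> space (sph d)"
    then have "ip d (e1 d) y \<in> {-1..1}" using ip_in[OF x] by (simp add: space_sph)
    then show "f (ip d (e1 d) y) \<le> f 1" by (intro mono_onD[OF mono]) auto
  qed
  finally show ?thesis by (simp add: prob_space)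
qed

lemma kernel_range:
  "x \<in> sphere_pts d \<Longrightarrow> y \<in> sphere_pts d \<Longrightarrow> 0 \<le> f (ip d x y) \<and> f (ip d x y) \<le> f 1"
  using ip_in[of x y] kernel_nonneg[of x y] by (auto simp: space_sph intro!: mono_onD[OF mono])

lemma lam_le_1: "lam d f \<le> 1"
proof -
  have x: "e1 d \<in> sphere_pts d" by (rule e1_sphere[OF d])
  have "lam d f = avg (\<lambda>y. ip d y (e1 d)) (e1 d)" by (simp add: lam_def avg_def mult.commute)
  also have "\<bar>\<dots>\<bar> \<le> 1"
    using x abs_ip_sphere by (intro avg_bound ip_sph_bdd) (auto simp: space_sph)
  finally show ?thesis by simp
qed

lemma Lipschitz_center_bound:
  assumes g: "bdd_meas (sph d) g" and L: "Lipschitz_sphere d L g" "0 \<le> L" and x: "x \<in> sphere_pts d"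
  shows "\<bar>center g x\<bar> \<le> 2 * L"
proof -
  have "center g x = (\<integral>y. g x - g y \<partial>sph d)"
    using g by (simp add: center_def bdd_meas_integrable prob_space)
  also have "\<bar>\<dots>\<bar> \<le> 2 * L"
  proof (rule abs_integral_le)
    show "(\<lambda>y. g x - g y) \<in> borel_measurable (sph d)" by (intro bdd_measD bdd_meas_diff bdd_meas_const g)
    fix y assume "y \<in> space (sph d)"
    then have y: "y \<in> sphere_pts d" by (simp add: space_sph)
    have "\<bar>g x - g y\<bar> \<le> L * edist d x y" using L x y by (simp add: Lipschitz_sphere_def)
    also have "\<dots> \<le> L * 2" using edist_sphere_le[OF x y] L by (intro mult_left_mono)
    finally show "\<bar>g x - g y\<bar> \<le> 2 * L" by simp
  qed
  finally show ?thesis .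
qed

lemma avg_pow_Lipschitz:
  assumes g: "bdd_meas (sph d) g" and L: "Lipschitz_sphere d L g" "0 \<le> L" and lam: "0 < lam d f"
  shows "Lipschitz_sphere d (lam d f ^ n * L) ((avg ^^ n) g)"
proof (induction n)
  case (Suc n)
  have "Lipschitz_sphere d (lam d f * (lam d f ^ n * L)) (avg ((avg ^^ n) g))"
    using Suc L lam by (intro avg_Lipschitz avg_pow_bdd g) auto
  then show ?case by (simp add: mult.assoc)
qed (use L in simp)

text \<open>Lipschitz contraction gives the decay of \<open>\<parallel>avg\<^sup>n g\<parallel>\<close> with an unspecified constant; self-adjointness
  makes \<open>n \<mapsto> \<parallel>avg\<^sup>n g\<parallel>\<^sup>2\<close> log-convex, which removes the constant.\<close>
lemma L2_contraction:
  assumes g: "bdd_meas (sph d) g" and L: "Lipschitz_sphere d L g" "0 \<le> L" and lam: "0 < lam d f"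
    and mean: "(\<integral>x. g x \<partial>sph d) = 0"
  shows "(\<integral>x. ((avg ^^ n) g x)\<^sup>2 \<partial>sph d) \<le> ((lam d f)\<^sup>2) ^ n * (\<integral>x. (g x)\<^sup>2 \<partial>sph d)"
proof -
  define a where "a n = (\<integral>x. ((avg ^^ n) g x)\<^sup>2 \<partial>sph d)" for n
  have "a n \<le> ((lam d f)\<^sup>2) ^ n * a 0"
  proof (rule log_convex_ratio_bound)
    show "0 \<le> a n" for n by (simp add: a_def)
    show "(a (Suc n))\<^sup>2 \<le> a n * a (Suc (Suc n))" for n
    proof -
      \<comment> \<open>Moving one \<open>avg\<close> across gives the scalar product of the
        iterates n and n + 2; Cauchy-Schwarz for it is log-convexity.\<close>
      have "a (Suc n) = (\<integral>x. avg ((avg ^^ n) g) x * (avg ^^ Suc n) g x \<partial>sph d)"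
        by (simp add: a_def power2_eq_square)
      also have "\<dots> = (\<integral>x. (avg ^^ n) g x * avg ((avg ^^ Suc n) g) x \<partial>sph d)"
        by (rule avg_self_adjoint[symmetric]) (intro avg_pow_bdd g)+
      finally have "a (Suc n) = (\<integral>x. (avg ^^ n) g x * (avg ^^ Suc (Suc n)) g x \<partial>sph d)" by simp
      then show ?thesis
        unfolding a_def[of n] a_def[of "Suc (Suc n)"]
        using Cauchy_Schwarz_integral[OF avg_pow_bdd[OF g, of n] avg_pow_bdd[OF g, of "Suc (Suc n)"]] by simp
    qed
    \<comment> \<open>A function of mean zero is bounded by twice its Lipschitz constant, the sphere
      having diameter 2. The factor \<open>(2 * L)\<^sup>2\<close> is the constant that
      log-convexity discards.\<close>
    show "a n \<le> (2 * L)\<^sup>2 * ((lam d f)\<^sup>2) ^ n" for n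
    proof -
      have "\<bar>(avg ^^ n) g x\<bar> \<le> 2 * (lam d f ^ n * L)" if "x \<in> sphere_pts d" for x
        using Lipschitz_center_bound[OF avg_pow_bdd[OF g] avg_pow_Lipschitz[OF g L lam] _ that, of n] L lam
        by (simp add: center_def avg_pow_integral g mean)
      then have "((avg ^^ n) g x)\<^sup>2 \<le> (2 * (lam d f ^ n * L))\<^sup>2" if "x \<in> sphere_pts d" for x
        using that by (metis abs_ge_zero power2_abs power_mono)
      then have "a n \<le> (\<integral>x. (2 * (lam d f ^ n * L))\<^sup>2 \<partial>sph d)"
        unfolding a_def power2_eq_square
        by (intro integral_mono bdd_meas_integrable bdd_meas_mult avg_pow_bdd g bdd_meas_const)
           (auto simp: space_sph power2_eq_square)
      also have "\<dots> = (2 * L)\<^sup>2 * ((lam d f)\<^sup>2) ^ n"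
        by (simp add: prob_space power_mult_distrib power_mult[symmetric] mult.commute)
      finally show ?thesis .
    qed
    show "0 < (lam d f)\<^sup>2" using lam by simp
  qed
  then show ?thesis by (simp add: a_def)
qed

text \<open>A kernel section F satisfies \<open>F * F \<le> f 1 * F\<close> and has integral 1, so
  its mean-square size is of order \<open>sqrt (f 1)\<close>; contraction supplies
  \<open>lam d f ^ n\<close>, and the \<open>L1\<close> norm is at most the \<open>L2\<close> norm.
  As the contraction is available for Lipschitz functions only, a polynomial P in
  \<open>ip d x y\<close> replaces F.\<close>

lemma kernel_power_L1:
  assumes x: "x \<in> sphere_pts d" and lam: "0 < lam d f"
  shows "(\<integral>y. \<bar>(avg ^^ n) (\<lambda>y. f (ip d x y)) y - 1\<bar> \<partial>sph d) \<le> 3 * lam d f ^ n * sqrt (f 1)"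
proof -
  \<comment> \<open>The approximation error enters twice, at a total cost of
    \<open>lam d f ^ n\<close>. The approximant may depend on n, because its Lipschitz constant does
    not occur in the conclusion of \<open>L2_contraction\<close>.\<close>
  define \<epsilon> where "\<epsilon> = lam d f ^ n / 2"
  have \<epsilon>: "0 < \<epsilon>" "\<epsilon> \<le> 1" using lam lam_le_1 power_le_one[of "lam d f" n] by (auto simp: \<epsilon>_def)
  obtain p where p: "real_polynomial_function p" "\<And>t. t \<in> {-1..1} \<Longrightarrow> \<bar>f t - p t\<bar> < \<epsilon>"
    using Stone_Weierstrass_real_polynomial_function[OF compact_Icc cont \<epsilon>(1)] by blast
  obtain L B where L: "0 \<le> L" "\<forall>t\<in>{-1..1}. \<bar>p t\<bar> \<le> B" "\<forall>t\<in>{-1..1}. \<forall>u\<in>{-1..1}. \<bar>p t - p u\<bar> \<le> L * \<bar>t - u\<bar>"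
    using real_polynomial_function_Lipschitz[OF p(1)] by blast
  define F where "F y = f (ip d x y)" for y
  define P where "P y = p (ip d x y)" for y
  have F: "bdd_meas (sph d) F" unfolding F_def by (rule kernel_bdd'[OF x])
  have P: "bdd_meas (sph d) P"
  proof (rule bdd_measI[where c=B])
    have "continuous_on UNIV p" using p(1) by (simp add: continuous_on_polymonial_function real_polynomial_function_eq)
    then have "p \<in> borel_measurable borel" by (rule borel_measurable_continuous_onI)
    moreover have "(\<lambda>y. ip d x y) \<in> borel_measurable (sph d)"
      using bdd_measD[OF ip_sph_bdd[of d x]] by (simp add: ip_commute)
    ultimately show "P \<in> borel_measurable (sph d)" unfolding P_def by (rule measurable_compose[rotated])
    show "\<bar>P y\<bar> \<le> B" if "y \<in> space (sph d)" for y
      using that L(2) ip_in[OF x] by (auto simp: P_def space_sph)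
  qed
  have FP: "\<bar>F y - P y\<bar> \<le> \<epsilon>" if "y \<in> space (sph d)" for y
    using p(2)[OF ip_in[OF x, of y]] that by (simp add: F_def P_def space_sph less_imp_le)
  have intF: "(\<integral>y. F y \<partial>sph d) = 1" using kernel_integral[of x] x by (simp add: F_def space_sph)
  have lip: "Lipschitz_sphere d L (center P)"
    unfolding Lipschitz_sphere_def
  proof (intro ballI)
    fix y y' assume y: "y \<in> sphere_pts d" "y' \<in> sphere_pts d"
    have "\<bar>center P y - center P y'\<bar> \<le> L * \<bar>ip d x y - ip d x y'\<bar>"
      using L(3) ip_in[OF x] y by (simp add: center_def P_def)
    also have "\<dots> \<le> L * edist d y y'"
      unfolding edist_def using L(1) by (intro mult_left_mono ip_dist_bound x)
    finally show "\<bar>center P y - center P y'\<bar> \<le> L * edist d y y'" .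
  qed
  define Q where "Q = (avg ^^ n) (center P)"
  have Q: "bdd_meas (sph d) Q" unfolding Q_def by (intro avg_pow_bdd center_bdd P)
  have near: "\<bar>(avg ^^ n) F y - 1\<bar> \<le> \<bar>Q y\<bar> + 2 * \<epsilon>" if y: "y \<in> space (sph d)" for y
  proof -
    have "Q y = (avg ^^ n) P y - (\<integral>y. P y \<partial>sph d)"
      unfolding Q_def center_def[abs_def] using avg_pow_diff[OF P bdd_meas_const y] avg_pow_const[OF y] by simp
    moreover have "\<bar>(avg ^^ n) (\<lambda>y. F y - P y) y\<bar> \<le> \<epsilon>"
      by (rule avg_pow_bound[OF bdd_meas_diff[OF F P] FP y])
    moreover have "(avg ^^ n) (\<lambda>y. F y - P y) y = (avg ^^ n) F y - (avg ^^ n) P y"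
      by (rule avg_pow_diff[OF F P y])
    moreover have "\<bar>\<integral>y. F y - P y \<partial>sph d\<bar> \<le> \<epsilon>"
      by (rule abs_integral_le[OF bdd_measD[OF bdd_meas_diff[OF F P]] FP])
    moreover have "(\<integral>y. F y - P y \<partial>sph d) = 1 - (\<integral>y. P y \<partial>sph d)"
      using F P intF by (simp add: bdd_meas_integrable)
    ultimately show ?thesis by linarith
  qed
  \<comment> \<open>From \<open>\<bar>P y\<bar> \<le> F y + 1\<close> the square is at most
    \<open>(f 1 + 2) * F y + 1\<close>, whose integral is \<open>f 1 + 3\<close>; since
    \<open>1 \<le> f 1\<close>, this is at most \<open>4 * f 1\<close>.\<close>
  have P2: "(\<integral>y. (center P y)\<^sup>2 \<partial>sph d) \<le> 4 * f 1"
  proof -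
    have int: "integrable (sph d) P" "integrable (sph d) (\<lambda>y. (P y)\<^sup>2)" "integrable (sph d) F"
      unfolding power2_eq_square by (intro bdd_meas_integrable bdd_meas_mult P F)+
    define m where "m = (\<integral>y. P y \<partial>sph d)"
    have "(\<integral>y. (center P y)\<^sup>2 \<partial>sph d) = (\<integral>y. (P y)\<^sup>2 - 2 * m * P y + m\<^sup>2 \<partial>sph d)"
      by (intro Bochner_Integration.integral_cong refl) (simp add: center_def m_def power2_eq_square algebra_simps)
    also have "\<dots> = (\<integral>y. (P y)\<^sup>2 \<partial>sph d) - m\<^sup>2"
      using int by (simp add: m_def[symmetric] prob_space power2_eq_square)
    also have "\<dots> \<le> (\<integral>y. (P y)\<^sup>2 \<partial>sph d)" by simp
    also have "\<dots> \<le> (\<integral>y. (f 1 + 2) * F y + 1 \<partial>sph d)"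
    proof (rule integral_mono[OF int(2)])
      show "integrable (sph d) (\<lambda>y. (f 1 + 2) * F y + 1)" using int by simp
      fix y assume y: "y \<in> space (sph d)"
      have "\<bar>P y\<bar> \<le> F y + 1"
        using FP[OF y] \<epsilon> kernel_range[OF x, of y] y by (auto simp: F_def space_sph)
      then have "(P y)\<^sup>2 \<le> (F y + 1)\<^sup>2" by (metis abs_ge_zero power2_abs power_mono)
      also have "\<dots> = F y * F y + 2 * F y + 1" by (simp add: power2_eq_square algebra_simps)
      also have "F y * F y \<le> f 1 * F y"
        using kernel_range[OF x, of y] y by (intro mult_right_mono) (auto simp: F_def space_sph)
      finally show "(P y)\<^sup>2 \<le> (f 1 + 2) * F y + 1" by (simp add: algebra_simps)
    qed
    also have "\<dots> = f 1 + 3" using int intF by (simp add: prob_space)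
    also have "\<dots> \<le> 4 * f 1" using one_le_f1 by simp
    finally show ?thesis .
  qed
  have "(\<integral>y. \<bar>Q y\<bar> \<partial>sph d) \<le> 2 * lam d f ^ n * sqrt (f 1)"
  proof (rule power2_le_imp_le)
    have "(\<integral>y. \<bar>Q y\<bar> \<partial>sph d)\<^sup>2 \<le> (\<integral>y. (Q y)\<^sup>2 \<partial>sph d)"
      using Cauchy_Schwarz_integral[OF bdd_meas_abs[OF Q] bdd_meas_const[of _ 1]] by (simp add: prob_space)
    also have "\<dots> \<le> ((lam d f)\<^sup>2) ^ n * (\<integral>y. (center P y)\<^sup>2 \<partial>sph d)"
      unfolding Q_def by (rule L2_contraction[OF center_bdd[OF P] lip L(1) lam center_integral[OF P]])
    also have "\<dots> \<le> ((lam d f)\<^sup>2) ^ n * (4 * f 1)" using P2 by (intro mult_left_mono) auto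
    also have "\<dots> = (2 * lam d f ^ n * sqrt (f 1))\<^sup>2"
      using one_le_f1 by (simp add: power_mult_distrib power_mult[symmetric] mult.commute)
    finally show "(\<integral>y. \<bar>Q y\<bar> \<partial>sph d)\<^sup>2 \<le> (2 * lam d f ^ n * sqrt (f 1))\<^sup>2" .
  qed (use lam one_le_f1 in simp)
  moreover have "(\<integral>y. \<bar>(avg ^^ n) F y - 1\<bar> \<partial>sph d) \<le> (\<integral>y. \<bar>Q y\<bar> + 2 * \<epsilon> \<partial>sph d)"
    by (intro integral_mono bdd_meas_integrable bdd_meas_abs bdd_meas_diff bdd_meas_add bdd_meas_const avg_pow_bdd F Q near)
  moreover have "(\<integral>y. \<bar>Q y\<bar> + 2 * \<epsilon> \<partial>sph d) = (\<integral>y. \<bar>Q y\<bar> \<partial>sph d) + 2 * \<epsilon>"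
    using Q by (simp add: bdd_meas_integrable bdd_meas_abs prob_space)
  moreover have "2 * \<epsilon> \<le> lam d f ^ n * sqrt (f 1)"
    using one_le_f1 lam by (simp add: \<epsilon>_def)
  ultimately show ?thesis by (simp add: F_def[abs_def])
qed

text \<open>Without decay, centring at most doubles the sup norm. For decay, one of the n + 1 steps
  expresses the value at x as a pairing with the kernel section at x, and self-adjointness moves the
  other n steps onto that section.\<close>

lemma center_power_bounds:
  assumes g: "bdd_meas (sph d) g" and c: "\<And>y. y \<in> sphere_pts d \<Longrightarrow> \<bar>g y\<bar> \<le> c" and x: "x \<in> sphere_pts d"
    and lam: "0 < lam d f"
  shows "\<bar>(avg ^^ n) (center g) x\<bar> \<le> 2 * c"
    and "\<bar>(avg ^^ Suc n) (center g) x\<bar> \<le> 3 * lam d f ^ n * sqrt (f 1) * c"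
proof -
  have ig: "\<bar>\<integral>y. g y \<partial>sph d\<bar> \<le> c" by (rule abs_integral_le[OF bdd_measD[OF g]]) (simp add: space_sph c)
  have "\<bar>center g y\<bar> \<le> 2 * c" if "y \<in> space (sph d)" for y
    using c[of y] ig that by (simp add: center_def space_sph)
  then show "\<bar>(avg ^^ n) (center g) x\<bar> \<le> 2 * c"
    using x by (intro avg_pow_bound center_bdd g) (auto simp: space_sph)
  define F where "F y = f (ip d x y)" for y
  have F: "bdd_meas (sph d) F" unfolding F_def by (rule kernel_bdd'[OF x])
  have intF: "(\<integral>y. F y \<partial>sph d) = 1" using kernel_integral[of x] x by (simp add: F_def space_sph)
  have b: "bdd_meas (sph d) ((avg ^^ n) F)" by (rule avg_pow_bdd[OF F])
  have "(avg ^^ Suc n) (center g) x = (\<integral>y. F y * (avg ^^ n) (center g) y \<partial>sph d)"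
    by (simp add: avg_def[of _ x] F_def)
  also have "\<dots> = (\<integral>y. (avg ^^ n) F y * center g y \<partial>sph d)"
    by (rule avg_pow_self_adjoint[OF F center_bdd[OF g]])
  also have "\<dots> = (\<integral>y. (avg ^^ n) F y * g y \<partial>sph d) - (\<integral>y. g y \<partial>sph d)"
    unfolding center_def using b g
    by (simp add: right_diff_distrib bdd_meas_integrable bdd_meas_mult avg_pow_integral[OF F] intF)
  also have "\<dots> = (\<integral>y. ((avg ^^ n) F y - 1) * g y \<partial>sph d)"
    using b g by (simp add: left_diff_distrib bdd_meas_integrable bdd_meas_mult)
  also have "\<bar>\<dots>\<bar> \<le> (\<integral>y. \<bar>((avg ^^ n) F y - 1) * g y\<bar> \<partial>sph d)" by (rule integral_abs_bound)
  also have "\<dots> \<le> (\<integral>y. \<bar>(avg ^^ n) F y - 1\<bar> * c \<partial>sph d)"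
    using c by (intro integral_mono bdd_meas_integrable bdd_meas_abs bdd_meas_mult bdd_meas_diff bdd_meas_const b g)
       (auto simp: abs_mult space_sph intro!: mult_left_mono)
  also have "\<dots> = (\<integral>y. \<bar>(avg ^^ n) F y - 1\<bar> \<partial>sph d) * c" by simp
  also have "\<dots> \<le> 3 * lam d f ^ n * sqrt (f 1) * c"
    using kernel_power_L1[OF x lam, of n] c[OF x] unfolding F_def[abs_def] by (intro mult_right_mono) auto
  finally show "\<bar>(avg ^^ Suc n) (center g) x\<bar> \<le> 3 * lam d f ^ n * sqrt (f 1) * c" .
qed

end

text \<open>Averaging with the reflection along \<open>e1 d\<close> turns the integrand of
  \<open>2 * lam d f\<close> into \<open>t * (f t - f (- t))\<close>, which is nonpositive for
  decreasing \<open>f\<close>. A positive \<open>lam d f\<close> thus leaves the increasing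
  case.\<close>

lemma lam_nonpos:
  assumes d: "1 \<le> d" and mk: "markov_kernel d f" and anti: "antimono_on {-1..1} f"
    and cont: "continuous_on {-1..1} f"
  shows "lam d f \<le> 0"
proof -
  interpret symmetric_kernel "sph d" "\<lambda>x y. f (ip d x y)"
    by (rule markov_kernel_symmetric_kernel[OF d mk cont])
  let ?R = "refl_pt d (e1 d)"
  have e: "e1 d \<in> sphere_pts d" by (rule e1_sphere[OF d])
  then have e1: "ip d (e1 d) (e1 d) = 1" by (simp add: sphere_pts_def)
  have R: "ip d (?R y) (e1 d) = - ip d y (e1 d)" "ip d (e1 d) (?R y) = - ip d (e1 d) y" for y
    by (simp_all add: ip_refl_pt e1 ip_commute[of d y])
  have b: "bdd_meas (sph d) (\<lambda>y. ip d y (e1 d) * f (ip d (e1 d) y))"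
    using kernel_section[of "e1 d"] e by (intro bdd_meas_mult ip_sph_bdd) (simp add: space_sph)
  have b': "bdd_meas (sph d) (\<lambda>y. ip d (?R y) (e1 d) * f (ip d (e1 d) (?R y)))"
    by (rule bdd_meas_compose[OF b refl_pt_sph_measurable])
  have "lam d f = (\<integral>y. ip d (?R y) (e1 d) * f (ip d (e1 d) (?R y)) \<partial>sph d)"
    unfolding lam_def by (rule integral_sph_refl_pt[OF d bdd_measD[OF b], symmetric])
  then have "2 * lam d f = (\<integral>y. ip d y (e1 d) * f (ip d (e1 d) y) + ip d (?R y) (e1 d) * f (ip d (e1 d) (?R y)) \<partial>sph d)"
    using b b' by (simp add: bdd_meas_integrable) (simp add: lam_def)
  also have "\<dots> \<le> (\<integral>y. 0 \<partial>sph d)"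
  proof (intro integral_mono bdd_meas_integrable bdd_meas_add b b' bdd_meas_const)
    fix y assume "y \<in> space (sph d)"
    then have t: "\<bar>ip d (e1 d) y\<bar> \<le> 1" using abs_ip_sphere[OF e] by (simp add: space_sph)
    define t where "t = ip d (e1 d) y"
    have "t * (f t - f (- t)) \<le> 0"
    proof (cases "0 \<le> t")
      case True
      then have "f t \<le> f (- t)" using anti t unfolding t_def[symmetric] by (intro monotone_onD[OF anti]) auto
      then show ?thesis using True by (simp add: mult_nonneg_nonpos)
    next
      case False
      then have "f (- t) \<le> f t" using anti t unfolding t_def[symmetric] by (intro monotone_onD[OF anti]) auto
      then show ?thesis using False by (simp add: mult_nonpos_nonneg)
    qed
    then show "ip d y (e1 d) * f (ip d (e1 d) y) + ip d (?R y) (e1 d) * f (ip d (e1 d) (?R y)) \<le> 0"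
      unfolding R by (simp add: t_def ip_commute[of d y] algebra_simps)
  qed
  finally show ?thesis by simp
qed

text \<open>With A and l the negatives of the two logarithms, \<open>s ^ k\<close> is the
  exponential of \<open>k * l / (4 * A)\<close>. The second claim is restricted to
  \<open>2 < s ^ Suc n\<close> because at earlier times the bound without decay suffices; by then
  enough time has passed for \<open>\<rho> ^ n\<close> to absorb both \<open>sqrt F\<close> and the
  growth of \<open>s ^ Suc n\<close>.\<close>

lemma mixing_rate:
  fixes \<rho> F M :: real
  assumes \<rho>: "0 < \<rho>" "\<rho> < 1" and F: "1 \<le> F"
  defines "M \<equiv> ln (\<rho> * (1 - \<rho>) / F) / ln \<rho>"
  defines "s \<equiv> exp (1 / (4 * M))"
  shows "1 \<le> M"
    and "2 < s ^ Suc n \<Longrightarrow> 3 * \<rho> ^ n * sqrt F * s ^ Suc n \<le> 4"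
proof -
  define l where "l = - ln \<rho>"
  define A where "A = - ln (\<rho> * (1 - \<rho>) / F)"
  have l: "0 < l" using \<rho> by (simp add: l_def)
  have A: "A = l + ln F - ln (1 - \<rho>)"
    using \<rho> F by (simp add: A_def l_def ln_div ln_mult)
  have nn: "0 \<le> ln F" "0 \<le> - ln (1 - \<rho>)" using \<rho> F by auto
  have M: "M = A / l" by (simp add: M_def A_def l_def)
  have Al: "l \<le> A" using A nn by simp
  show M1: "1 \<le> M" using Al l by (simp add: M)
  \<comment> \<open>Here the factor \<open>1 - \<rho>\<close> inside the logarithm matters:
    \<open>\<rho> * (1 - \<rho>) \<le> 1 / 4\<close> keeps A away from 0 even when
    \<open>\<rho>\<close> and F are close to 1.\<close>
  have A1: "1 \<le> A"
  proof -
    have "\<rho> * (1 - \<rho>) / F \<le> 1 / 4"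
    proof -
      have "0 \<le> (\<rho> - 1 / 2)\<^sup>2" by simp
      then have "\<rho> * (1 - \<rho>) \<le> 1 / 4" by (simp add: power2_eq_square algebra_simps)
      moreover have "\<rho> * (1 - \<rho>) / F \<le> \<rho> * (1 - \<rho>) / 1" using \<rho> F by (intro divide_left_mono) auto
      ultimately show ?thesis by linarith
    qed
    then have "ln (\<rho> * (1 - \<rho>) / F) \<le> ln (1 / 4)" using \<rho> F by (subst ln_le_cancel_iff) auto
    also have "\<dots> = - (2 * ln 2)" using ln_realpow[of 2 2] by (simp add: ln_div)
    finally show ?thesis using ln2_ge_two_thirds by (simp add: A_def)
  qed
  have s: "s ^ k = exp (real k * l / (4 * A))" for k
    using l Al by (simp add: s_def M exp_of_nat_mult[symmetric])
  assume "2 < s ^ Suc n"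
  then have "ln 2 < real (Suc n) * l / (4 * A)" unfolding s by (simp add: ln_less_cancel_iff[symmetric] del: of_nat_Suc)
  then have "2 / 3 < real (Suc n) * l / (4 * A)" using ln2_ge_two_thirds by linarith
  \<comment> \<open>A quarter of \<open>real (Suc n) * l\<close> pays for the growth of
    \<open>s ^ Suc n\<close>; the other three quarters exceed 2 A, which covers l + ln F /
    2.\<close>
  then have big: "8 / 3 * A < real (Suc n) * l" using A1 by (simp add: field_simps)
  have "real (Suc n) * l / (4 * A) \<le> real (Suc n) * l / 4"
    using A1 l by (intro divide_left_mono) auto
  moreover have "real (Suc n) * l = real n * l + l" by (simp add: algebra_simps)
  ultimately have "- (real n * l) + ln F / 2 + real (Suc n) * l / (4 * A) \<le> l + ln F / 2 - 3 / 4 * (real (Suc n) * l)"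
    by linarith
  also have "\<dots> \<le> 0" using big A nn l by linarith
  finally have E: "- (real n * l) + ln F / 2 + real (Suc n) * l / (4 * A) \<le> 0" .
  have "\<rho> ^ n = exp (- (real n * l))"
    using \<rho> by (simp add: l_def exp_of_nat_mult)
  moreover have "sqrt F = exp (ln F / 2)"
    using F by (simp add: ln_sqrt[symmetric])
  ultimately have "3 * \<rho> ^ n * sqrt F * s ^ Suc n = 3 * exp (- (real n * l) + ln F / 2 + real (Suc n) * l / (4 * A))"
    unfolding s by (simp only: exp_add mult.assoc)
  also have "\<dots> \<le> 3 * exp 0" using E by (intro mult_left_mono) (simp only: exp_le_cancel_iff, simp)
  finally show "3 * \<rho> ^ n * sqrt F * s ^ Suc n \<le> 4" by simp
qed

lemma (in monotone_zonal_kernel) mixing_kernel_sph: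
  assumes lam: "0 < lam d f" "lam d f < 1"
  shows "mixing_kernel (sph d) (\<lambda>x y. f (ip d x y))
    (exp (1 / (4 * (ln (lam d f * (1 - lam d f) / f 1) / ln (lam d f)))))"
proof -
  define s where "s = exp (1 / (4 * (ln (lam d f * (1 - lam d f) / f 1) / ln (lam d f))))"
  note rate = mixing_rate[OF lam one_le_f1, folded s_def]
  have "0 < ln (lam d f * (1 - lam d f) / f 1) / ln (lam d f)" using rate(1) by linarith
  then have s: "1 < s"
    unfolding s_def one_less_exp_iff by (rule divide_pos_pos[OF zero_less_one mult_pos_pos[OF zero_less_numeral]])
  have "\<bar>(avg ^^ n) (center g) z\<bar> \<le> 4 * c / s ^ n"
    if g: "bdd_meas (sph d) g" and c: "\<And>x. x \<in> space (sph d) \<Longrightarrow> \<bar>g x\<bar> \<le> c" and z: "z \<in> space (sph d)" for g c z n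
  proof -
    have c0: "0 \<le> c" using c[OF z] by simp
    have c': "\<bar>g y\<bar> \<le> c" if "y \<in> sphere_pts d" for y using c that by (simp add: space_sph)
    have z': "z \<in> sphere_pts d" using z by (simp add: space_sph)
    note b = center_power_bounds[OF g c' z' lam(1)]
    have "\<bar>(avg ^^ n) (center g) z\<bar> * s ^ n \<le> 4 * c"
    \<comment> \<open>Up to the time when \<open>s ^ n\<close> reaches 2, the bound 2 c without
      decay already gives 2 * 2 = 4.\<close>
    proof (cases "s ^ n \<le> 2")
      case True
      have "\<bar>(avg ^^ n) (center g) z\<bar> * s ^ n \<le> (2 * c) * 2"
        using b(1)[of n] True c0 s by (intro mult_mono) auto
      then show ?thesis by simp
    next
      case False
      then obtain m where m: "n = Suc m" by (cases n) auto
      have "\<bar>(avg ^^ n) (center g) z\<bar> * s ^ n \<le> (3 * lam d f ^ m * sqrt (f 1) * c) * s ^ Suc m"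
        unfolding m using b(2)[of m] s by (intro mult_right_mono) auto
      also have "\<dots> = (3 * lam d f ^ m * sqrt (f 1) * s ^ Suc m) * c" by simp
      also have "\<dots> \<le> 4 * c" using rate(2)[of m] False m c0 by (intro mult_right_mono) auto
      finally show ?thesis .
    qed
    then show ?thesis using s by (simp add: field_simps)
  qed
  then show ?thesis
    unfolding s_def[symmetric] by unfold_locales (use s in auto)
qed

text \<open>In \<open>X\<close> the factor 2 absorbs the ceiling in the growth condition, as
  \<open>1 < q\<close>, and the division by \<open>decay\<close> turns the exponent k - 1 into
  k.\<close>

lemma zero_percolation_mixing:
  assumes mk: "mixing_kernel (sph d) (\<lambda>x y. f (ip d x y)) s"
    and T: "is_tree T" "growth_at_most q T" and q: "1 < q"
    and small: "q * mixing_kernel.decay s < 1"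
  shows "zero_percolation d f T"
proof -
  interpret mixing_kernel "sph d" "\<lambda>x y. f (ip d x y)" s by (rule mk)
  define X where "X k = 2 * ln 17 / decay * (q * decay) ^ k" for k
  have fin: "finite (level T l)" for l using T(2) by (simp add: growth_at_most_def)
  have bound: "0 \<le> expected_TV d f T k \<and> expected_TV d f T k \<le> (exp (X k) - 1) / 4" if k: "0 < k" for k
  proof -
    obtain C where C: "0 \<le> C" "0 \<le> expected_TV d f T k" "expected_TV d f T k \<le> C"
      "ln (1 + 4 * C) \<le> decay ^ (k - 1) * ln 17 * card (level T k)"
      using expected_TV_bound[OF mk T(1) fin k] by blast
    have "real (card (level T k)) \<le> of_int \<lceil>q ^ k\<rceil>" using T(2) by (simp add: growth_at_most_def)
    also have "\<dots> \<le> q ^ k + 1" by linarith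
    also have "\<dots> \<le> 2 * q ^ k" using q by simp
    finally have card: "real (card (level T k)) \<le> 2 * q ^ k" .
    have "ln (1 + 4 * C) \<le> decay ^ (k - 1) * ln 17 * (2 * q ^ k)"
      using C(4) card decay_bounds by (elim order_trans, intro mult_left_mono) auto
    also have "\<dots> = X k"
      using k decay_bounds by (cases k) (simp_all add: X_def power_mult_distrib)
    finally have "exp (ln (1 + 4 * C)) \<le> exp (X k)" by simp
    then have "1 + 4 * C \<le> exp (X k)" using C(1) by simp
    then show ?thesis using C by simp
  qed
  have "X \<longlonglongrightarrow> 2 * ln 17 / decay * 0"
    unfolding X_def using small q decay_bounds
    by (intro tendsto_mult tendsto_const LIMSEQ_power_zero) auto
  then have "(\<lambda>k. (exp (X k) - 1) / 4) \<longlonglongrightarrow> (exp 0 - 1) / 4"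
    by (intro tendsto_intros) simp_all
  then have lim: "(\<lambda>k. (exp (X k) - 1) / 4) \<longlonglongrightarrow> 0" by simp
  show ?thesis
    unfolding zero_percolation_def
    by (rule tendsto_sandwich[OF _ _ tendsto_const lim])
       (use bound in \<open>auto intro!: eventually_sequentiallyI[of 1]\<close>)
qed

theorem theorem3:
  shows "\<exists>c::real. c > 0 \<and>
    (\<forall>(d::nat) (f::real \<Rightarrow> real) (q::real) (T::nat list set).
       1 \<le> d \<longrightarrow>
       markov_kernel d f \<longrightarrow>
       (mono_on {-1..1} f \<or> antimono_on {-1..1} f) \<longrightarrow>
       continuous_on {-1..1} f \<longrightarrow>
       lam d f > 0 \<longrightarrow>
       spectral_bound d f \<longrightarrow>
       q > 1 \<longrightarrow>
       is_tree T \<longrightarrow>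
       growth_at_most q T \<longrightarrow>
       q \<le> 1 / (1 - c * (ln (lam d f) * (1 - lam d f)^2)
                     / ln (lam d f * (1 - lam d f) / f 1)) \<longrightarrow>
       zero_percolation d f T)"
proof (intro exI[of _ "1 / 200"] conjI allI impI)
  fix d :: nat and f :: "real \<Rightarrow> real" and q :: real and T :: "nat list set"
  assume d: "1 \<le> d" and mk: "markov_kernel d f" and mono: "mono_on {-1..1} f \<or> antimono_on {-1..1} f"
    and cont: "continuous_on {-1..1} f" and lam0: "lam d f > 0" and q: "q > 1"
    and T: "is_tree T" "growth_at_most q T"
    and qle: "q \<le> 1 / (1 - 1 / 200 * (ln (lam d f) * (1 - lam d f)^2) / ln (lam d f * (1 - lam d f) / f 1))"
  have "mono_on {-1..1} f" using mono lam_nonpos[OF d mk _ cont] lam0 by fastforce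
  then interpret monotone_zonal_kernel d f by unfold_locales (use d mk cont in auto)
  let ?\<rho> = "lam d f"
  \<comment> \<open>At the value 1 the term subtracted in the threshold is 0, so the threshold would
    read \<open>q \<le> 1\<close>.\<close>
  have lam1: "?\<rho> < 1"
  proof (rule ccontr)
    assume "\<not> ?\<rho> < 1"
    then have "?\<rho> = 1" using lam_le_1 by simp
    then show False using qle q by simp
  qed
  define M where "M = ln (?\<rho> * (1 - ?\<rho>) / f 1) / ln ?\<rho>"
  define s where "s = exp (1 / (4 * M))"
  have M: "1 \<le> M" unfolding M_def by (rule mixing_rate(1)[OF lam0 lam1 one_le_f1])
  have mk': "mixing_kernel (sph d) (\<lambda>x y. f (ip d x y)) s"
    unfolding s_def M_def by (rule mixing_kernel_sph[OF lam0 lam1])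
  interpret K: mixing_kernel "sph d" "\<lambda>x y. f (ip d x y)" s by (rule mk')
  have r: "1 / 200 * (ln ?\<rho> * (1 - ?\<rho>)^2) / ln (?\<rho> * (1 - ?\<rho>) / f 1) = (1 - ?\<rho>)^2 / (200 * M)"
    using M by (simp add: M_def)
  have r2: "(1 - ?\<rho>)^2 / (200 * M) \<le> 1 / (200 * M)"
    using M lam0 lam1 by (intro divide_right_mono power_le_one) auto
  have r3: "1 / (200 * M) \<le> 1 / 200" using M by simp
  have "q \<le> 1 / (1 - (1 - ?\<rho>)^2 / (200 * M))" using qle by (simp only: r)
  also have "\<dots> \<le> 1 / (1 - 1 / (200 * M))" using r2 r3 by (intro divide_left_mono mult_pos_pos) auto
  finally have q1: "q \<le> 1 / (1 - 1 / (200 * M))" .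
  have "inverse s \<le> inverse (1 + 1 / (4 * M))"
    unfolding s_def using M exp_ge_add_one_self[of "1 / (4 * M)"] by (intro le_imp_inverse_le) (auto intro!: add_pos_pos)
  \<comment> \<open>Equivalent to \<open>4 * M + 1 \<le> 5 * M\<close>, i.e. to
    \<open>1 \<le> M\<close>.\<close>
  also have "\<dots> \<le> 1 - 1 / (5 * M)" using M by (simp add: field_simps)
  finally have "1 / (5 * M) \<le> 1 - 1 / s" by (simp add: inverse_eq_divide)
  \<comment> \<open>170 is 34 * 5: 34 from the definition of \<open>decay\<close>, 5 from the
    estimate of \<open>1 / s\<close>. The constant 1 / 200 is chosen below 1 / 170, so that
    \<open>q * K.decay\<close> is strictly less than 1.\<close>
  then have dec: "K.decay \<le> 1 - 1 / (170 * M)" by (simp add: K.decay_def)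
  have "q * K.decay \<le> 1 / (1 - 1 / (200 * M)) * (1 - 1 / (170 * M))"
    using q1 dec q K.decay_bounds by (intro mult_mono) auto
  also have "\<dots> < 1" using M by (simp add: field_simps)
  finally have "q * K.decay < 1" .
  then show "zero_percolation d f T" by (rule zero_percolation_mixing[OF mk' T q])
qed simp

end
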